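(* Let $G$ be a connected Lie group of real dimension $4$ with Lie algebra $\mathfrak{g}$, equipped with a left invariant metric $g$ and a compatible left invariant complex structure $J$. Assume that the Hermitian manifold $(G,J,g)$ has a flat $s$-Gauduchon connection $\nabla^s$ for some real number $s\neq 0,2$. Then either $G$ is isomorphic to a complex vector group, or its Lie algebra $\mathfrak{g}$ admits the orthogonal decomposition $$\mathfrak{g}=\mathfrak{c}\oplus\mathfrak{k},\qquad \text{with subalgebras } \mathfrak{c}=\operatorname{span}\{W\} \text{ and } \mathfrak{k}=\operatorname{span}\{X,Y,Z\},$$ where $\{X,Y,Z,W\}$ is an orthonormal basis of $\mathfrak{g}$, $\mathfrak{c}$ is the center of $\mathfrak{g}$, $$[X,Y]=qZ,\qquad [X,Z]=-qY,\qquad [Y,Z]=0,$$ where $q\neq 0$ is any given real number, and the complex structure $J$ is defined by $JX=W$ and $JY=Z$.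
   Context: On a Hermitian manifold $(M,J,g)$, a Hermitian connection is an affine connection $\nabla$ with $\nabla J=0$ and $\nabla g=0$; its torsion is $T(x,y)=\nabla_xy-\nabla_yx-[x,y]$. The Chern connection $\nabla^c$ is the unique Hermitian connection whose torsion has no $(1,1)$-component, i.e. $T(x,\overline{y})=0$ for $x,y$ of type $(1,0)$. The Bismut connection $\nabla^b$ is the unique Hermitian connection whose torsion is totally skew-symmetric, i.e. $g(T(x,y),z)$ is a $3$-form. For $s\in\mathbb{R}$ the $s$-Gauduchon connection is $\nabla^s=(1-\frac{s}{2})\nabla^c+\frac{s}{2}\nabla^b$. Flat means that the curvature tensor vanishes identically. Complex structures are integrable, and compatible means $g(Jx,Jy)=g(x,y)$. Left invariant tensors on $G$ are identified with their values on $\mathfrak{g}$. A complex vector group is the additive group of a complex vector space (here $\mathbb{C}^2$).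
   Formalization: "G is isomorphic to a complex vector group" fails for a flat complex torus; it is replaced by: C^2 covers G by a holomorphic group homomorphism, which is an isomorphism of complex Lie groups when G is simply connected. *)

theory Defs
  imports "HOL-Analysis.Analysis" "HOL-Library.Function_Algebras"
begin

text \<open>Functions into a real vector space form a real vector space pointwise. Vector fields are
  operators on functions, so this makes \<^const>\<open>span\<close> available for them.\<close>

instantiation "fun" :: (type, real_vector) real_vector
begin

definition scaleR_fun :: "real \<Rightarrow> ('a \<Rightarrow> 'b) \<Rightarrow> 'a \<Rightarrow> 'b"
  where "scaleR_fun c f = (\<lambda>x. c *\<^sub>R f x)"

instance
  by standard (auto simp: scaleR_fun_def plus_fun_def algebra_simps)

end


section \<open>Smooth manifolds and Lie groups\<close>

text \<open>Both predicates below are meant for open \<open>S\<close>.\<close>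

primrec Ck_on :: "nat \<Rightarrow> 'a::euclidean_space set \<Rightarrow> ('a \<Rightarrow> 'b::real_normed_vector) \<Rightarrow> bool" where
  "Ck_on 0 S f \<longleftrightarrow> continuous_on S f"
| "Ck_on (Suc k) S f \<longleftrightarrow>
     (\<forall>x\<in>S. f differentiable (at x)) \<and>
     (\<forall>v. Ck_on k S (\<lambda>x. frechet_derivative f (at x) v))"

definition smooth_on :: "'a::euclidean_space set \<Rightarrow> ('a \<Rightarrow> 'b::real_normed_vector) \<Rightarrow> bool"
  where "smooth_on S f \<longleftrightarrow> (\<forall>k. Ck_on k S f)"

type_synonym ('m, 'e) chart = "'m set \<times> ('m \<Rightarrow> 'e)"

definition is_atlas :: "('m::topological_space, 'e::euclidean_space) chart set \<Rightarrow> bool"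
  where "is_atlas A \<longleftrightarrow>
    (\<Union>(U, \<phi>)\<in>A. U) = UNIV \<and>
    (\<forall>(U, \<phi>)\<in>A. open U \<and> open (\<phi> ` U) \<and> homeomorphism U (\<phi> ` U) \<phi> (inv_into U \<phi>)) \<and>
    (\<forall>(U, \<phi>)\<in>A. \<forall>(V, \<psi>)\<in>A. smooth_on (\<phi> ` (U \<inter> V)) (\<psi> \<circ> inv_into U \<phi>))"

definition euclidean_atlas :: "('e::euclidean_space, 'e) chart set"
  where "euclidean_atlas = {(UNIV, id)}"

definition prod_atlas ::
    "('m, 'e) chart set \<Rightarrow> ('n, 'f) chart set \<Rightarrow> ('m \<times> 'n, 'e \<times> 'f) chart set"
  where "prod_atlas A B = {(U \<times> V, map_prod \<phi> \<psi>) | U \<phi> V \<psi>. (U, \<phi>) \<in> A \<and> (V, \<psi>) \<in> B}"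

definition smooth_map ::
    "('m::topological_space, 'e::euclidean_space) chart set \<Rightarrow>
     ('n::topological_space, 'f::euclidean_space) chart set \<Rightarrow> ('m \<Rightarrow> 'n) \<Rightarrow> bool"
  where "smooth_map A B F \<longleftrightarrow>
    continuous_on UNIV F \<and>
    (\<forall>(U, \<phi>)\<in>A. \<forall>(V, \<psi>)\<in>B. smooth_on (\<phi> ` (U \<inter> F -` V)) (\<psi> \<circ> F \<circ> inv_into U \<phi>))"

text \<open>The group law is written additively but is not commutative: \<^class>\<open>topological_group_add\<close>
  extends \<^class>\<open>group_add\<close>. The dimension is that of the model space \<open>'e\<close>.\<close>

definition is_lie_group ::
    "('g::{topological_group_add, t2_space}, 'e::euclidean_space) chart set \<Rightarrow> bool"
  where "is_lie_group A \<longleftrightarrow>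
    is_atlas A \<and> smooth_map (prod_atlas A A) A (\<lambda>(x, y). x + y) \<and> smooth_map A A uminus"


section \<open>Vector fields\<close>

definition smooth_functions ::
    "('m::topological_space, 'e::euclidean_space) chart set \<Rightarrow> ('m \<Rightarrow> real) set"
  where "smooth_functions A = {f. smooth_map A euclidean_atlas f}"

type_synonym 'm vfield = "('m \<Rightarrow> real) \<Rightarrow> ('m \<Rightarrow> real)"

text \<open>Vector fields are the derivations of the algebra of smooth functions, extended by zero to
  all functions so that equal derivations are equal operators.\<close>

definition vector_fields ::
    "('m::topological_space, 'e::euclidean_space) chart set \<Rightarrow> 'm vfield set"
  where "vector_fields A = {X.
    (\<forall>f\<in>smooth_functions A. X f \<in> smooth_functions A) \<and>
    (\<forall>f\<in>smooth_functions A. \<forall>h\<in>smooth_functions A. X (f + h) = X f + X h) \<and>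
    (\<forall>f\<in>smooth_functions A. \<forall>c. X (c *\<^sub>R f) = c *\<^sub>R X f) \<and>
    (\<forall>f\<in>smooth_functions A. \<forall>h\<in>smooth_functions A. X (f * h) = X f * h + f * X h) \<and>
    (\<forall>f. f \<notin> smooth_functions A \<longrightarrow> X f = 0)}"

definition fmult :: "('m \<Rightarrow> real) \<Rightarrow> 'm vfield \<Rightarrow> 'm vfield"
  where "fmult f X = (\<lambda>h. f * X h)"

definition bracket :: "'m vfield \<Rightarrow> 'm vfield \<Rightarrow> 'm vfield"
  where "bracket X Y = (\<lambda>f. X (Y f) - Y (X f))"

definition push_left :: "'g::group_add \<Rightarrow> 'g vfield \<Rightarrow> 'g vfield"
  where "push_left a X = (\<lambda>f p. X (\<lambda>x. f (a + x)) (- a + p))"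

definition lie_algebra ::
    "('g::{topological_group_add, t2_space}, 'e::euclidean_space) chart set \<Rightarrow> 'g vfield set"
  where "lie_algebra A = {X \<in> vector_fields A. \<forall>a. push_left a X = X}"


section \<open>Hermitian structures and connections\<close>

text \<open>Tensor fields are given by their action on vector fields, where they are linear over the
  smooth functions.\<close>

definition riemannian_metric ::
    "('m::topological_space, 'e::euclidean_space) chart set \<Rightarrow>
     ('m vfield \<Rightarrow> 'm vfield \<Rightarrow> 'm \<Rightarrow> real) \<Rightarrow> bool"
  where "riemannian_metric A g \<longleftrightarrow>
    (\<forall>X\<in>vector_fields A. \<forall>Y\<in>vector_fields A.
       g X Y \<in> smooth_functions A \<and> g X Y = g Y X \<and>
       (\<forall>Z\<in>vector_fields A. g (X + Z) Y = g X Y + g Z Y) \<and>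
       (\<forall>f\<in>smooth_functions A. g (fmult f X) Y = f * g X Y)) \<and>
    (\<forall>X\<in>vector_fields A. \<forall>p.
       g X X p \<ge> 0 \<and> (g X X p = 0 \<longrightarrow> (\<forall>f\<in>smooth_functions A. X f p = 0)))"

definition complex_structure ::
    "('m::topological_space, 'e::euclidean_space) chart set \<Rightarrow> ('m vfield \<Rightarrow> 'm vfield) \<Rightarrow> bool"
  where "complex_structure A J \<longleftrightarrow>
    (\<forall>X\<in>vector_fields A.
       J X \<in> vector_fields A \<and> J (J X) = - X \<and>
       (\<forall>Y\<in>vector_fields A. J (X + Y) = J X + J Y) \<and>
       (\<forall>f\<in>smooth_functions A. J (fmult f X) = fmult f (J X))) \<and>
    (\<forall>X\<in>vector_fields A. \<forall>Y\<in>vector_fields A.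
       bracket (J X) (J Y) = bracket X Y + J (bracket (J X) Y) + J (bracket X (J Y)))"

definition compatible ::
    "('m::topological_space, 'e::euclidean_space) chart set \<Rightarrow> ('m vfield \<Rightarrow> 'm vfield) \<Rightarrow>
     ('m vfield \<Rightarrow> 'm vfield \<Rightarrow> 'm \<Rightarrow> real) \<Rightarrow> bool"
  where "compatible A J g \<longleftrightarrow>
    (\<forall>X\<in>vector_fields A. \<forall>Y\<in>vector_fields A. g (J X) (J Y) = g X Y)"

definition left_invariant_metric ::
    "('g::{topological_group_add, t2_space}, 'e::euclidean_space) chart set \<Rightarrow>
     ('g vfield \<Rightarrow> 'g vfield \<Rightarrow> 'g \<Rightarrow> real) \<Rightarrow> bool"
  where "left_invariant_metric A g \<longleftrightarrow>
    (\<forall>X\<in>vector_fields A. \<forall>Y\<in>vector_fields A. \<forall>a p.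
       g (push_left a X) (push_left a Y) (a + p) = g X Y p)"

definition left_invariant_complex_structure ::
    "('g::{topological_group_add, t2_space}, 'e::euclidean_space) chart set \<Rightarrow>
     ('g vfield \<Rightarrow> 'g vfield) \<Rightarrow> bool"
  where "left_invariant_complex_structure A J \<longleftrightarrow>
    (\<forall>X\<in>vector_fields A. \<forall>a. J (push_left a X) = push_left a (J X))"

type_synonym 'm connection = "'m vfield \<Rightarrow> 'm vfield \<Rightarrow> 'm vfield"

definition affine_connection ::
    "('m::topological_space, 'e::euclidean_space) chart set \<Rightarrow> 'm connection \<Rightarrow> bool"
  where "affine_connection A D \<longleftrightarrow>
    (\<forall>X\<in>vector_fields A. \<forall>Y\<in>vector_fields A.
       D X Y \<in> vector_fields A \<and>
       (\<forall>Z\<in>vector_fields A. D (X + Z) Y = D X Y + D Z Y \<and> D X (Y + Z) = D X Y + D X Z) \<and>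
       (\<forall>f\<in>smooth_functions A.
          D (fmult f X) Y = fmult f (D X Y) \<and>
          D X (fmult f Y) = fmult (X f) Y + fmult f (D X Y)))"

definition hermitian_connection ::
    "('m::topological_space, 'e::euclidean_space) chart set \<Rightarrow> ('m vfield \<Rightarrow> 'm vfield) \<Rightarrow>
     ('m vfield \<Rightarrow> 'm vfield \<Rightarrow> 'm \<Rightarrow> real) \<Rightarrow> 'm connection \<Rightarrow> bool"
  where "hermitian_connection A J g D \<longleftrightarrow>
    affine_connection A D \<and>
    (\<forall>X\<in>vector_fields A. \<forall>Y\<in>vector_fields A. D X (J Y) = J (D X Y)) \<and>
    (\<forall>X\<in>vector_fields A. \<forall>Y\<in>vector_fields A. \<forall>Z\<in>vector_fields A.
       X (g Y Z) = g (D X Y) Z + g Y (D X Z))"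

definition torsion :: "'m connection \<Rightarrow> 'm vfield \<Rightarrow> 'm vfield \<Rightarrow> 'm vfield"
  where "torsion D X Y = D X Y - D Y X - bracket X Y"

text \<open>The fields of type (1,0) are \<open>X - i JX\<close>. The two equations below are the real and the
  imaginary part of \<open>T (X - i JX, Y + i JY) = 0\<close>, for \<open>T\<close> extended complex bilinearly.\<close>

definition chern_connection ::
    "('m::topological_space, 'e::euclidean_space) chart set \<Rightarrow> ('m vfield \<Rightarrow> 'm vfield) \<Rightarrow>
     ('m vfield \<Rightarrow> 'm vfield \<Rightarrow> 'm \<Rightarrow> real) \<Rightarrow> 'm connection \<Rightarrow> bool"
  where "chern_connection A J g D \<longleftrightarrow>
    hermitian_connection A J g D \<and>
    (\<forall>X\<in>vector_fields A. \<forall>Y\<in>vector_fields A.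
       torsion D X Y + torsion D (J X) (J Y) = 0 \<and>
       torsion D X (J Y) - torsion D (J X) Y = 0)"

definition bismut_connection ::
    "('m::topological_space, 'e::euclidean_space) chart set \<Rightarrow> ('m vfield \<Rightarrow> 'm vfield) \<Rightarrow>
     ('m vfield \<Rightarrow> 'm vfield \<Rightarrow> 'm \<Rightarrow> real) \<Rightarrow> 'm connection \<Rightarrow> bool"
  where "bismut_connection A J g D \<longleftrightarrow>
    hermitian_connection A J g D \<and>
    (\<forall>X\<in>vector_fields A. \<forall>Y\<in>vector_fields A. \<forall>Z\<in>vector_fields A.
       g (torsion D X Y) Z = - g (torsion D Y X) Z \<and>
       g (torsion D X Y) Z = - g (torsion D X Z) Y)"

text \<open>The Chern and the Bismut connection are unique as operations on vector fields, hence so is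
  the connection characterized here.\<close>

definition gauduchon_connection ::
    "('m::topological_space, 'e::euclidean_space) chart set \<Rightarrow> ('m vfield \<Rightarrow> 'm vfield) \<Rightarrow>
     ('m vfield \<Rightarrow> 'm vfield \<Rightarrow> 'm \<Rightarrow> real) \<Rightarrow> real \<Rightarrow> 'm connection \<Rightarrow> bool"
  where "gauduchon_connection A J g s D \<longleftrightarrow>
    (\<exists>Dc Db. chern_connection A J g Dc \<and> bismut_connection A J g Db \<and>
       (\<forall>X\<in>vector_fields A. \<forall>Y\<in>vector_fields A.
          D X Y = (1 - s / 2) *\<^sub>R Dc X Y + (s / 2) *\<^sub>R Db X Y))"

definition flat ::
    "('m::topological_space, 'e::euclidean_space) chart set \<Rightarrow> 'm connection \<Rightarrow> bool"
  where "flat A D \<longleftrightarrow>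
    (\<forall>X\<in>vector_fields A. \<forall>Y\<in>vector_fields A. \<forall>Z\<in>vector_fields A.
       D X (D Y Z) - D Y (D X Z) - D (bracket X Y) Z = 0)"


section \<open>Notions for the conclusion\<close>

definition center :: "'m vfield set \<Rightarrow> 'm vfield set"
  where "center L = {X \<in> L. \<forall>Y\<in>L. bracket X Y = 0}"

definition subalgebra :: "'m vfield set \<Rightarrow> 'm vfield set \<Rightarrow> bool"
  where "subalgebra H L \<longleftrightarrow> subspace H \<and> H \<subseteq> L \<and> (\<forall>X\<in>H. \<forall>Y\<in>H. bracket X Y \<in> H)"

text \<open>On left invariant fields a left invariant metric takes constant functions as values, and the
  \<open>0\<close> and \<open>1\<close> below are the constant functions.\<close>

definition orthonormal_basis ::
    "('m vfield \<Rightarrow> 'm vfield \<Rightarrow> 'm \<Rightarrow> real) \<Rightarrow> 'm vfield set \<Rightarrow> 'm vfield list \<Rightarrow> bool"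
  where "orthonormal_basis g L B \<longleftrightarrow>
    distinct B \<and> set B \<subseteq> L \<and> span (set B) = L \<and>
    (\<forall>X\<in>set B. \<forall>Y\<in>set B. g X Y = (if X = Y then 1 else 0))"

definition orthogonal_decomposition ::
    "('m vfield \<Rightarrow> 'm vfield \<Rightarrow> 'm \<Rightarrow> real) \<Rightarrow>
     'm vfield set \<Rightarrow> 'm vfield set \<Rightarrow> 'm vfield set \<Rightarrow> bool"
  where "orthogonal_decomposition g L H K \<longleftrightarrow>
    L = {X + Y | X Y. X \<in> H \<and> Y \<in> K} \<and> H \<inter> K = {0} \<and> (\<forall>X\<in>H. \<forall>Y\<in>K. g X Y = 0)"

text \<open>Homomorphisms of complex Lie groups from the vector group \<open>\<complex>\<^sup>2\<close>. The last clause says that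
  the differential of \<open>F\<close> is complex linear: it sends the constant field \<open>\<xi>\<close> to a field \<open>X\<close> and
  the constant field \<open>\<i> \<xi>\<close> to \<open>J X\<close>.\<close>

definition field_related ::
    "('m::topological_space, 'e::euclidean_space) chart set \<Rightarrow>
     ('a::euclidean_space \<Rightarrow> 'm) \<Rightarrow> 'a \<Rightarrow> 'm vfield \<Rightarrow> bool"
  where "field_related A F \<xi> X \<longleftrightarrow>
    (\<forall>f\<in>smooth_functions A. \<forall>u. X f (F u) = frechet_derivative (f \<circ> F) (at u) \<xi>)"

definition vector_group_hom ::
    "('g::{topological_group_add, t2_space}, 'e::euclidean_space) chart set \<Rightarrow>
     ('g vfield \<Rightarrow> 'g vfield) \<Rightarrow> (complex ^ 2 \<Rightarrow> 'g) \<Rightarrow> bool"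
  where "vector_group_hom A J F \<longleftrightarrow>
    (\<forall>u v. F (u + v) = F u + F v) \<and>
    smooth_map euclidean_atlas A F \<and>
    (\<forall>\<xi>. \<exists>X\<in>vector_fields A. field_related A F \<xi> X \<and> field_related A F (\<i> *s \<xi>) (J X))"

definition vector_group_iso ::
    "('g::{topological_group_add, t2_space}, 'e::euclidean_space) chart set \<Rightarrow>
     ('g vfield \<Rightarrow> 'g vfield) \<Rightarrow> (complex ^ 2 \<Rightarrow> 'g) \<Rightarrow> bool"
  where "vector_group_iso A J F \<longleftrightarrow>
    vector_group_hom A J F \<and> bij F \<and> smooth_map A euclidean_atlas (inv F)"

text \<open>A group with abelian Lie algebra, such as a flat complex torus, is a vector group only up to
  covering. Isomorphism is therefore asserted for simply connected \<open>G\<close>, and in general that \<open>\<complex>\<^sup>2\<close>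
  is the universal covering group of \<open>G\<close>.\<close>

definition covered_by_complex_vector_group ::
    "('g::{topological_group_add, t2_space}, 'e::euclidean_space) chart set \<Rightarrow>
     ('g vfield \<Rightarrow> 'g vfield) \<Rightarrow> bool"
  where "covered_by_complex_vector_group A J \<longleftrightarrow>
    (\<exists>F. vector_group_hom A J F \<and> covering_space UNIV F UNIV \<and>
       (simply_connected (UNIV :: 'g set) \<longrightarrow> vector_group_iso A J F))"

end

theory Submission
  imports Defs
begin

text \<open>Left invariance and the pointwise uniqueness of the Chern and the Bismut connection reduce the
  statement to linear algebra on the four-dimensional Lie algebra. There the Chern torsion \<open>T\<close>
  is complex bilinear, so in a suitable unitary frame \<open>T e f = l e\<close> for a real \<open>l\<close>. For a flat
  \<open>s\<close>-Gauduchon connection the first Bianchi identity is linear in the connection coefficients once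
  \<open>l\<close> is divided out; it forces \<open>7 t\<^sup>2 - 6 t + 1 = 0\<close> for \<open>t = s / 2\<close> and determines enough
  coefficients for one flatness equation to give a contradiction. Hence \<open>l = 0\<close>, the metric is Kaehler
  and the connection, now torsion free and flat, is a representation of the Lie algebra in the unitary
  Lie algebra with commuting image, from which the bracket can be read off.

  If the Lie algebra is abelian, the left invariant coframe is closed in a chart at the unit. By the
  Poincare lemma it has a primitive, whose local inverse is a local homomorphism; its extension to the
  vector group is the covering, and no flows of vector fields are needed.\<close>

subsection \<open>Unitary frames of a four-dimensional Hermitian vector space\<close>

text \<open>Left invariance of the Chern and Bismut connections and pointwise dependence of the
  tensors are not assumed: fields are derivations of global functions, and tensors are only linear
  over these. In a left invariant frame the components of a connection at two points satisfy the
  same inhomogeneous torsion equation, the inhomogeneity being the structure constants of the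
  bracket; uniqueness therefore makes the components constant. The linear algebra takes place in
  \<open>complex ^ 2\<close> with its standard inner product, because the inner product of the model
  space is unrelated to the metric; a unitary isomorphism \<kappa> carries one to the other. The
  excluded values of s are genuine: a nonabelian complex Lie group has a flat Chern connection (s =
  0) and SU(2) x R a flat Bismut connection (s = 2), both with nonzero torsion. So the elimination
  of \<open>l\<close> has to divide by t and by 1 - t. In the torsion free case the image of the
  representation commutes because su(2) has dimension three, one less than the Lie algebra: some
  nonzero element acts as a scalar, and that scalar turns out to be zero.\<close>

lemmas bilinear_simps =
  bilinear_ladd bilinear_radd bilinear_lmul bilinear_rmul bilinear_lneg bilinear_rneg
  bilinear_lzero bilinear_rzero bilinear_lsub bilinear_rsub

locale hermitian_space =
  fixes J :: "'a::euclidean_space \<Rightarrow> 'a"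
  assumes dim4: "DIM('a) = 4"
    and linear_J: "linear J"
    and JJ [simp]: "J (J x) = - x"
    and J_isometry [simp]: "J x \<bullet> J y = x \<bullet> y"
begin

lemmas J_add [simp] = linear_add[OF linear_J]
lemmas J_diff [simp] = linear_diff[OF linear_J]
lemmas J_neg [simp] = linear_neg[OF linear_J]
lemmas J_scale [simp] = linear_scale[OF linear_J]
lemmas J_0 [simp] = linear_0[OF linear_J]

lemma J_skew: "J x \<bullet> y = - (x \<bullet> J y)"
  using J_isometry[of x "J y"] by simp

lemma J_orth [simp]: "x \<bullet> J x = 0" "J x \<bullet> x = 0"
  using J_skew[of x x] by (simp_all add: inner_commute)

text \<open>As \<open>J\<close> is a skew isometry, these four equations already make
  \<open>e\<close>, \<open>J e\<close>, \<open>f\<close>, \<open>J f\<close> orthonormal.\<close>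

definition unitary_frame :: "'a \<Rightarrow> 'a \<Rightarrow> bool"
  where "unitary_frame e f \<longleftrightarrow> e \<bullet> e = 1 \<and> f \<bullet> f = 1 \<and> e \<bullet> f = 0 \<and> e \<bullet> J f = 0"

lemma unitary_frame_inner:
  assumes "unitary_frame e f"
  shows "e \<bullet> e = 1" "f \<bullet> f = 1" "e \<bullet> f = 0" "f \<bullet> e = 0" "e \<bullet> J f = 0" "J f \<bullet> e = 0"
    "f \<bullet> J e = 0" "J e \<bullet> f = 0"
proof -
  show "e \<bullet> e = 1" "f \<bullet> f = 1" "e \<bullet> f = 0" "e \<bullet> J f = 0"
    using assms by (auto simp: unitary_frame_def)
  then show "f \<bullet> e = 0" "J f \<bullet> e = 0" "f \<bullet> J e = 0" "J e \<bullet> f = 0"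
    using J_skew[of e f] by (simp_all add: inner_commute)
qed

lemma unitary_frame_expand:
  assumes "unitary_frame e f"
  shows "x = (x \<bullet> e) *\<^sub>R e + (x \<bullet> J e) *\<^sub>R J e + (x \<bullet> f) *\<^sub>R f + (x \<bullet> J f) *\<^sub>R J f"
proof -
  note ip = unitary_frame_inner[OF assms]
  let ?B = "{e, J e, f, J f}"
  have ne: "e \<noteq> J e" "e \<noteq> f" "e \<noteq> J f" "J e \<noteq> f" "J e \<noteq> J f" "f \<noteq> J f"
    using ip by (metis J_orth(1) zero_neq_one J_isometry)+
  have orth: "pairwise orthogonal ?B"
    by (auto simp: pairwise_def orthogonal_def ip)
  have norm1: "norm i = 1" if "i \<in> ?B" for i
    using that ip by (auto simp: norm_eq_sqrt_inner)
  have "independent ?B"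
    by (rule pairwise_orthogonal_independent[OF orth]) (use norm1 in force)
  moreover have "card ?B = DIM('a)"
    using ne dim4 by simp
  ultimately have "span ?B = UNIV"
    by (metis card_ge_dim_independent dim_UNIV order_refl subset_UNIV top.extremum_uniqueI)
  then have "(\<Sum>i\<in>?B. (x \<bullet> i) *\<^sub>R i) = x"
    by (intro orthonormal_basis_expand[OF orth norm1]) auto
  then show ?thesis
    using ne by (simp add: add.assoc)
qed

lemma unitary_frame_eqI:
  assumes "unitary_frame e f" "x \<bullet> e = y \<bullet> e" "x \<bullet> J e = y \<bullet> J e" "x \<bullet> f = y \<bullet> f" "x \<bullet> J f = y \<bullet> J f"
  shows "x = y"
  by (metis assms unitary_frame_expand)

lemma unitary_frame_exists:
  assumes "e \<bullet> e = 1"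
  obtains f where "unitary_frame e f"
proof -
  have "dim {e, J e} \<le> card {e, J e}"
    by (rule dim_le_card') simp
  also have "\<dots> < DIM('a)"
    using dim4 by (simp add: card_insert_if)
  finally obtain x where x: "x \<noteq> 0" "\<And>y. y \<in> span {e, J e} \<Longrightarrow> orthogonal x y"
    using orthogonal_to_subspace_exists by blast
  have "x \<bullet> e = 0" "x \<bullet> J e = 0"
    using x(2)[of e] x(2)[of "J e"] by (auto simp: orthogonal_def intro: span_base)
  then have "unitary_frame e (x /\<^sub>R norm x)"
    using assms x(1) J_skew[of e x]
    by (simp add: unitary_frame_def inner_commute power2_norm_eq_inner[symmetric] power2_eq_square)
  then show ?thesis ..
qed

text \<open>The next two lemmas are the uniqueness of the Chern and of the Bismut connection: \<open>c\<close> is the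
  difference of two such connections, lowered by the metric.\<close>

lemma chern_difference_zero:
  fixes c :: "'a \<Rightarrow> 'a \<Rightarrow> 'a \<Rightarrow> real"
  assumes neg: "\<And>x y z. c (- x) y z = - c x y z" "\<And>x y z. c x (- y) z = - c x y z"
      "\<And>x y z. c x y (- z) = - c x y z"
    and skew: "\<And>x y z. c x y z = - c x z y"
    and cJ: "\<And>x y z. c x (J y) z = - c x y (J z)"
    and t1: "\<And>x y z. c x y z - c y x z + (c (J x) (J y) z - c (J y) (J x) z) = 0"
  shows "c x y z = 0"
proof -
  \<comment> \<open>By \<open>t1\<close> this \<open>P\<close> is symmetric in its first two slots.
    But \<open>J\<close> moves from the first slot to the third with a plus sign and from the second
    with a minus sign, so \<open>P\<close> must vanish.\<close>
  define P where "P x y z = c x y z - c (J x) y (J z)" for x y z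
  have sym: "P x y z = P y x z" for x y z
    using t1[of x y z] cJ[of "J x" y z] cJ[of "J y" x z] by (simp add: P_def)
  have PJ: "P (J x) y z = P x y (J z)" "P x (J y) z = - P x y (J z)" for x y z
    using cJ[of x y z] cJ[of "J x" y "J z"] neg by (simp_all add: P_def)
  have "P x y (J z) = 0" for x y z
    using PJ(1)[of x y z] sym[of "J x" y z] PJ(2)[of y x z] sym[of x y "J z"] by simp
  then have "P x y z = 0" for x y z
    using neg(3) by (metis JJ P_def diff_self neg_0_equal_iff_equal minus_equation_iff
        PJ sym)
  then have cP: "c x y z = c (J x) y (J z)" for x y z
    by (simp add: P_def)
  \<comment> \<open>Together with \<open>cP\<close> and skewness this gives \<open>c x y z = c (J x)
    y (J z) = - c (J x) (J z) y = c (J x) z (J y) = c x z y = - c x y z\<close>.\<close>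
  have "c (J x) y (J z) = - c (J x) (J y) z" for x y z
    using cJ[of "J x" y z] by simp
  then show ?thesis
    using cP skew by (smt (verit, best))
qed

lemma bismut_difference_zero:
  fixes c :: "'a \<Rightarrow> 'a \<Rightarrow> 'a \<Rightarrow> real"
  assumes neg: "\<And>x y z. c (- x) y z = - c x y z" "\<And>x y z. c x (- y) z = - c x y z"
      "\<And>x y z. c x y (- z) = - c x y z"
    and skew: "\<And>x y z. c x y z = - c x z y"
    and cJ: "\<And>x y z. c x (J y) z = - c x y (J z)"
    and t: "\<And>x y z. c x y z - c y x z = - (c x z y - c z x y)"
  shows "c x y z = 0"
proof -
  \<comment> \<open>With \<open>skew\<close>, the torsion condition makes \<open>c\<close> a 3-form.
    Then \<open>J\<close> can be moved between any two slots at the cost of a sign; a round trip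
    through all three slots costs three signs, so \<open>c x (J y) z\<close> equals its own
    negative.\<close>
  have s13: "c y x z = - c z x y" for x y z
    using t[of x y z] skew[of x y z] skew[of z x y] by simp
  have JJc: "c x (J y) (J z) = c x y z" for x y z
    using cJ[of x y "J z"] neg by simp
  have s12: "c x y z = - c y x z" for x y z
    using s13 skew by metis
  have JJc': "c (J x) (J y) z = c x y z" for x y z
    using JJc[of z x y] s13 skew s12 by metis
  have "c x (J y) z = - c (J x) y z" for x y z
    using JJc'[of x "J y" z] neg by simp
  then have "c x (J y) z = - c x (J y) z" for x y z
    using cJ s12 s13 skew by (smt (verit, best))
  then have "c x (J y) z = 0" for x y z
    by (smt (verit))
  then show ?thesis
    using neg(2) by (metis JJ minus_equation_iff neg_0_equal_iff_equal)
qed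

end

subsection \<open>Flat Hermitian Lie algebras\<close>

lemma eq_neg_imp_zero: "x = - x \<Longrightarrow> x = (0::'a::real_vector)"
  by (simp add: eq_neg_iff_add_eq_0 scaleR_2[symmetric])

locale hermitian_lie_algebra = hermitian_space +
  fixes br :: "'a \<Rightarrow> 'a \<Rightarrow> 'a"
  assumes bilinear_br: "bilinear br"
    and br_skew: "br x y = - br y x"
    and jacobi: "br x (br y z) + br y (br z x) + br z (br x y) = 0"

locale flat_hermitian = hermitian_lie_algebra +
  fixes D :: "'a \<Rightarrow> 'a \<Rightarrow> 'a"
  assumes bilinear_D: "bilinear D"
    and D_J: "D x (J y) = J (D x y)"
    and D_skew: "D x y \<bullet> z = - (y \<bullet> D x z)"
    and flat: "D (br x y) z = D x (D y z) - D y (D x z)"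
begin

lemmas D_simps [simp] = bilinear_simps[OF bilinear_D]
lemmas br_simps [simp] = bilinear_simps[OF bilinear_br]

definition S where "S x y = D x y - D y x - br x y"

lemma bilinear_S: "bilinear S"
  by (auto simp: bilinear_def S_def linear_iff algebra_simps)

lemmas S_simps [simp] = bilinear_simps[OF bilinear_S]

lemma S_skew: "S x y = - S y x"
  using br_skew[of x y] by (simp add: S_def)

text \<open>Once \<open>S\<close> is unfolded, flatness cancels the terms containing
  \<open>D\<close> and only the Jacobi identity remains. The first three groups are the covariant
  derivatives of the torsion.\<close>

lemma bianchi:
  "D x (S y z) - S (D x y) z - S y (D x z) + (D y (S z x) - S (D y z) x - S z (D y x))
    + (D z (S x y) - S (D z x) y - S x (D z y)) + S (S x y) z + S (S y z) x + S (S z x) y = 0"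
proof -
  have "br (br x y) z + br (br y z) x + br (br z x) y
      = - (br x (br y z) + br y (br z x) + br z (br x y))"
    using br_skew[of "br x y" z] br_skew[of "br y z" x] br_skew[of "br z x" y] by simp
  then have j: "br (br x y) z + br (br y z) x + br (br z x) y = 0"
    by (simp only: jacobi)  simp
  have "?thesis \<longleftrightarrow> br (br x y) z + br (br y z) x + br (br z x) y = 0"
    using br_skew[of x "D z y"] br_skew[of x "D y z"] br_skew[of y "D z x"] br_skew[of y "D x z"]
      br_skew[of z "D x y"] br_skew[of z "D y x"]
    by (simp add: S_def flat algebra_simps)
  with j show ?thesis by simp
qed

text \<open>Here \<open>T\<close> plays the Chern torsion and \<open>t\<close> is s / 2; the
  hypothesis \<open>tor\<close> expresses the torsion of the Gauduchon connection through
  \<open>T\<close>. The special form of \<open>T e f\<close> is no restriction, as it is reached by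
  a choice of frame.\<close>

lemma torsion_scale_zero:
  fixes T :: "'a \<Rightarrow> 'a \<Rightarrow> 'a" and t l :: real
  assumes fr: "unitary_frame e f"
    and bT: "bilinear T" and T_skew: "\<And>x y. T x y = - T y x" and T_J: "\<And>x y. T (J x) y = J (T x y)"
    and tor: "\<And>x y z. S x y \<bullet> z = (1 - 2 * t) * (T x y \<bullet> z) + t * (y \<bullet> T x z - x \<bullet> T y z)"
    and Tef: "T e f = l *\<^sub>R e"
    and t: "t \<noteq> 0" "t \<noteq> 1"
  shows "l = 0"
proof (rule ccontr)
  assume l: "l \<noteq> 0"
  note ip = unitary_frame_inner[OF fr]
  note eqI = unitary_frame_eqI[OF fr]
  have TJ2: "T x (J y) = J (T x y)" for x y
    using T_skew[of x y] T_skew[of x "J y"] T_J[of y x] by simp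
  have Txx: "T x x = 0" for x
    using T_skew[of x x] by (rule eq_neg_imp_zero)
  have Tfe: "T f e = - l *\<^sub>R e"
    using T_skew[of f e] Tef by simp
  have S_self [simp]: "S x x = 0" for x
    using S_skew[of x x] by (rule eq_neg_imp_zero)
  have S1: "S e (J e) = (2 * t * l) *\<^sub>R J f" "S e f = ((1 - t) * l) *\<^sub>R e"
    "S e (J f) = ((1 - 3 * t) * l) *\<^sub>R J e" "S (J e) f = ((1 - t) * l) *\<^sub>R J e"
    "S (J e) (J f) = ((3 * t - 1) * l) *\<^sub>R e" "S f (J f) = 0"
    by (rule eqI; simp add: tor T_J TJ2 Txx Tef Tfe ip algebra_simps)+
  have S2: "S (J e) e = - (2 * t * l) *\<^sub>R J f" "S f e = - ((1 - t) * l) *\<^sub>R e"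
    "S (J f) e = - ((1 - 3 * t) * l) *\<^sub>R J e" "S f (J e) = - ((1 - t) * l) *\<^sub>R J e"
    "S (J f) (J e) = - ((3 * t - 1) * l) *\<^sub>R e" "S (J f) f = 0"
    using S1 S_skew by (metis scaleR_minus_left minus_zero)+
  \<comment> \<open>\<open>D v\<close> is a skew-Hermitian 2 by 2 matrix: \<open>p\<close> and
    \<open>k\<close> are its imaginary diagonal entries, \<open>q\<close> and \<open>r\<close> the
    real and imaginary part of the off-diagonal one.\<close>
  define p q r k where "p v = D v e \<bullet> J e" and "q v = D v e \<bullet> f" and "r v = D v e \<bullet> J f"
    and "k v = D v f \<bullet> J f" for v
  have sk: "D v x \<bullet> x = 0" for v x
    using D_skew[of v x x] by (simp add: inner_commute)
  have De: "D v e = p v *\<^sub>R J e + q v *\<^sub>R f + r v *\<^sub>R J f" for v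
    by (rule eqI) (simp_all add: ip inner_simps p_def q_def r_def sk)
  have Df: "D v f = - q v *\<^sub>R e + r v *\<^sub>R J e + k v *\<^sub>R J f" for v
    by (rule eqI) (use D_skew[of v f e] D_skew[of v f "J e"] J_skew[of "D v e" f] sk[of v f] in 
      \<open>simp_all add: ip inner_simps q_def r_def k_def sk D_J inner_commute\<close>)
  have DJe: "D v (J e) = - p v *\<^sub>R e + q v *\<^sub>R J f - r v *\<^sub>R f" for v
    by (simp add: D_J De)
  have DJf: "D v (J f) = - q v *\<^sub>R J e - r v *\<^sub>R e - k v *\<^sub>R f" for v
    by (simp add: D_J Df)
  have lin: "p (x + y) = p x + p y" "p (c *\<^sub>R x) = c * p x" "q (x + y) = q x + q y" "q (c *\<^sub>R x) = c * q x"
     "r (x + y) = r x + r y" "r (c *\<^sub>R x) = c * r x" "k (x + y) = k x + k y" "k (c *\<^sub>R x) = c * k x"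
     "p (x - y) = p x - p y" "q (x - y) = q x - q y" "r (x - y) = r x - r y" "k (x - y) = k x - k y" for x y c
    by (simp_all add: p_def q_def r_def k_def inner_simps)
  note tab = De Df DJe DJf S1 S2 lin
  have c: "x = 0 \<Longrightarrow> x \<bullet> e = 0 \<and> x \<bullet> J e = 0 \<and> x \<bullet> f = 0 \<and> x \<bullet> J f = 0" for x :: 'a
    by simp
  \<comment> \<open>The Bianchi sum is alternating in its three arguments, so these four triples of
    frame vectors exhaust it.\<close>
  note B1 = c[OF bianchi[of e "J e" f]]
  note B2 = c[OF bianchi[of e "J e" "J f"]]
  note B3 = c[OF bianchi[of e f "J f"]]
  note B4 = c[OF bianchi[of "J e" f "J f"]]
  have E1: "k e = 0" "k (J e) = 0" "l * ((1 - t) * (r e + q (J e))) = 0"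
      "l * ((1 - 3 * t) * (r (J e) - q e)) = l * (2 * t * k (J f))"
    using B2 by (auto simp: tab inner_simps ip l t algebra_simps)
  have E2: "l * ((1 - 3 * t) * (q e - r (J e))) = l * (4 * t * (1 - t) * l)"
    using B1 by (simp add: tab inner_simps ip l t algebra_simps)
  have E2': "l * (t * r e) + l * (t * q (J e)) = l * r e + (l * q (J e) + l * (t * (k f * 2)))"
    using B1 by (simp add: tab inner_simps ip l t algebra_simps)
  have E3: "l * ((3 * t - 1) * k (J f)) = l * (2 * t * q e)" "l * ((t - 1) * k f) = l * (2 * t * r e)"
      "l * ((1 - 3 * t) * r (J f)) = l * ((1 - t) * q f)"
      "l * ((1 - 3 * t) * (- r f)) = l * ((1 - t) * q (J f))"
    using B3 by (simp_all add: tab inner_simps ip l t algebra_simps)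
  have E4: "l * ((1 - 3 * t) * k (J f)) = l * (2 * t * r (J e))"
      "l * ((1 - 3 * t) * q f) = l * ((1 - t) * r (J f))"
      "l * ((1 - 3 * t) * q (J f)) = l * ((1 - t) * (- r f))"
    using B4 by (simp_all add: tab inner_simps ip l t algebra_simps)
  have qr: "q (J e) = - r e"
    using E1(3) l t by simp
  have kf: "k f = 0"
    using E2' l t by (simp add: qr)
  have re: "r e = 0"
    using E3(2) l t by (simp add: kf)
  have r2: "r (J e) = - q e"
  proof -
    have "l * t * (r (J e) + q e) = 0"
      using E3(1) E4(1) by (simp add: algebra_simps)
    then have "r (J e) + q e = 0"
      using l t by (metis mult_eq_0_iff zero_neq_numeral)
    then show ?thesis
      by linarith
  qed
  have q1: "(1 - 3 * t) * q e = 2 * t * (1 - t) * l"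
  proof -
    have "l * (2 * ((1 - 3 * t) * q e - 2 * t * (1 - t) * l)) = 0"
      using E2 unfolding r2 by algebra
    then have "(1 - 3 * t) * q e - 2 * t * (1 - t) * l = 0"
      using l t by (metis mult_eq_0_iff zero_neq_numeral)
    then show ?thesis
      by linarith
  qed
  have k4: "k (J f) = - 2 * (1 - t) * l"
  proof -
    have "l * (2 * t * (k (J f) + 2 * (1 - t) * l)) = 0"
      using E1(4) q1 unfolding r2 by algebra
    then have "k (J f) + 2 * (1 - t) * l = 0"
      using l t by (metis mult_eq_0_iff zero_neq_numeral)
    then show ?thesis
      by linarith
  qed
  have tq: "t * q e = (1 - 3 * t) * ((1 - t) * l)"
  proof -
    have "l * (2 * (t * q e - (1 - 3 * t) * ((1 - t) * l))) = 0"
      using E3(1) unfolding k4 by algebra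
    then have "t * q e - (1 - 3 * t) * ((1 - t) * l) = 0"
      using l t by (metis mult_eq_0_iff zero_neq_numeral)
    then show ?thesis
      by linarith
  qed
  \<comment> \<open>The formulas \<open>q1\<close> and \<open>tq\<close> for \<open>q e\<close>
    agree only if \<open>7 * t * t - 6 * t + 1 = 0\<close>, which rules out
    \<open>t = 1 / 2\<close>.\<close>
  have "t * ((1 - 3 * t) * q e) = (1 - 3 * t) * (t * q e)"
    by simp
  then have "(1 - t) * l * (2 * t * t) = (1 - t) * l * ((1 - 3 * t) * (1 - 3 * t))"
    unfolding q1 tq by (simp add: algebra_simps)
  then have tt: "2 * t * t = (1 - 3 * t) * (1 - 3 * t)"
    using l t by simp
  have th: "t \<noteq> 1 / 2"
  proof
    assume "t = 1 / 2"
    with tt show False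
      by (simp add: field_simps)
  qed
  \<comment> \<open>The pairs \<open>(r (J f), q f)\<close> and \<open>(- r f, q (J f))\<close>
    solve the same homogeneous system. Its determinant is, up to sign,
    \<open>4 * t * (1 - 2 * t)\<close>, which is not zero.\<close>
  have zero: "x = 0 \<and> y = 0" if 1: "(1 - 3 * t) * x = (1 - t) * y" and 2: "(1 - 3 * t) * y = (1 - t) * x" for x y
  proof -
    have "(1 - 3 * t) * ((1 - 3 * t) * x) = (1 - t) * ((1 - t) * x)"
      unfolding 1 by (metis 2 mult.left_commute)
    then have "4 * t * (1 - 2 * t) * x = 0"
      by algebra
    then have "x = 0"
      using t th by simp
    then show ?thesis
      using 1 t by simp
  qed
  have rf: "r (J f) = 0" "q f = 0"
    using zero[of "r (J f)" "q f"] E3(3) E4(2) l by simp_all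
  have qJf: "r f = 0" "q (J f) = 0"
  proof -
    have "(1 - 3 * t) * (- r f) = (1 - t) * q (J f)" "(1 - 3 * t) * q (J f) = (1 - t) * (- r f)"
      using E3(4) E4(3) l by (simp_all only: mult_cancel_left) simp_all
    then show "r f = 0" "q (J f) = 0"
      using zero[of "- r f" "q (J f)"] by simp_all
  qed
  have Sef: "br e f = D e f - D f e - S e f"
    by (simp add: S_def)
  \<comment> \<open>By now most coefficients vanish, so this component of the curvature is a
    quadratic equation in \<open>q e\<close> alone. Its two roots contradict \<open>q1\<close> and
    \<open>tq\<close> respectively.\<close>
  have "(D e (D f f) - D f (D e f) - D (br e f) f) \<bullet> e = 0"
    using flat[of e f f] by simp
  then have "q e * (q e + (1 - t) * l) = 0"
    unfolding Sef by (simp add: tab inner_simps ip re kf E1 rf qJf qr algebra_simps)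
  then have "q e = 0 \<or> q e + (1 - t) * l = 0"
    by (simp only: mult_eq_0_iff)
  moreover have "q e = - (1 - t) * l" if "q e + (1 - t) * l = 0"
    using that by linarith
  ultimately consider "q e = 0" | "q e = - (1 - t) * l"
    by blast
  then show False
  proof cases
    case 1
    then show False
      using q1 t l by simp
  next
    case 2
    have "t * (- (1 - t) * l) = (1 - 3 * t) * ((1 - t) * l)"
      using tq unfolding 2 .
    then have "(1 - t) * l * (2 * t - 1) = 0"
      by (simp add: algebra_simps)
    then show False
      using t l th by simp
  qed
qed

end

text \<open>Each functional is the inner product with its adjoint at 1, and three vectors cannot
  span a space of dimension greater than three.\<close>

lemma linear_functional_common_zero:
  fixes p q r :: "'a::euclidean_space \<Rightarrow> real"
  assumes "DIM('a) > 3" "linear p" "linear q" "linear r"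
  obtains x where "x \<noteq> 0" "p x = 0" "q x = 0" "r x = 0"
proof -
  let ?S = "{adjoint p 1, adjoint q 1, adjoint r 1}"
  have "dim ?S \<le> card ?S"
    by (rule dim_le_card') simp
  also have "\<dots> \<le> 3"
    by (simp add: card_insert_if)
  finally obtain x where x: "x \<noteq> 0" "\<And>y. y \<in> span ?S \<Longrightarrow> orthogonal x y"
    using orthogonal_to_subspace_exists[of ?S] assms(1) by auto
  have "x \<bullet> adjoint p 1 = 0" "x \<bullet> adjoint q 1 = 0" "x \<bullet> adjoint r 1 = 0"
    using x(2) by (auto simp: orthogonal_def intro: span_base)
  with x(1) that[of x] assms show ?thesis
    by (simp add: adjoint_works)
qed

section \<open>The torsion free case: flat Kaehler Lie algebras\<close>

locale flat_kaehler = flat_hermitian +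
  assumes torsion_free: "br x y = D x y - D y x"
begin

definition U where "U = {x. \<forall>y. D x y = 0}"

lemma subspace_U: "subspace U"
  by (auto simp: subspace_def U_def)

text \<open>The kernel of a representation is an ideal, and for \<open>v\<close> in the kernel the
  torsion free condition turns \<open>D x v\<close> into the bracket of \<open>x\<close> and
  \<open>v\<close>.\<close>

lemma U_D: "D x v \<in> U" if "v \<in> U" for v
proof -
  have "br x v = D x v"
    using that torsion_free[of x v] by (simp add: U_def)
  moreover have "D (br x v) z = 0" for z
    using that by (simp add: flat U_def)
  ultimately show ?thesis
    by (simp add: U_def)
qed

lemma perp_D: "u \<bullet> D x b = 0" if "\<And>u. u \<in> U \<Longrightarrow> u \<bullet> b = 0" "u \<in> U"
  using that U_D[of u x] D_skew[of x u b] by simp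

lemma U_decomp:
  obtains u b where "x = u + b" "u \<in> U" "\<And>u. u \<in> U \<Longrightarrow> u \<bullet> b = 0"
  using orthogonal_subspace_decomp_exists[of U x] subspace_U
  by (metis orthogonal_def span_eq_iff orthogonal_commute)

lemma D_self: "D v x \<bullet> x = 0" "x \<bullet> D v x = 0"
  using D_skew[of v x x] by (simp_all add: inner_commute)

text \<open>The component \<open>b\<close> of \<open>C\<close> orthogonal to the kernel
  \<open>U\<close> acts like \<open>C\<close>. As \<theta> \<open>J\<close> commutes with every
  \<open>D x\<close>, the bracket of \<open>J b\<close> and \<open>b\<close> lies in
  \<open>U\<close>; but it equals \<open>D (J b) b + \<theta> *\<^sub>R b\<close>, which is
  orthogonal to \<open>U\<close>. Hence it is zero, and pairing it with \<open>b\<close> leaves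
  \<theta> times the square of the norm of \<open>b\<close>.\<close>

lemma complex_scalar_zero:
  assumes C: "\<And>x. D C x = \<theta> *\<^sub>R J x"
  shows "\<theta> = 0"
proof (rule ccontr)
  assume th: "\<theta> \<noteq> 0"
  obtain u b where ub: "C = u + b" "u \<in> U" "\<And>u. u \<in> U \<Longrightarrow> u \<bullet> b = 0"
    using U_decomp by metis
  have Db: "D b x = \<theta> *\<^sub>R J x" for x
    using C[of x] ub by (simp add: U_def)
  have JU: "J v \<in> U" if "v \<in> U" for v
    using subspace_scale[OF subspace_U U_D[OF that, of C], of "inverse \<theta>"] th by (simp add: C)
  let ?z = "br (J b) b"
  have z: "?z = D (J b) b + \<theta> *\<^sub>R b"
    using torsion_free[of "J b" b] by (simp add: Db)
  have "?z \<in> U"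
    by (simp add: U_def flat Db D_J)
  moreover have "v \<bullet> ?z = 0" if "v \<in> U" for v
    using perp_D[OF ub(3) that, of "J b"] ub(3)[OF that] by (simp add: z inner_simps)
  ultimately have "?z = 0"
    using inner_eq_zero_iff by blast
  then have "\<theta> * (b \<bullet> b) = 0"
    using D_self[of "J b" b] by (metis add.left_neutral inner_add_left inner_scaleR_left inner_zero_left z)
  then have "b = 0"
    using th by simp
  then have "J x = 0" for x
    using Db[of x] th by simp
  then have "x = 0" for x :: 'a
    by (metis JJ J_0 neg_0_equal_iff_equal)
  moreover have "DIM('a) \<noteq> 0" "\<And>b::'a. b \<in> Basis \<Longrightarrow> b \<noteq> 0"
    using dim4 by auto
  ultimately show False
    by (metis all_not_in_conv nonempty_Basis)
qed

lemma frame_D: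
  assumes fr: "unitary_frame e f"
  defines "p \<equiv> \<lambda>v. D v e \<bullet> J e" and "q \<equiv> \<lambda>v. D v e \<bullet> f" and "r \<equiv> \<lambda>v. D v e \<bullet> J f" and "k \<equiv> \<lambda>v. D v f \<bullet> J f"
  shows "D v e = p v *\<^sub>R J e + q v *\<^sub>R f + r v *\<^sub>R J f"
    and "D v f = - q v *\<^sub>R e + r v *\<^sub>R J e + k v *\<^sub>R J f"
proof -
  note ip = unitary_frame_inner[OF fr]
  note eqI = unitary_frame_eqI[OF fr]
  show "D v e = p v *\<^sub>R J e + q v *\<^sub>R f + r v *\<^sub>R J f"
    by (rule eqI) (simp_all add: ip inner_simps p_def q_def r_def D_self)
  show "D v f = - q v *\<^sub>R e + r v *\<^sub>R J e + k v *\<^sub>R J f"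
    by (rule eqI) (use D_skew[of v f e] D_skew[of v f "J e"] J_skew[of "D v e" f] in
      \<open>simp_all add: ip inner_simps q_def r_def k_def D_self D_J inner_commute\<close>)
qed

lemma commute_frame:
  assumes fr: "unitary_frame e f"
    and "D x (D y e) = D y (D x e)" "D x (D y f) = D y (D x f)"
  shows "D x (D y z) = D y (D x z)"
  by (subst (1 2) unitary_frame_expand[OF fr, of z]) (simp add: D_J assms)

text \<open>The three functionals below measure the su(2)-part of \<open>D C\<close>, so some
  nonzero \<open>C\<close> acts as a scalar and therefore trivially. If all \<open>D v\<close> kill
  \<open>C\<close>, the image lies in a one-dimensional u(1). Otherwise \<open>D X0 C\<close> is a
  second kernel vector, the image is spanned by two operators, and a subalgebra of u(2) spanned by
  two elements is abelian.\<close>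

lemma D_commute: "D x (D y z) = D y (D x z)"
proof -
  obtain e0 :: 'a where "e0 \<bullet> e0 = 1"
    using nonempty_Basis inner_same_Basis by blast
  then obtain f0 where fr0: "unitary_frame e0 f0"
    using unitary_frame_exists by blast
  obtain C where C: "C \<noteq> 0" "D C e0 \<bullet> f0 = 0" "D C e0 \<bullet> J f0 = 0"
      "D C e0 \<bullet> J e0 - D C f0 \<bullet> J f0 = 0"
    by (rule linear_functional_common_zero[of "\<lambda>v. D v e0 \<bullet> f0" "\<lambda>v. D v e0 \<bullet> J f0"
          "\<lambda>v. D v e0 \<bullet> J e0 - D v f0 \<bullet> J f0"])
      (use dim4 in \<open>auto simp: linear_iff inner_simps algebra_simps\<close>)
  define \<theta> where "\<theta> = D C e0 \<bullet> J e0"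
  have "D C e0 = \<theta> *\<^sub>R J e0" "D C f0 = \<theta> *\<^sub>R J f0"
    using frame_D[OF fr0, of C] C unitary_frame_inner[OF fr0] by (simp_all add: \<theta>_def)
  then have DC: "D C x = \<theta> *\<^sub>R J x" for x
    by (subst (1 2) unitary_frame_expand[OF fr0, of x]) (simp add: D_J algebra_simps)
  then have "\<theta> = 0"
    by (rule complex_scalar_zero)
  with DC have CU: "C \<in> U"
    by (simp add: U_def)
  show ?thesis
  proof (cases "\<forall>v. D v C = 0")
    case True
    have e: "(C /\<^sub>R norm C) \<bullet> (C /\<^sub>R norm C) = 1"
      using C(1) by (simp add: power2_norm_eq_inner[symmetric] power2_eq_square)
    then obtain f where fr: "unitary_frame (C /\<^sub>R norm C) f"
      using unitary_frame_exists by blast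
    have De: "D v (C /\<^sub>R norm C) = 0" for v
      using True by simp
    have "D v f = (D v f \<bullet> J f) *\<^sub>R J f" for v
      using frame_D(2)[OF fr, of v] unfolding De by simp
    then have Df: "D x (D y f) = (- (D x f \<bullet> J f) * (D y f \<bullet> J f)) *\<^sub>R f" for x y
      by (metis D_J D_simps(4) J_scale JJ mult.commute mult_minus_left scaleR_minus_left scaleR_minus_right scaleR_scaleR)
    show ?thesis
      by (rule commute_frame[OF fr]) (simp_all add: True Df mult.commute)
  next
    case False
    then obtain X0 where X0: "D X0 C \<noteq> 0" by blast
    define V where "V = D X0 C"
    have V: "V \<noteq> 0" "V \<in> U" "V \<bullet> C = 0"
      using X0 U_D[OF CU] D_self by (auto simp: V_def)
    have "dim {C, V} \<le> card {C, V}" "dim {C, V, X} \<le> card {C, V, X}" for X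
      by (rule dim_le_card', simp)+
    moreover have "card {C, V} \<le> 2" "card {C, V, X} \<le> 3" for X
      by (simp_all add: card_insert_if)
    ultimately have dims: "dim {C, V} < DIM('a)" "dim {C, V, X} < DIM('a)" for X
      using dim4 by (metis le_trans linorder_not_less numeral_le_iff semiring_norm(69,71,72))+
    obtain X1 where X1: "X1 \<noteq> 0" "\<And>y. y \<in> span {C, V} \<Longrightarrow> orthogonal X1 y"
      using orthogonal_to_subspace_exists[OF dims(1)] by blast
    obtain X2 where X2: "X2 \<noteq> 0" "\<And>y. y \<in> span {C, V, X1} \<Longrightarrow> orthogonal X2 y"
      using orthogonal_to_subspace_exists[OF dims(2)] by blast
    have o: "X1 \<bullet> C = 0" "X1 \<bullet> V = 0" "X2 \<bullet> C = 0" "X2 \<bullet> V = 0" "X2 \<bullet> X1 = 0"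
      using X1(2)[of C] X1(2)[of V] X2(2)[of C] X2(2)[of V] X2(2)[of X1]
      by (auto simp: orthogonal_def intro: span_base)
    have ne: "C \<noteq> V" "C \<noteq> X1" "C \<noteq> X2" "V \<noteq> X1" "V \<noteq> X2" "X1 \<noteq> X2"
      using o V C(1) X1(1) X2(1) by (metis inner_eq_zero_iff)+
    have "independent {C, V, X1, X2}"
      by (rule pairwise_orthogonal_independent)
        (use o V C(1) X1(1) X2(1) in \<open>auto simp: pairwise_def orthogonal_def inner_commute\<close>)
    moreover have "card {C, V, X1, X2} = DIM('a)"
      using ne dim4 by simp
    ultimately have sp: "span {C, V, X1, X2} = UNIV"
      by (metis card_ge_dim_independent dim_UNIV order_refl subset_UNIV top.extremum_uniqueI)
    have comb: "\<exists>c d. \<forall>z. D x z = c *\<^sub>R D X1 z + d *\<^sub>R D X2 z" for x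
    proof -
      have "x \<in> span {C, V, X1, X2}"
        by (simp add: sp)
      then obtain a b c d where "x = a *\<^sub>R C + b *\<^sub>R V + c *\<^sub>R X1 + d *\<^sub>R X2"
        by (auto simp: span_insert span_empty algebra_simps eq_diff_eq diff_eq_eq) 
      then have "D x z = c *\<^sub>R D X1 z + d *\<^sub>R D X2 z" for z
        using CU V(2) by (simp add: U_def)
      then show ?thesis by blast
    qed
    obtain c d where cd: "D (br X1 X2) z = c *\<^sub>R D X1 z + d *\<^sub>R D X2 z" for z
      using comb by blast
    have com: "D X1 (D X2 z) - D X2 (D X1 z) = c *\<^sub>R D X1 z + d *\<^sub>R D X2 z" for z
      using cd[of z] by (simp add: flat)
    define p q r k where "p v = D v e0 \<bullet> J e0" and "q v = D v e0 \<bullet> f0" and "r v = D v e0 \<bullet> J f0"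
      and "k v = D v f0 \<bullet> J f0" for v
    note De = frame_D(1)[OF fr0, folded p_def q_def r_def k_def]
    note Df = frame_D(2)[OF fr0, folded p_def q_def r_def k_def]
    note ip = unitary_frame_inner[OF fr0]
    let ?m = "\<lambda>v. p v - k v"
    let ?w1 = "2 * (r X1 * q X2 - q X1 * r X2)"
    let ?w2 = "r X2 * ?m X1 - r X1 * ?m X2"
    let ?w3 = "q X1 * ?m X2 - q X2 * ?m X1"
    have e: "D X1 (D X2 e0) - D X2 (D X1 e0) = ?w1 *\<^sub>R J e0 + ?w2 *\<^sub>R f0 + ?w3 *\<^sub>R J f0"
      "D X1 (D X2 f0) - D X2 (D X1 f0) = - ?w2 *\<^sub>R e0 + ?w3 *\<^sub>R J e0 - ?w1 *\<^sub>R J f0"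
      by (rule unitary_frame_eqI[OF fr0]; simp add: De Df D_J inner_simps ip algebra_simps)+
    have w: "?w1 = c * p X1 + d * p X2" "?w2 = c * q X1 + d * q X2" "?w3 = c * r X1 + d * r X2"
      "- ?w1 = c * k X1 + d * k X2"
      using arg_cong[OF com[of e0], of "\<lambda>x. x \<bullet> J e0"] arg_cong[OF com[of e0], of "\<lambda>x. x \<bullet> f0"]
        arg_cong[OF com[of e0], of "\<lambda>x. x \<bullet> J f0"] arg_cong[OF com[of f0], of "\<lambda>x. x \<bullet> J f0"]
      unfolding e by (simp_all add: De Df inner_simps ip)
    \<comment> \<open>In the coordinates \<open>?m / 2\<close>, \<open>q\<close>, \<open>r\<close>
      of su(2) the commutator is -2 times the cross product of the traceless parts, hence orthogonal
      to both. By \<open>com\<close> it is also a combination of them, so it is orthogonal to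
      itself.\<close>
    have "?w1 * ?w1 + ?w2 * ?w2 + ?w3 * ?w3 = 0"
      using w by algebra
    then have w0: "?w1 = 0" "?w2 = 0" "?w3 = 0"
      by (smt (verit, best) not_square_less_zero sum_squares_eq_zero_iff zero_le_square)+
    then have "D X1 (D X2 e0) = D X2 (D X1 e0)" "D X1 (D X2 f0) = D X2 (D X1 f0)"
      using e by simp_all
    then have "D X1 (D X2 z) = D X2 (D X1 z)" for z
      by (rule commute_frame[OF fr0])
    moreover obtain c1 d1 c2 d2 where "\<And>z. D x z = c1 *\<^sub>R D X1 z + d1 *\<^sub>R D X2 z"
      "\<And>z. D y z = c2 *\<^sub>R D X1 z + d2 *\<^sub>R D X2 z"
      using comb by metis
    ultimately show ?thesis
      by (simp add: algebra_simps)
  qed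
qed

lemma br_in_U: "br x y \<in> U"
  by (simp add: U_def flat D_commute[of x])

text \<open>A bracket of two vectors of the complement of \<open>U\<close> lies both in
  \<open>U\<close> and in the complement, so it is zero and \<open>D x y\<close> is symmetric there.
  Symmetry in the first two slots and skewness in the last two leave only zero, as in the uniqueness
  of the Levi-Civita connection.\<close>

lemma D_perp_zero:
  assumes X: "\<And>u. u \<in> U \<Longrightarrow> u \<bullet> X = 0"
  shows "D v X = 0"
proof -
  define P where "P = {x. \<forall>u\<in>U. u \<bullet> x = 0}"
  have PD: "D x y \<in> P" if "y \<in> P" for x y
    using that perp_D by (simp add: P_def)
  have sym: "D x y = D y x" if "x \<in> P" "y \<in> P" for x y
  proof -
    have "br x y \<in> P"
      using that PD subspace_orthogonal_to_vectors[of U]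
      by (simp add: torsion_free P_def inner_simps)
    then have "br x y \<bullet> br x y = 0"
      using br_in_U[of x y] by (simp add: P_def)
    then show ?thesis
      using torsion_free[of x y] by simp
  qed
  have *: "D b X = 0" if "b \<in> P" for b
  proof -
    have X: "X \<in> P"
      using X by (simp add: P_def)
    have "D x y \<bullet> z = - (D y z \<bullet> x)" if "x \<in> P" "y \<in> P" "z \<in> P" for x y z
      using sym[OF that(1,2)] D_skew[of y x z] by (simp add: inner_commute)
    then have "D x y \<bullet> z = 0" if "x \<in> P" "y \<in> P" "z \<in> P" for x y z
      using that by (smt (verit))
    then show ?thesis
      using X \<open>b \<in> P\<close> PD by (metis inner_eq_zero_iff)
  qed
  obtain u b where "v = u + b" "u \<in> U" "\<And>u. u \<in> U \<Longrightarrow> u \<bullet> b = 0"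
    using U_decomp by metis
  with * show ?thesis
    by (simp add: U_def P_def)
qed

text \<open>A unit vector \<open>X\<close> orthogonal to the kernel \<open>U\<close> is killed by
  every \<open>D v\<close>, hence so is \<open>J X\<close>, and \<open>D v\<close> is a rotation of
  the plane of \<open>Y\<close> and \<open>J Y\<close> with speed \<open>k v\<close>. Elements with
  \<open>k v = 0\<close> lie in \<open>U\<close>; this forces \<open>k\<close> to vanish on the
  complement of \<open>X\<close>, so that \<open>k X\<close> is the constant q.\<close>

theorem classification:
  "(\<forall>x y. br x y = 0) \<or>
   (\<exists>X Y q. q \<noteq> 0 \<and> unitary_frame X Y \<and> br X Y = q *\<^sub>R J Y \<and> br X (J Y) = - (q *\<^sub>R Y) \<and>
     br Y (J Y) = 0 \<and> (\<forall>v. br (J X) v = 0))"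
proof (cases "U = UNIV")
  case True
  then have "D x y = 0" for x y
    by (auto simp: U_def)
  then show ?thesis
    by (simp add: torsion_free)
next
  case False
  then obtain x u b where x: "x \<notin> U" "x = u + b" "u \<in> U" and b: "\<And>u. u \<in> U \<Longrightarrow> u \<bullet> b = 0"
    using U_decomp by (metis UNIV_eq_I)
  have bU: "b \<notin> U"
    using x subspace_add[OF subspace_U] by blast
  then have "b \<noteq> 0"
    using subspace_0[OF subspace_U] by blast
  define X where "X = b /\<^sub>R norm b"
  have X: "X \<bullet> X = 1" "\<And>u. u \<in> U \<Longrightarrow> u \<bullet> X = 0"
    using \<open>b \<noteq> 0\<close> b by (simp_all add: X_def power2_norm_eq_inner[symmetric] power2_eq_square)
  obtain Y where fr: "unitary_frame X Y"
    using unitary_frame_exists X(1) by blast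
  define k where "k v = D v Y \<bullet> J Y" for v
  have DX: "D v X = 0" for v
    using X(2) by (rule D_perp_zero)
  have DY: "D v Y = k v *\<^sub>R J Y" for v
    using frame_D(2)[OF fr, of v] unfolding DX by (simp add: k_def)
  have Dk: "v \<in> U" if "k v = 0" for v
  proof -
    have "D v z = 0" for z
      by (subst unitary_frame_expand[OF fr, of z]) (simp add: D_J DX DY that)
    then show ?thesis by (simp add: U_def)
  qed
  have "X \<notin> U"
    using X by fastforce
  then have kX: "k X \<noteq> 0"
    using Dk by blast
  have kz: "k v = 0" if "v \<bullet> X = 0" for v
  proof -
    have "k (k X *\<^sub>R v - k v *\<^sub>R X) = 0"
      by (simp add: k_def inner_simps)
    then have "(k X *\<^sub>R v - k v *\<^sub>R X) \<bullet> X = 0"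
      by (intro X(2) Dk)
    then show ?thesis
      using that X(1) by (simp add: inner_simps)
  qed
  note ip = unitary_frame_inner[OF fr]
  have k0: "k Y = 0" "k (J Y) = 0" "k (J X) = 0"
    by (rule kz, simp add: ip)+
  then have "J X \<in> U"
    using Dk by blast
  then have "br (J X) v = 0" for v
    using torsion_free[of "J X" v] by (simp add: U_def D_J DX)
  moreover have "br X Y = k X *\<^sub>R J Y" "br X (J Y) = - (k X *\<^sub>R Y)" "br Y (J Y) = 0"
    by (simp_all add: torsion_free D_J DX DY k0)
  ultimately show ?thesis
    using kX fr by blast
qed

end

section \<open>Chern, Bismut and Gauduchon connections on the Lie algebra\<close>

context hermitian_lie_algebra
begin

text \<open>This is a left invariant Hermitian connection: the metric is constant on left invariant
  fields, so the derivative term of metric compatibility drops out and skewness remains.\<close>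

definition hermitian_form :: "('a \<Rightarrow> 'a \<Rightarrow> 'a) \<Rightarrow> bool"
  where "hermitian_form D \<longleftrightarrow>
    bilinear D \<and> (\<forall>x y. D x (J y) = J (D x y)) \<and> (\<forall>x y z. D x y \<bullet> z = - (y \<bullet> D x z))"

definition tor :: "('a \<Rightarrow> 'a \<Rightarrow> 'a) \<Rightarrow> 'a \<Rightarrow> 'a \<Rightarrow> 'a"
  where "tor D x y = D x y - D y x - br x y"

lemmas br_bilinear_simps = bilinear_simps[OF bilinear_br]

lemma bilinear_tor: "bilinear D \<Longrightarrow> bilinear (tor D)"
  by (auto simp: bilinear_def tor_def linear_iff algebra_simps br_bilinear_simps)

lemma tor_skew: "tor D x y = - tor D y x"
  using br_skew[of x y] by (simp add: tor_def)

context
  fixes Dc Db :: "'a \<Rightarrow> 'a \<Rightarrow> 'a"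
  assumes integrable: "\<And>x y. br (J x) (J y) = br x y + J (br (J x) y) + J (br x (J y))"
    and Dc: "hermitian_form Dc"
    and chern: "\<And>x y. tor Dc x y + tor Dc (J x) (J y) = 0"
    and Db: "hermitian_form Db"
    and bismut: "\<And>x y z. tor Db x y \<bullet> z = - (tor Db x z \<bullet> y)"
begin

text \<open>Since the connection commutes with \<open>J\<close>, integrability is a condition on the
  torsion: the Nijenhuis expression of \<open>tor Dc\<close> vanishes. With the (1,1)-part zero as
  well, only the complex bilinear part is left.\<close>

lemma chern_torsion_J: "tor Dc (J x) y = J (tor Dc x y)"
proof -
  let ?T = "tor Dc"
  have bT: "bilinear ?T"
    using Dc bilinear_tor by (simp add: hermitian_form_def)
  have "?T (J x) (J y) - J (?T (J x) y) - J (?T x (J y)) - ?T x y = 0"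
    using Dc by (simp add: tor_def hermitian_form_def integrable)
  moreover have "?T x (J y) = ?T (J x) y"
    using chern[of x "J y"] by (simp add: bilinear_simps[OF bT])
  moreover have "?T (J x) (J y) = - ?T x y"
    using chern[of x y] by (metis add_eq_0_iff)
  ultimately have *: "- ?T x y - J (?T (J x) y) - J (?T (J x) y) - ?T x y = 0"
    by (simp only:)
  have "2 *\<^sub>R (J (?T (J x) y) + ?T x y) = - (- ?T x y - J (?T (J x) y) - J (?T (J x) y) - ?T x y)"
    by (simp add: scaleR_2)
  then have "2 *\<^sub>R (J (?T (J x) y) + ?T x y) = 0"
    unfolding * by simp
  then have "J (?T (J x) y) = - ?T x y"
    by (simp add: add_eq_0_iff2)
  then have "J (J (?T (J x) y)) = J (- ?T x y)"
    by simp
  then show ?thesis by simp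
qed

text \<open>The right-hand side is a Hermitian connection whose torsion is minus the cyclic sum of
  the Chern torsion, hence a 3-form. Uniqueness identifies it with \<open>Db\<close>.\<close>

lemma bismut_eq: "Db x y \<bullet> z = Dc x y \<bullet> z - tor Dc x y \<bullet> z + y \<bullet> tor Dc x z"
proof -
  let ?T = "tor Dc"
  have bT: "bilinear ?T" and bc: "bilinear Dc" and bb: "bilinear Db"
    using Dc Db bilinear_tor by (auto simp: hermitian_form_def)
  note ss = bilinear_simps[OF bT] bilinear_simps[OF bc] bilinear_simps[OF bb]
  have TJ2: "?T x (J y) = J (?T x y)" for x y
    using tor_skew[of Dc x y] tor_skew[of Dc x "J y"] chern_torsion_J[of y x] by simp
  define c where "c x y z = Db x y \<bullet> z - (Dc x y \<bullet> z - ?T x y \<bullet> z + y \<bullet> ?T x z)" for x y z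
  have cskew: "c x y z = - c x z y" for x y z
  proof -
    have "Dc x z \<bullet> y = - (z \<bullet> Dc x y)" "Db x z \<bullet> y = - (z \<bullet> Db x y)"
      using Dc Db unfolding hermitian_form_def by blast+
    then show ?thesis
      by (simp add: c_def inner_commute[of z] inner_commute[of y])
  qed
  have "c x y z = 0"
  proof (rule bismut_difference_zero)
    show "c (- x) y z = - c x y z" "c x (- y) z = - c x y z" "c x y (- z) = - c x y z" for x y z
      by (simp_all add: c_def ss)
    show "c x y z = - c x z y" for x y z
      by (rule cskew)
    show "c x (J y) z = - c x y (J z)" for x y z
    proof -
      have "Dc x (J y) = J (Dc x y)" "Db x (J y) = J (Db x y)"
        using Dc Db by (simp_all add: hermitian_form_def)
      then show ?thesis
        by (simp add: c_def TJ2 J_skew)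
    qed
    have c2: "c x y z - c y x z = tor Db x y \<bullet> z + ?T x y \<bullet> z + ?T y z \<bullet> x + ?T z x \<bullet> y" for x y z
      using tor_skew[of Dc y x] tor_skew[of Dc z x]
      by (simp add: c_def tor_def[of Db] inner_simps inner_commute) (simp add: tor_def inner_simps inner_commute)
    show "c x y z - c y x z = - (c x z y - c z x y)" for x y z
      unfolding c2 using bismut[of x y z] tor_skew[of Dc x y] tor_skew[of Dc y z] tor_skew[of Dc z x]
      by simp
  qed
  then show ?thesis by (simp add: c_def)
qed

theorem flat_gauduchon_classification:
  fixes s :: real
  defines "D \<equiv> \<lambda>x y. (1 - s / 2) *\<^sub>R Dc x y + (s / 2) *\<^sub>R Db x y"
  assumes s: "s \<noteq> 0" "s \<noteq> 2"
    and flat: "\<And>x y z. D x (D y z) - D y (D x z) - D (br x y) z = 0"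
  shows "(\<forall>x y. br x y = 0) \<or>
   (\<exists>X Y q. q \<noteq> 0 \<and> unitary_frame X Y \<and> br X Y = q *\<^sub>R J Y \<and> br X (J Y) = - (q *\<^sub>R Y) \<and>
     br Y (J Y) = 0 \<and> (\<forall>v. br (J X) v = 0))"
proof -
  interpret F: flat_hermitian J br D
  proof
    show "bilinear D"
      using Dc Db by (auto simp: D_def hermitian_form_def bilinear_def linear_iff algebra_simps)
    show "D x (J y) = J (D x y)" for x y
      using Dc Db by (simp add: D_def hermitian_form_def)
    show "D x y \<bullet> z = - (y \<bullet> D x z)" for x y z
      using Dc Db by (simp add: D_def hermitian_form_def inner_simps)
    show "D (br x y) z = D x (D y z) - D y (D x z)" for x y z
      using flat[of x y z] by simp
  qed
  let ?T = "tor Dc"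
  have bT: "bilinear ?T"
    using Dc bilinear_tor by (simp add: hermitian_form_def)
  note Ts = bilinear_simps[OF bT]
  have TJ2: "?T x (J y) = J (?T x y)" for x y
    using tor_skew[of Dc x y] tor_skew[of Dc x "J y"] chern_torsion_J[of y x] by simp
  have S: "F.S x y \<bullet> z = (1 - 2 * (s / 2)) * (?T x y \<bullet> z) + (s / 2) * (y \<bullet> ?T x z - x \<bullet> ?T y z)" for x y z
  proof -
    have "F.S x y \<bullet> z = (1 - s / 2) * (Dc x y \<bullet> z - Dc y x \<bullet> z) + (s / 2) * (Db x y \<bullet> z - Db y x \<bullet> z) - br x y \<bullet> z"
      unfolding F.S_def[of x y] by (simp add: D_def inner_simps algebra_simps)
    also have "\<dots> = (Dc x y \<bullet> z - Dc y x \<bullet> z - br x y \<bullet> z)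
        + (s / 2) * (?T y x \<bullet> z - ?T x y \<bullet> z + y \<bullet> ?T x z - x \<bullet> ?T y z)"
      by (simp add: bismut_eq algebra_simps)
    also have "?T y x = - ?T x y"
      by (rule tor_skew)
    also have "Dc x y \<bullet> z - Dc y x \<bullet> z - br x y \<bullet> z = ?T x y \<bullet> z"
      by (simp add: tor_def inner_simps)
    finally show ?thesis
      by (simp add: algebra_simps)
  qed
  have T0: "?T e f = 0" if fr: "unitary_frame e f" for e f
  proof (rule ccontr)
    assume ne: "?T e f \<noteq> 0"
    note ip = unitary_frame_inner[OF fr]
    have Txx: "?T x x = 0" for x
      using tor_skew[of Dc x x] by (rule eq_neg_imp_zero)
    obtain n E where E: "E \<bullet> E = 1" and Tef: "?T e f = n *\<^sub>R E"
    proof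
      show "(?T e f /\<^sub>R norm (?T e f)) \<bullet> (?T e f /\<^sub>R norm (?T e f)) = 1"
        "?T e f = norm (?T e f) *\<^sub>R (?T e f /\<^sub>R norm (?T e f))"
        using ne by (simp_all add: power2_norm_eq_inner[symmetric] power2_eq_square)
    qed
    obtain F0 where fr0: "unitary_frame E F0"
      using unitary_frame_exists E by blast
    \<comment> \<open>A skew complex bilinear map in two complex variables is a determinant times a
      fixed vector, so its image is the complex line through \<open>E\<close>.\<close>
    have T2: "\<exists>a b. ?T x y = a *\<^sub>R E + b *\<^sub>R J E" for x y
    proof -
      let ?e = "\<lambda>x. x \<bullet> e" and ?f = "\<lambda>x. x \<bullet> f" and ?g = "\<lambda>x. x \<bullet> J e" and ?h = "\<lambda>x. x \<bullet> J f"
      have fe: "?T f e = - n *\<^sub>R E"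
        using tor_skew[of Dc f e] Tef by simp
      have "?T x y = (n * (?e x * ?f y - ?f x * ?e y - ?g x * ?h y + ?h x * ?g y)) *\<^sub>R E
          + (n * (?e x * ?h y + ?g x * ?f y - ?f x * ?g y - ?h x * ?e y)) *\<^sub>R J E"
        by (subst unitary_frame_expand[OF fr, of x], subst unitary_frame_expand[OF fr, of y])
          (simp add: Ts chern_torsion_J TJ2 Txx fe Tef algebra_simps)
      then show ?thesis by blast
    qed
    then obtain a b where ab: "?T E F0 = a *\<^sub>R E + b *\<^sub>R J E"
      by blast
    define N where "N = sqrt (a\<^sup>2 + b\<^sup>2)"
    have "?T E F0 = 0"
    proof (rule ccontr)
      assume "?T E F0 \<noteq> 0"
      then have "a\<^sup>2 + b\<^sup>2 > 0"
        using ab by (auto simp: sum_power2_gt_zero_iff)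
      then have N: "N > 0" "N * N = a * a + b * b"
        by (auto simp: N_def power2_eq_square)
      note ip0 = unitary_frame_inner[OF fr0]
      \<comment> \<open>Multiplying \<open>F0\<close> by the unit complex number (a - i b) / N makes
        the coefficient of \<open>?T E F1\<close> real.\<close>
      define F1 where "F1 = (a / N) *\<^sub>R F0 - (b / N) *\<^sub>R J F0"
      have "F1 \<bullet> F1 = (a * a + b * b) / (N * N)"
        by (simp add: F1_def inner_simps ip0 add_divide_distrib)
      then have fr1: "unitary_frame E F1"
        using N by (auto simp: unitary_frame_def F1_def inner_simps ip0)
      have "?T E F1 = ((a * a + b * b) / N) *\<^sub>R E"
        by (simp add: F1_def Ts TJ2 ab algebra_simps add_divide_distrib)
      also have "(a * a + b * b) / N = N"
        using N by (simp add: field_simps)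
      finally have TN: "?T E F1 = N *\<^sub>R E" .
      have "s / 2 \<noteq> 0" "s / 2 \<noteq> 1"
        using s by simp_all
      then have "N = 0"
        by (rule F.torsion_scale_zero[OF fr1 bT tor_skew chern_torsion_J S TN])
      then show False using N by simp
    qed
    moreover have "?T F0 E = 0"
      using calculation tor_skew[of Dc F0 E] by simp
    ultimately have "?T x y = 0" for x y
      by (subst unitary_frame_expand[OF fr0, of x], subst unitary_frame_expand[OF fr0, of y])
        (simp add: Ts chern_torsion_J TJ2 Txx)
    then show False using ne by simp
  qed
  have T00: "?T x y = 0" for x y
  proof -
    obtain e0 :: 'a where "e0 \<bullet> e0 = 1"
      using nonempty_Basis inner_same_Basis by blast
    then obtain f0 where fr0: "unitary_frame e0 f0"
      using unitary_frame_exists by blast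
    have Txx: "?T x x = 0" for x
      using tor_skew[of Dc x x] by (rule eq_neg_imp_zero)
    have "?T f0 e0 = 0"
      using tor_skew[of Dc f0 e0] T0[OF fr0] by simp
    then show ?thesis
      by (subst unitary_frame_expand[OF fr0, of x], subst unitary_frame_expand[OF fr0, of y])
        (simp add: Ts chern_torsion_J TJ2 Txx T0[OF fr0])
  qed
  interpret K: flat_kaehler J br D
  proof
    fix x y
    have "F.S x y \<bullet> F.S x y = 0"
      by (subst S) (simp add: T00)
    then show "br x y = D x y - D y x"
      by (simp add: F.S_def)
  qed
  show ?thesis
    by (rule K.classification)
qed

end

end

subsection \<open>Calculus of smooth maps\<close>

abbreviation fd :: "('a::real_normed_vector \<Rightarrow> 'b::real_normed_vector) \<Rightarrow> 'a \<Rightarrow> 'a \<Rightarrow> 'b"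
  where "fd f x \<equiv> frechet_derivative f (at x)"

lemma fd_eq: "(f has_derivative f') (at x) \<Longrightarrow> fd f x = f'"
  using frechet_derivative_at by metis

lemma fd_works: "f differentiable (at x) \<Longrightarrow> (f has_derivative fd f x) (at x)"
  by (simp add: frechet_derivative_works)

lemma fd_linear: "f differentiable (at x) \<Longrightarrow> linear (fd f x)"
  by (rule linear_frechet_derivative)

lemma fd_Basis_expand:
  fixes f :: "'a::euclidean_space \<Rightarrow> 'b::real_normed_vector"
  assumes "f differentiable (at x)"
  shows "fd f x v = (\<Sum>b\<in>Basis. (v \<bullet> b) *\<^sub>R fd f x b)"
  by (subst (1) euclidean_representation[symmetric, of v])
    (simp add: linear_sum[OF fd_linear[OF assms]] linear_scale[OF fd_linear[OF assms]])

lemma fd_cong_open: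
  assumes "open S" "x \<in> S" "\<And>y. y \<in> S \<Longrightarrow> f y = g y"
  shows "fd f x = fd g x" "f differentiable (at x) \<longleftrightarrow> g differentiable (at x)"
proof -
  have *: "(f has_derivative f') (at x) \<longleftrightarrow> (g has_derivative f') (at x)" for f'
    using has_derivative_transform_within_open[OF _ assms(1,2), of f f' UNIV g]
      has_derivative_transform_within_open[OF _ assms(1,2), of g f' UNIV f] assms(3) by auto
  then show "fd f x = fd g x"
    by (simp add: frechet_derivative_def)
  show "f differentiable (at x) \<longleftrightarrow> g differentiable (at x)"
    using * by (simp add: differentiable_def)
qed

lemma Ck_on_cong:
  "\<lbrakk>open S; \<And>x. x \<in> S \<Longrightarrow> f x = g x\<rbrakk> \<Longrightarrow> Ck_on k S f \<longleftrightarrow> Ck_on k S g"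
proof (induction k arbitrary: f g)
  case 0
  then show ?case by (auto intro: continuous_on_cong)
next
  case (Suc k)
  have "Ck_on k S (\<lambda>x. fd f x v) \<longleftrightarrow> Ck_on k S (\<lambda>x. fd g x v)" for v
    by (rule Suc.IH[OF Suc.prems(1)]) (metis Suc.prems fd_cong_open(1))
  then show ?case
    using fd_cong_open(2)[OF Suc.prems(1) _ Suc.prems(2)] by auto
qed

lemma Ck_on_subset: "\<lbrakk>Ck_on k S f; T \<subseteq> S\<rbrakk> \<Longrightarrow> Ck_on k T f"
  by (induction k arbitrary: f) (auto intro: continuous_on_subset)

lemma Ck_on_local:
  assumes "\<And>x. x \<in> S \<Longrightarrow> \<exists>T. open T \<and> x \<in> T \<and> Ck_on k T f"
  shows "Ck_on k S f"
  using assms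
proof (induction k arbitrary: f)
  case 0
  then show ?case
    by (metis Ck_on.simps(1) continuous_at_imp_continuous_on continuous_on_eq_continuous_at)
next
  case (Suc k)
  show ?case
    unfolding Ck_on.simps
  proof (intro conjI ballI allI)
    fix x assume "x \<in> S"
    then show "f differentiable (at x)"
      using Suc.prems by fastforce
  next
    fix v
    show "Ck_on k S (\<lambda>x. fd f x v)"
      by (rule Suc.IH) (use Suc.prems in fastforce)
  qed
qed

lemma Ck_on_Suc_imp: "Ck_on (Suc k) S f \<Longrightarrow> Ck_on k S f"
  by (induction k arbitrary: f)
    (auto intro!: continuous_at_imp_continuous_on differentiable_imp_continuous_within)

text \<open>The derivative can be supplied by a formula, so later inductions never handle the chosen
  \<open>frechet_derivative\<close> of a compound expression.\<close>

lemma Ck_on_SucI: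
  assumes "open S" and f: "\<And>x. x \<in> S \<Longrightarrow> (f has_derivative f' x) (at x)"
    and "\<And>v. Ck_on k S (\<lambda>x. f' x v)"
  shows "Ck_on (Suc k) S f"
  unfolding Ck_on.simps
proof (intro conjI ballI allI)
  show "f differentiable (at x)" if "x \<in> S" for x
    using f[OF that] by (auto simp: differentiable_def)
  show "Ck_on k S (\<lambda>x. fd f x v)" for v
    using assms(3)[of v] Ck_on_cong[OF assms(1), of "\<lambda>x. fd f x v" "\<lambda>x. f' x v" k] fd_eq[OF f]
    by auto
qed

lemma Ck_on_has_derivative:
  "\<lbrakk>Ck_on (Suc k) S f; x \<in> S\<rbrakk> \<Longrightarrow> (f has_derivative fd f x) (at x)"
  by (simp add: fd_works)

lemma Ck_on_const: "open S \<Longrightarrow> Ck_on k S (\<lambda>x. c)"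
proof (induction k arbitrary: c)
  case (Suc k)
  then show ?case
    by (intro Ck_on_SucI[where f' = "\<lambda>x v. 0"]) auto
qed auto

lemma Ck_on_bounded_linear:
  assumes "bounded_linear f" "open S"
  shows "Ck_on k S f"
proof (cases k)
  case 0
  then show ?thesis
    using assms linear_continuous_on by auto
next
  case (Suc m)
  show ?thesis
    unfolding Suc
    by (rule Ck_on_SucI[where f' = "\<lambda>x. f"])
      (use assms in \<open>auto intro: Ck_on_const bounded_linear_imp_has_derivative\<close>)
qed

lemma Ck_on_add:
  "\<lbrakk>open S; Ck_on k S f; Ck_on k S g\<rbrakk> \<Longrightarrow> Ck_on k S (\<lambda>x. f x + g x)"
proof (induction k arbitrary: f g)
  case (Suc k)
  show ?case
  proof (rule Ck_on_SucI[OF Suc.prems(1)])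
    show "((\<lambda>x. f x + g x) has_derivative (\<lambda>v. fd f x v + fd g x v)) (at x)" if "x \<in> S" for x
      using Suc.prems that by (intro has_derivative_add Ck_on_has_derivative)
    show "Ck_on k S (\<lambda>x. fd f x v + fd g x v)" for v
      using Suc by auto
  qed
qed (auto intro: continuous_intros)

lemma Ck_on_sum:
  "\<lbrakk>open S; \<And>i. i \<in> I \<Longrightarrow> Ck_on k S (f i)\<rbrakk> \<Longrightarrow> Ck_on k S (\<lambda>x. \<Sum>i\<in>I. f i x)"
  by (induction I rule: infinite_finite_induct) (auto intro: Ck_on_add Ck_on_const)

lemma (in bounded_bilinear) Ck_on_prod:
  "\<lbrakk>open S; Ck_on k S f; Ck_on k S g\<rbrakk> \<Longrightarrow> Ck_on k S (\<lambda>x. prod (f x) (g x))"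
proof (induction k arbitrary: f g)
  case 0
  then show ?case by (auto intro: continuous_on)
next
  case (Suc k)
  show ?case
  proof (rule Ck_on_SucI[OF Suc.prems(1)])
    show "((\<lambda>x. prod (f x) (g x)) has_derivative (\<lambda>v. prod (f x) (fd g x v) + prod (fd f x v) (g x))) (at x)"
      if "x \<in> S" for x
      using Suc.prems that by (intro FDERIV Ck_on_has_derivative)
    show "Ck_on k S (\<lambda>x. prod (f x) (fd g x v) + prod (fd f x v) (g x))" for v
      using Suc by (intro Ck_on_add Suc.IH) (auto intro: Ck_on_Suc_imp simp del: Ck_on.simps, auto)
  qed
qed

lemmas Ck_on_scaleR = bounded_bilinear.Ck_on_prod[OF bounded_bilinear_scaleR]
lemmas Ck_on_mult = bounded_bilinear.Ck_on_prod[OF bounded_bilinear_mult]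
lemmas Ck_on_inner = bounded_bilinear.Ck_on_prod[OF bounded_bilinear_inner]

lemma Ck_on_compose_linear:
  assumes h: "bounded_linear h" and "open S"
  shows "Ck_on k S f \<Longrightarrow> Ck_on k S (\<lambda>x. h (f x))"
proof (induction k arbitrary: f)
  case 0
  then show ?case
    by (auto intro: bounded_linear.continuous_on[OF h])
next
  case (Suc k)
  show ?case
    by (rule Ck_on_SucI[OF assms(2), where f' = "\<lambda>x v. h (fd f x v)"])
      (use Suc in \<open>auto intro!: bounded_linear.has_derivative[OF h] Ck_on_has_derivative simp del: Ck_on.simps\<close>, use Suc in auto)
qed

text \<open>\<open>Ck_on\<close> controls derivatives in fixed directions only, whereas the chain
  rule differentiates \<open>g\<close> in the moving direction \<open>fd f x v\<close>. Expanding
  that direction in \<open>Basis\<close> turns the derivative into a sum of products to which the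
  induction applies.\<close>

lemma Ck_on_compose:
  fixes f :: "'a::euclidean_space \<Rightarrow> 'b::euclidean_space" and g :: "'b \<Rightarrow> 'c::real_normed_vector"
  shows "\<lbrakk>open S; open T; f ` S \<subseteq> T; Ck_on k S f; Ck_on k T g\<rbrakk> \<Longrightarrow> Ck_on k S (\<lambda>x. g (f x))"
proof (induction k arbitrary: g)
  case 0
  then show ?case
    by (auto intro: continuous_on_compose2)
next
  case (Suc k)
  let ?f' = "\<lambda>x v. \<Sum>b\<in>Basis. (fd f x v \<bullet> b) *\<^sub>R fd g (f x) b"
  have fk: "Ck_on k S f"
    using Suc.prems(4) by (rule Ck_on_Suc_imp)
  show ?case
  proof (rule Ck_on_SucI[OF Suc.prems(1), of _ ?f'])
    fix x assume x: "x \<in> S"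
    then have gd: "(g has_derivative fd g (f x)) (at (f x))"
      using Suc.prems by (intro Ck_on_has_derivative) auto
    have "((\<lambda>x. g (f x)) has_derivative (\<lambda>v. fd g (f x) (fd f x v))) (at x)"
      using has_derivative_compose[OF Ck_on_has_derivative[OF Suc.prems(4) x] gd] .
    moreover have "fd g (f x) (fd f x v) = ?f' x v" for v
      by (rule fd_Basis_expand) (use gd differentiable_def in blast)
    ultimately show "((\<lambda>x. g (f x)) has_derivative ?f' x) (at x)"
      by simp
  next
    fix v
    have "Ck_on k S (\<lambda>x. fd g (f x) b)" for b
      using Suc.prems fk by (intro Suc.IH) auto
    then show "Ck_on k S (\<lambda>x. ?f' x v)"
      using Suc.prems by (intro Ck_on_sum Ck_on_scaleR Ck_on_inner Ck_on_const) auto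
  qed
qed

lemma smooth_onI: "(\<And>k. Ck_on k S f) \<Longrightarrow> smooth_on S f"
  by (simp add: smooth_on_def)

lemma smooth_onD: "smooth_on S f \<Longrightarrow> Ck_on k S f"
  by (simp add: smooth_on_def)

lemma smooth_on_cong:
  "\<lbrakk>open S; \<And>x. x \<in> S \<Longrightarrow> f x = g x\<rbrakk> \<Longrightarrow> smooth_on S f \<longleftrightarrow> smooth_on S g"
  unfolding smooth_on_def using Ck_on_cong by blast

lemma smooth_on_subset: "\<lbrakk>smooth_on S f; T \<subseteq> S\<rbrakk> \<Longrightarrow> smooth_on T f"
  unfolding smooth_on_def using Ck_on_subset by blast

lemma smooth_on_local:
  "(\<And>x. x \<in> S \<Longrightarrow> \<exists>T. open T \<and> x \<in> T \<and> smooth_on T f) \<Longrightarrow> smooth_on S f"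
  unfolding smooth_on_def by (intro allI Ck_on_local) blast

lemma smooth_on_const: "open S \<Longrightarrow> smooth_on S (\<lambda>x. c)"
  by (simp add: smooth_on_def Ck_on_const)

lemma smooth_on_bounded_linear: "\<lbrakk>bounded_linear f; open S\<rbrakk> \<Longrightarrow> smooth_on S f"
  by (simp add: smooth_on_def Ck_on_bounded_linear)

lemma smooth_on_id: "open S \<Longrightarrow> smooth_on S (\<lambda>x. x)"
  by (intro smooth_on_bounded_linear bounded_linear_ident)

lemma smooth_on_add: "\<lbrakk>open S; smooth_on S f; smooth_on S g\<rbrakk> \<Longrightarrow> smooth_on S (\<lambda>x. f x + g x)"
  by (simp add: smooth_on_def Ck_on_add)

lemma smooth_on_sum:
  "\<lbrakk>open S; \<And>i. i \<in> I \<Longrightarrow> smooth_on S (f i)\<rbrakk> \<Longrightarrow> smooth_on S (\<lambda>x. \<Sum>i\<in>I. f i x)"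
  by (simp add: smooth_on_def Ck_on_sum)

lemma smooth_on_scaleR: "\<lbrakk>open S; smooth_on S f; smooth_on S g\<rbrakk> \<Longrightarrow> smooth_on S (\<lambda>x. f x *\<^sub>R g x)"
  by (simp add: smooth_on_def Ck_on_scaleR)

lemma smooth_on_mult:
  fixes f g :: "_ \<Rightarrow> 'b::real_normed_algebra"
  shows "\<lbrakk>open S; smooth_on S f; smooth_on S g\<rbrakk> \<Longrightarrow> smooth_on S (\<lambda>x. f x * g x)"
  by (simp add: smooth_on_def Ck_on_mult)

lemma smooth_on_inner: "\<lbrakk>open S; smooth_on S f; smooth_on S g\<rbrakk> \<Longrightarrow> smooth_on S (\<lambda>x. f x \<bullet> g x)"
  by (simp add: smooth_on_def Ck_on_inner)

lemma smooth_on_compose_linear: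
  "\<lbrakk>bounded_linear h; open S; smooth_on S f\<rbrakk> \<Longrightarrow> smooth_on S (\<lambda>x. h (f x))"
  by (simp add: smooth_on_def Ck_on_compose_linear)

lemma smooth_on_minus: "\<lbrakk>open S; smooth_on S f\<rbrakk> \<Longrightarrow> smooth_on S (\<lambda>x. - f x)"
  by (rule smooth_on_compose_linear[OF bounded_linear_minus[OF bounded_linear_ident]])

lemma smooth_on_diff: "\<lbrakk>open S; smooth_on S f; smooth_on S g\<rbrakk> \<Longrightarrow> smooth_on S (\<lambda>x. f x - g x)"
  using smooth_on_add[OF _ _ smooth_on_minus, of S f g] by simp

lemma smooth_on_Pair:
  fixes f :: "'a::euclidean_space \<Rightarrow> 'b::euclidean_space" and g :: "'a \<Rightarrow> 'c::euclidean_space"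
  assumes "open S" "smooth_on S f" "smooth_on S g"
  shows "smooth_on S (\<lambda>x. (f x, g x))"
proof -
  have "smooth_on S (\<lambda>x. (f x, 0) + (0, g x))"
    using smooth_on_compose_linear[OF bounded_linear_Pair[OF bounded_linear_ident bounded_linear_zero] assms(1,2)]
      smooth_on_compose_linear[OF bounded_linear_Pair[OF bounded_linear_zero bounded_linear_ident] assms(1,3)]
    by (rule smooth_on_add[OF assms(1)])
  then show ?thesis by simp
qed

lemma smooth_on_compose:
  fixes f :: "'a::euclidean_space \<Rightarrow> 'b::euclidean_space" and g :: "'b \<Rightarrow> 'c::real_normed_vector"
  shows "\<lbrakk>open S; open T; f ` S \<subseteq> T; smooth_on S f; smooth_on T g\<rbrakk> \<Longrightarrow> smooth_on S (\<lambda>x. g (f x))"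
  unfolding smooth_on_def using Ck_on_compose by blast

lemma smooth_on_has_derivative: "\<lbrakk>smooth_on S f; x \<in> S\<rbrakk> \<Longrightarrow> (f has_derivative fd f x) (at x)"
  using Ck_on_has_derivative[OF smooth_onD] .

lemma smooth_on_differentiable: "\<lbrakk>smooth_on S f; x \<in> S\<rbrakk> \<Longrightarrow> f differentiable (at x)"
  using smooth_on_has_derivative differentiable_def by blast

lemma smooth_on_continuous: "smooth_on S f \<Longrightarrow> continuous_on S f"
  using smooth_onD[of S f 0] by simp

lemma smooth_on_fd: "smooth_on S f \<Longrightarrow> smooth_on S (\<lambda>x. fd f x v)"
  unfolding smooth_on_def by (metis Ck_on.simps(2))

text \<open>The Leibniz rule and the inverse function theorem take derivatives as functions with
  values in bounded linear maps.\<close>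

lemma continuous_on_Blinfun_fd:
  fixes f :: "'a::euclidean_space \<Rightarrow> 'b::euclidean_space"
  assumes "Ck_on (Suc k) S f"
  shows "continuous_on S (\<lambda>x. Blinfun (fd f x))"
proof (rule continuous_on_blinfun_componentwise)
  fix b :: 'a
  have "continuous_on S (\<lambda>x. fd f x b)"
    using assms Ck_on_subset[of k] by (cases k) (auto intro: differentiable_imp_continuous_on simp: differentiable_on_def differentiable_at_withinI)
  moreover have "blinfun_apply (Blinfun (fd f x)) b = fd f x b" if "x \<in> S" for x
    using Ck_on_has_derivative[OF assms that]
    by (simp add: bounded_linear_Blinfun_apply has_derivative_bounded_linear)
  ultimately show "continuous_on S (\<lambda>x. blinfun_apply (Blinfun (fd f x)) b)"
    by (simp cong: continuous_on_cong)
qed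

subsection \<open>A bump function\<close>

lemma power_div_fact_le_exp: "x \<ge> 0 \<Longrightarrow> x ^ n / fact n \<le> exp (x::real)"
proof -
  assume x: "x \<ge> 0"
  have "(\<Sum>i\<in>{n}. x ^ i /\<^sub>R fact i) \<le> (\<Sum>i. x ^ i /\<^sub>R fact i)"
    by (rule sum_le_suminf) (use x in \<open>auto simp: summable_exp\<close>)
  then show ?thesis
    by (simp add: exp_def divide_inverse mult.commute)
qed

text \<open>The index makes the family closed under differentiation, with derivative
  \<open>flat_exp (n + 2) - n * flat_exp (n + 1)\<close>; one induction over all n then gives
  smoothness of exp (-1/t).\<close>

definition flat_exp :: "nat \<Rightarrow> real \<Rightarrow> real"
  where "flat_exp n t = (if t > 0 then exp (- 1 / t) / t ^ n else 0)"

text \<open>This compares exp (1/t) with the single term of index \<open>n + 2\<close> of its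
  series. A quadratic bound is enough to make the derivative at 0 vanish.\<close>

lemma flat_exp_bound: "\<bar>flat_exp n t\<bar> \<le> fact (n + 2) * t\<^sup>2"
proof (cases "t > 0")
  case True
  have "(1 / t) ^ (n + 2) / fact (n + 2) \<le> exp (1 / t)"
    by (rule power_div_fact_le_exp) (use True in simp)
  then have "1 \<le> exp (1 / t) * (fact (n + 2) * t ^ (n + 2))"
    using True by (simp add: power_divide divide_simps del: fact_Suc) (simp add: mult_ac del: fact_Suc)
  then have "exp (- 1 / t) \<le> fact (n + 2) * t ^ (n + 2)"
    by (simp add: exp_minus divide_simps mult.commute del: fact_Suc)
  then have "exp (- 1 / t) / t ^ n \<le> fact (n + 2) * t\<^sup>2"
    using True by (simp add: divide_simps power_add mult_ac del: fact_Suc) (simp add: power2_eq_square mult_ac)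
  then show ?thesis
    using True by (simp add: flat_exp_def del: fact_Suc)
qed (simp add: flat_exp_def)

lemma flat_exp_deriv:
  "(flat_exp n has_field_derivative flat_exp (n + 2) t - real n * flat_exp (n + 1) t) (at t)"
proof -
  consider "t > 0" | "t < 0" | "t = 0" by linarith
  then show ?thesis
  proof cases
    case 1
    have "((\<lambda>t. exp (- inverse t) * inverse t ^ n) has_field_derivative
        exp (- inverse t) * inverse t ^ 2 * inverse t ^ n
        - exp (- inverse t) * (real n * inverse t ^ (n - Suc 0) * inverse t ^ 2)) (at t)"
      using 1 by (auto intro!: derivative_eq_intros simp: power2_eq_square)
    moreover have "real n * inverse t ^ (n - Suc 0) * inverse t ^ 2 = real n * inverse t ^ (n + 1)"
      by (cases n) (auto simp: power2_eq_square)
    moreover have "exp (- inverse t) * inverse t ^ 2 * inverse t ^ n - exp (- inverse t) * (real n * inverse t ^ (n + 1))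
        = flat_exp (n + 2) t - real n * flat_exp (n + 1) t"
      using 1 by (simp add: flat_exp_def divide_inverse power_inverse power2_eq_square)
    ultimately have "((\<lambda>t. exp (- inverse t) * inverse t ^ n) has_field_derivative
        flat_exp (n + 2) t - real n * flat_exp (n + 1) t) (at t)"
      by simp
    then show ?thesis
      by (rule has_field_derivative_transform_within_open[where S = "{0<..}"])
        (use 1 in \<open>auto simp: flat_exp_def divide_inverse power_inverse\<close>)
  next
    case 2
    have "((\<lambda>t. 0) has_field_derivative flat_exp (n + 2) t - real n * flat_exp (n + 1) t) (at t)"
      using 2 by (simp add: flat_exp_def)
    then show ?thesis
      by (rule has_field_derivative_transform_within_open[where S = "{..<0}"])
        (use 2 in \<open>auto simp: flat_exp_def\<close>)
  next
    case 3
    have "((\<lambda>h. flat_exp n h / h) \<longlongrightarrow> 0) (at 0)"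
    proof (rule Lim_null_comparison)
      show "\<forall>\<^sub>F h in at 0. norm (flat_exp n h / h) \<le> fact (n + 2) * \<bar>h\<bar>"
        using flat_exp_bound[of n]
        by (intro always_eventually allI) (auto simp: divide_simps power2_eq_square abs_mult_self_eq simp del: fact_Suc,
            metis abs_mult_self_eq mult.assoc)
      show "((\<lambda>h. fact (n + 2) * \<bar>h\<bar>) \<longlongrightarrow> 0) (at (0::real))"
        by (auto intro!: tendsto_eq_intros)
    qed
    then show ?thesis
      using 3 by (simp add: has_field_derivative_iff flat_exp_def)
  qed
qed

lemma Ck_on_flat_exp: "Ck_on k UNIV (flat_exp n)"
proof (induction k arbitrary: n)
  case 0
  then show ?case
    using flat_exp_deriv by (auto intro!: continuous_at_imp_continuous_on DERIV_isCont)
next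
  case (Suc k)
  show ?case
  proof (rule Ck_on_SucI)
    show "(flat_exp n has_derivative (\<lambda>v. (flat_exp (n + 2) t + (- real n) * flat_exp (n + 1) t) * v)) (at t)" for t
      using flat_exp_deriv[of n t] by (simp add: has_field_derivative_def)
    show "Ck_on k UNIV (\<lambda>t. (flat_exp (n + 2) t + (- real n) * flat_exp (n + 1) t) * v)" for v
      by (intro Ck_on_mult Ck_on_add Ck_on_const Suc) auto
  qed auto
qed

definition bump :: "'a::euclidean_space \<Rightarrow> real \<Rightarrow> 'a \<Rightarrow> real"
  where "bump c r x = flat_exp 0 (r\<^sup>2 - (x - c) \<bullet> (x - c))"

lemma smooth_on_bump: "smooth_on UNIV (bump c r)"
proof -
  have "smooth_on UNIV (\<lambda>x. r\<^sup>2 - (x - c) \<bullet> (x - c))"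
    by (intro smooth_on_diff smooth_on_inner smooth_on_const smooth_on_id open_UNIV)
  from smooth_on_compose[OF open_UNIV open_UNIV subset_UNIV this smooth_onI[OF Ck_on_flat_exp]]
  show ?thesis
    unfolding bump_def .
qed

lemma bump_nonzero_iff: "r > 0 \<Longrightarrow> bump c r x \<noteq> 0 \<longleftrightarrow> x \<in> ball c r"
  by (auto simp: bump_def flat_exp_def dist_norm power2_norm_eq_inner[symmetric] norm_minus_commute
      dest: power_less_imp_less_base intro: power_strict_mono)

subsection \<open>Hadamard's lemma and the Poincare lemma\<close>

lemma segment_in_convex:
  "\<lbrakk>convex S; c \<in> S; x \<in> S; t \<in> {0..1::real}\<rbrakk> \<Longrightarrow> c + t *\<^sub>R (x - c) \<in> S"
  using convexD_alt[of S c x t] by (simp add: algebra_simps)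

lemma continuous_on_segment_map:
  fixes f :: "'a::real_normed_vector \<Rightarrow> 'b::real_normed_vector"
  assumes "convex S" "c \<in> S" "continuous_on S f" "x \<in> S"
  shows "continuous_on {0..1} (\<lambda>t. f (c + t *\<^sub>R (x - c)))"
proof (rule continuous_on_compose2[OF assms(3)])
  show "continuous_on {0..1} (\<lambda>t. c + t *\<^sub>R (x - c))"
    by (intro continuous_intros)
  show "(\<lambda>t. c + t *\<^sub>R (x - c)) ` {0..1} \<subseteq> S"
    using segment_in_convex[OF assms(1,2,4)] by blast
qed

text \<open>The weight \<open>t ^ m\<close> serves the induction: each derivative in
  \<open>x\<close> brings out a factor \<open>t\<close>, so the result is again an integral of this
  form.\<close>

lemma has_derivative_ray_integral:
  fixes F :: "'a::euclidean_space \<Rightarrow> 'b::euclidean_space"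
  assumes S: "open S" "convex S" "c \<in> S" and F: "Ck_on (Suc k) S F" and x: "x \<in> S"
  shows "((\<lambda>x. integral {0..1} (\<lambda>t. t ^ m *\<^sub>R F (c + t *\<^sub>R (x - c)))) has_derivative
    (\<lambda>v. integral {0..1} (\<lambda>t. t ^ Suc m *\<^sub>R fd F (c + t *\<^sub>R (x - c)) v))) (at x)"
proof -
  let ?g = "\<lambda>(x::'a) t. c + t *\<^sub>R (x - c)"
  let ?B = "\<lambda>x. Blinfun (fd F x)"
  let ?fx = "\<lambda>x t. t ^ Suc m *\<^sub>R ?B (?g x t)"
  have FC: "continuous_on S F"
    using F by (auto intro!: continuous_at_imp_continuous_on differentiable_imp_continuous_within)
  have BC: "continuous_on S ?B"
    using continuous_on_Blinfun_fd[OF F] .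
  have gS: "?g x t \<in> S" if "x \<in> S" "t \<in> {0..1}" for x t
    using segment_in_convex[OF S(2,3)] that by blast
  have B: "blinfun_apply (?B y) = fd F y" if "y \<in> S" for y
    using Ck_on_has_derivative[OF F that]
    by (simp add: bounded_linear_Blinfun_apply has_derivative_bounded_linear)
  have L: "((\<lambda>x. integral (cbox 0 1) (\<lambda>t. t ^ m *\<^sub>R F (?g x t))) has_derivative
      blinfun_apply (integral (cbox 0 1) (?fx x))) (at x within S)"
  proof (rule leibniz_rule)
    fix x t assume xt: "x \<in> S" "t \<in> cbox 0 (1::real)"
    have "((\<lambda>x. F (?g x t)) has_derivative (\<lambda>v. fd F (?g x t) (t *\<^sub>R v))) (at x within S)"
    proof (rule has_derivative_compose[of "\<lambda>x. ?g x t" _ _ _ F])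
      show "((\<lambda>x. ?g x t) has_derivative (\<lambda>v. t *\<^sub>R v)) (at x within S)"
        by (auto intro!: derivative_eq_intros)
      show "(F has_derivative fd F (?g x t)) (at (?g x t))"
        using xt by (intro Ck_on_has_derivative[OF F] gS) auto
    qed
    moreover have "fd F (?g x t) (t *\<^sub>R v) = t *\<^sub>R fd F (?g x t) v" for v
      using F gS xt by (intro linear_scale fd_linear) auto
    ultimately show "((\<lambda>x. t ^ m *\<^sub>R F (?g x t)) has_derivative blinfun_apply (?fx x t)) (at x within S)"
      using xt gS[of x t] B by (auto intro!: derivative_eq_intros simp: blinfun.scaleR_left mult.commute)
  next
    fix x assume "x \<in> S"
    then show "(\<lambda>t. t ^ m *\<^sub>R F (?g x t)) integrable_on cbox 0 1"
      using continuous_on_segment_map[OF S(2,3) FC] by (intro integrable_continuous continuous_intros) auto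
  next
    show "continuous_on (S \<times> cbox 0 1) (\<lambda>(x, t). ?fx x t)"
      unfolding split_beta
      by (intro continuous_intros continuous_on_compose2[OF BC]) (use gS in auto)
  qed (use x S in auto)
  have int: "?fx x integrable_on {0..1}"
    using continuous_on_segment_map[OF S(2,3) BC x]
    by (intro integrable_continuous_real continuous_intros)
  have "blinfun_apply (integral {0..1} (?fx x)) v = integral {0..1} (\<lambda>t. t ^ Suc m *\<^sub>R fd F (?g x t) v)" for v
  proof -
    have "blinfun_apply (integral {0..1} (?fx x)) v = integral {0..1} (\<lambda>t. blinfun_apply (?fx x t) v)"
      by (rule blinfun_apply_integral[OF int])
    also have "\<dots> = integral {0..1} (\<lambda>t. t ^ Suc m *\<^sub>R fd F (?g x t) v)"
      by (rule integral_cong) (use B gS[OF x] in \<open>simp add: blinfun.scaleR_left\<close>)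
    finally show ?thesis .
  qed
  then have "blinfun_apply (integral {0..1} (?fx x)) = (\<lambda>v. integral {0..1} (\<lambda>t. t ^ Suc m *\<^sub>R fd F (?g x t) v))"
    by (rule ext)
  then show ?thesis
    using L at_within_open[OF x S(1)] by (simp only: cbox_interval)
qed

lemma Ck_on_ray_integral:
  fixes F :: "'a::euclidean_space \<Rightarrow> 'b::euclidean_space"
  assumes S: "open S" "convex S" "c \<in> S"
  shows "Ck_on k S F \<Longrightarrow> Ck_on k S (\<lambda>x. integral {0..1} (\<lambda>t. t ^ m *\<^sub>R F (c + t *\<^sub>R (x - c))))"
proof (induction k arbitrary: F m)
  case 0
  have "continuous_on S (\<lambda>x. integral (cbox 0 1) (\<lambda>t. t ^ m *\<^sub>R F (c + t *\<^sub>R (x - c))))"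
  proof (rule integral_continuous_on_param)
    show "continuous_on (S \<times> cbox 0 1) (\<lambda>(x, t). t ^ m *\<^sub>R F (c + t *\<^sub>R (x - c)))"
    proof -
      have "continuous_on (S \<times> cbox 0 1) (\<lambda>z. F (c + snd z *\<^sub>R (fst z - c)))"
      proof (rule continuous_on_compose2[of S F])
        show "continuous_on S F"
          using 0 by simp
        show "continuous_on (S \<times> cbox 0 1) (\<lambda>z. c + snd z *\<^sub>R (fst z - c))"
          by (intro continuous_intros)
        show "(\<lambda>z. c + snd z *\<^sub>R (fst z - c)) ` (S \<times> cbox 0 1) \<subseteq> S"
          using segment_in_convex[OF S(2,3)] by auto
      qed
      then show ?thesis
        unfolding split_beta by (intro continuous_intros)
    qed
  qed
  then show ?case by simp
next
  case (Suc k)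
  show ?case
  proof (rule Ck_on_SucI[OF S(1) has_derivative_ray_integral[OF S Suc.prems]])
    show "Ck_on k S (\<lambda>x. integral {0..1} (\<lambda>t. t ^ Suc m *\<^sub>R fd F (c + t *\<^sub>R (x - c)) v))" for v
      by (rule Suc.IH) (use Suc.prems in simp)
  qed
qed

text \<open>The first formula gives the remainder in Hadamard's lemma. The second integrates the
  derivative of \<open>t *\<^sub>R F (c + t *\<^sub>R (x - c))\<close>, which is what appears when
  the primitive of a closed form is differentiated.\<close>

lemma fundamental_theorem_ray:
  fixes F :: "'a::euclidean_space \<Rightarrow> 'b::euclidean_space"
  assumes S: "convex S" "c \<in> S" "x \<in> S" and F: "Ck_on (Suc k) S F"
  shows "((\<lambda>t. fd F (c + t *\<^sub>R (x - c)) (x - c)) has_integral F x - F c) {0..1}"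
    and "((\<lambda>t. F (c + t *\<^sub>R (x - c)) + t *\<^sub>R fd F (c + t *\<^sub>R (x - c)) (x - c)) has_integral F x) {0..1}"
proof -
  have v: "((\<lambda>t. F (c + t *\<^sub>R (x - c))) has_vector_derivative fd F (c + t *\<^sub>R (x - c)) (x - c))
      (at t within {0..1})" if "t \<in> {0..1}" for t
  proof -
    let ?y = "c + t *\<^sub>R (x - c)"
    have d: "(F has_derivative fd F ?y) (at ?y)"
      using Ck_on_has_derivative[OF F segment_in_convex[OF S that]] .
    have "((\<lambda>t. F (c + t *\<^sub>R (x - c))) has_derivative (\<lambda>h. fd F ?y (h *\<^sub>R (x - c)))) (at t within {0..1})"
      by (rule has_derivative_compose[of "\<lambda>t. c + t *\<^sub>R (x - c)" _ _ _ F, OF _ d]) (auto intro!: derivative_eq_intros)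
    then show ?thesis
      using linear_scale[OF has_derivative_linear[OF d]] by (simp add: has_vector_derivative_def)
  qed
  show "((\<lambda>t. fd F (c + t *\<^sub>R (x - c)) (x - c)) has_integral F x - F c) {0..1}"
    using fundamental_theorem_of_calculus[OF _ v] by simp
  have "((\<lambda>t. t *\<^sub>R F (c + t *\<^sub>R (x - c))) has_vector_derivative
      F (c + t *\<^sub>R (x - c)) + t *\<^sub>R fd F (c + t *\<^sub>R (x - c)) (x - c)) (at t within {0..1})"
    if "t \<in> {0..1}" for t
    using v[OF that] by (auto intro!: derivative_eq_intros)
  from fundamental_theorem_of_calculus[OF _ this]
  show "((\<lambda>t. F (c + t *\<^sub>R (x - c)) + t *\<^sub>R fd F (c + t *\<^sub>R (x - c)) (x - c)) has_integral F x) {0..1}"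
    by simp
qed

lemma hadamard:
  fixes f :: "'a::euclidean_space \<Rightarrow> 'b::euclidean_space"
  assumes S: "open S" "convex S" "c \<in> S" and f: "smooth_on S f"
  obtains h where "\<And>b. smooth_on S (h b)" "\<And>b. h b c = fd f c b"
    "\<And>x. x \<in> S \<Longrightarrow> f x = f c + (\<Sum>b\<in>Basis. ((x - c) \<bullet> b) *\<^sub>R h b x)"
proof
  let ?h = "\<lambda>b x. integral {0..1} (\<lambda>t. t ^ 0 *\<^sub>R fd f (c + t *\<^sub>R (x - c)) b)"
  show "smooth_on S (?h b)" for b
    using Ck_on_ray_integral[OF S, of _ "\<lambda>x. fd f x b" 0] smooth_on_fd[OF f] by (simp add: smooth_on_def)
  show "?h b c = fd f c b" for b
    by simp
  show "f x = f c + (\<Sum>b\<in>Basis. ((x - c) \<bullet> b) *\<^sub>R ?h b x)" if x: "x \<in> S" for x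
  proof -
    have fc: "continuous_on S (\<lambda>x. fd f x b)" for b
      using smooth_on_fd[OF f] smooth_on_continuous by blast
    have int: "(\<lambda>t. fd f (c + t *\<^sub>R (x - c)) b) integrable_on {0..1}" for b
      using continuous_on_segment_map[OF S(2,3) fc x] by (rule integrable_continuous_real)
    have "f x - f c = integral {0..1} (\<lambda>t. fd f (c + t *\<^sub>R (x - c)) (x - c))"
      using fundamental_theorem_ray(1)[OF S(2,3) x smooth_onD[OF f]] by (simp add: integral_unique)
    also have "\<dots> = integral {0..1} (\<lambda>t. \<Sum>b\<in>Basis. ((x - c) \<bullet> b) *\<^sub>R fd f (c + t *\<^sub>R (x - c)) b)"
      by (intro integral_cong fd_Basis_expand smooth_on_differentiable[OF f] segment_in_convex[OF S(2,3) x])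
    also have "\<dots> = (\<Sum>b\<in>Basis. ((x - c) \<bullet> b) *\<^sub>R ?h b x)"
      using int by (subst integral_sum) (auto intro!: integrable_cmul)
    finally show ?thesis by (simp add: algebra_simps)
  qed
qed

text \<open>The primitive integrates \<open>w\<close> along the ray from \<open>c\<close>. When it
  is differentiated in direction \<open>v\<close>, closedness exchanges \<open>v\<close> with the
  ray direction and makes the integrand the t-derivative of
  \<open>t *\<^sub>R w (c + t *\<^sub>R (x - c)) v\<close>.\<close>

lemma poincare:
  fixes w :: "'a::euclidean_space \<Rightarrow> 'a \<Rightarrow> 'b::euclidean_space"
  assumes S: "open S" "convex S" "c \<in> S" and lin: "\<And>x. x \<in> S \<Longrightarrow> linear (w x)"
    and w: "\<And>v. smooth_on S (\<lambda>x. w x v)"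
    and closed: "\<And>x u v. x \<in> S \<Longrightarrow> fd (\<lambda>x. w x u) x v = fd (\<lambda>x. w x v) x u"
  obtains f where "smooth_on S f" "f c = 0" "\<And>x. x \<in> S \<Longrightarrow> (f has_derivative w x) (at x)"
proof
  let ?H = "\<lambda>b x. integral {0..1} (\<lambda>t. t ^ 0 *\<^sub>R w (c + t *\<^sub>R (x - c)) b)"
  let ?f = "\<lambda>x. \<Sum>b\<in>Basis. ((x - c) \<bullet> b) *\<^sub>R ?H b x"
  have H: "smooth_on S (?H b)" for b
    using Ck_on_ray_integral[OF S, of _ "\<lambda>x. w x b" 0] w by (simp add: smooth_on_def)
  show "smooth_on S ?f"
    by (intro smooth_on_sum smooth_on_scaleR smooth_on_inner smooth_on_diff smooth_on_const smooth_on_id H S(1))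
  show "?f c = 0" by simp
  fix x assume x: "x \<in> S"
  let ?g = "\<lambda>t. c + t *\<^sub>R (x - c)"
  have dH: "(?H b has_derivative (\<lambda>v. integral {0..1} (\<lambda>t. t *\<^sub>R fd (\<lambda>x. w x b) (?g t) v))) (at x)" for b
    using has_derivative_ray_integral[OF S smooth_onD[OF w] x, of 0] by simp
  have D: "(?f has_derivative (\<lambda>v. \<Sum>b\<in>Basis. ((x - c) \<bullet> b) *\<^sub>R integral {0..1} (\<lambda>t. t *\<^sub>R fd (\<lambda>x. w x b) (?g t) v)
      + (v \<bullet> b) *\<^sub>R ?H b x)) (at x)"
    by (rule has_derivative_sum, rule has_derivative_scaleR[OF _ dH]) (auto intro!: derivative_eq_intros)
  have gS: "?g t \<in> S" if "t \<in> {0..1}" for t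
    using segment_in_convex[OF S(2,3) x that] .
  have "(\<Sum>b\<in>Basis. ((x - c) \<bullet> b) *\<^sub>R integral {0..1} (\<lambda>t. t *\<^sub>R fd (\<lambda>x. w x b) (?g t) v) + (v \<bullet> b) *\<^sub>R ?H b x)
      = w x v" for v
  proof -
    have i1: "(\<lambda>t. t *\<^sub>R fd (\<lambda>x. w x b) (?g t) v) integrable_on {0..1}" for b
      using continuous_on_segment_map[OF S(2,3) smooth_on_continuous[OF smooth_on_fd[OF w]] x]
      by (intro integrable_continuous_real continuous_intros)
    have i2: "(\<lambda>t. w (?g t) b) integrable_on {0..1}" for b
      using continuous_on_segment_map[OF S(2,3) smooth_on_continuous[OF w] x]
      by (rule integrable_continuous_real)
    have "(\<Sum>b\<in>Basis. ((x - c) \<bullet> b) *\<^sub>R integral {0..1} (\<lambda>t. t *\<^sub>R fd (\<lambda>x. w x b) (?g t) v) + (v \<bullet> b) *\<^sub>R ?H b x)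
      = integral {0..1} (\<lambda>t. \<Sum>b\<in>Basis. ((x - c) \<bullet> b) *\<^sub>R (t *\<^sub>R fd (\<lambda>x. w x b) (?g t) v) + (v \<bullet> b) *\<^sub>R w (?g t) b)"
    proof (rule integral_unique[symmetric], rule has_integral_sum)
      show "((\<lambda>t. ((x - c) \<bullet> b) *\<^sub>R (t *\<^sub>R fd (\<lambda>x. w x b) (?g t) v) + (v \<bullet> b) *\<^sub>R w (?g t) b) has_integral
          ((x - c) \<bullet> b) *\<^sub>R integral {0..1} (\<lambda>t. t *\<^sub>R fd (\<lambda>x. w x b) (?g t) v) + (v \<bullet> b) *\<^sub>R ?H b x) {0..1}" for b
        using has_integral_add[OF has_integral_cmul[OF integrable_integral[OF i1[of b]]]
            has_integral_cmul[OF integrable_integral[OF i2[of b]]]]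
        by simp
    qed simp
    also have "\<dots> = integral {0..1} (\<lambda>t. w (?g t) v + t *\<^sub>R fd (\<lambda>x. w x v) (?g t) (x - c))"
    proof (rule integral_cong)
      fix t :: real assume t: "t \<in> {0..1}"
      have "(\<Sum>b\<in>Basis. (v \<bullet> b) *\<^sub>R w (?g t) b) = w (?g t) v"
        using linear_sum[OF lin[OF gS[OF t]], of "\<lambda>b. (v \<bullet> b) *\<^sub>R b" Basis] linear_scale[OF lin[OF gS[OF t]]]
        by (simp add: euclidean_representation)
      moreover have "(\<Sum>b\<in>Basis. ((x - c) \<bullet> b) *\<^sub>R fd (\<lambda>x. w x b) (?g t) v) = fd (\<lambda>x. w x v) (?g t) (x - c)"
        using fd_Basis_expand[OF smooth_on_differentiable[OF w gS[OF t]], of v "x - c"]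
        by (simp add: closed[OF gS[OF t], of _ v])
      moreover have "(\<Sum>b\<in>Basis. ((x - c) \<bullet> b) *\<^sub>R (t *\<^sub>R fd (\<lambda>x. w x b) (?g t) v) + (v \<bullet> b) *\<^sub>R w (?g t) b)
         = t *\<^sub>R (\<Sum>b\<in>Basis. ((x - c) \<bullet> b) *\<^sub>R fd (\<lambda>x. w x b) (?g t) v) + (\<Sum>b\<in>Basis. (v \<bullet> b) *\<^sub>R w (?g t) b)"
        by (simp add: sum.distrib scaleR_sum_right mult.commute)
      ultimately show "(\<Sum>b\<in>Basis. ((x - c) \<bullet> b) *\<^sub>R (t *\<^sub>R fd (\<lambda>x. w x b) (?g t) v) + (v \<bullet> b) *\<^sub>R w (?g t) b)
          = w (?g t) v + t *\<^sub>R fd (\<lambda>x. w x v) (?g t) (x - c)"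
        by simp
    qed
    also have "\<dots> = w x v"
      using fundamental_theorem_ray(2)[OF S(2,3) x smooth_onD[OF w]] by (simp add: integral_unique)
    finally show ?thesis .
  qed
  then show "(?f has_derivative w x) (at x)"
    using D by simp
qed

subsection \<open>Smooth parametrizations of a Lie group\<close>

locale lie_group =
  fixes A :: "('g::{topological_group_add, t2_space}, 'e::euclidean_space) chart set"
  assumes lie: "is_lie_group A"
begin

lemma atlas: "is_atlas A"
  using lie by (simp add: is_lie_group_def)

lemma chart:
  assumes "(U, \<phi>) \<in> A"
  shows "open U" "open (\<phi> ` U)" "continuous_on U \<phi>" "continuous_on (\<phi> ` U) (inv_into U \<phi>)"
    "inj_on \<phi> U" "\<And>p. p \<in> U \<Longrightarrow> inv_into U \<phi> (\<phi> p) = p"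
    "\<And>x. x \<in> \<phi> ` U \<Longrightarrow> \<phi> (inv_into U \<phi> x) = x" "\<And>x. x \<in> \<phi> ` U \<Longrightarrow> inv_into U \<phi> x \<in> U"
proof -
  have h: "homeomorphism U (\<phi> ` U) \<phi> (inv_into U \<phi>)" and "open U" "open (\<phi> ` U)"
    using atlas assms by (auto simp: is_atlas_def)
  then show "open U" "open (\<phi> ` U)" by auto
  show "continuous_on U \<phi>" "continuous_on (\<phi> ` U) (inv_into U \<phi>)"
    "\<And>p. p \<in> U \<Longrightarrow> inv_into U \<phi> (\<phi> p) = p"
    "\<And>x. x \<in> \<phi> ` U \<Longrightarrow> \<phi> (inv_into U \<phi> x) = x" "\<And>x. x \<in> \<phi> ` U \<Longrightarrow> inv_into U \<phi> x \<in> U"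
    using h by (auto simp: homeomorphism_def)
  then show "inj_on \<phi> U"
    by (metis inj_on_def)
qed

lemma chart_exists: obtains U \<phi> where "(U, \<phi>) \<in> A" "p \<in> U"
proof -
  have "p \<in> (\<Union>(U, \<phi>)\<in>A. U)"
    using atlas by (simp add: is_atlas_def)
  then show ?thesis
    using that by blast
qed

lemma chart_open_image:
  assumes "(U, \<phi>) \<in> A" "open T" "T \<subseteq> U"
  shows "open (\<phi> ` T)"
proof -
  have "\<phi> ` T = \<phi> ` U \<inter> inv_into U \<phi> -` T"
    using chart[OF assms(1)] assms(3) by force
  then show ?thesis
    using continuous_open_preimage[OF chart(4,2)[OF assms(1)] assms(2)] by (simp add: Int_commute)
qed

lemma chart_open_preimage:
  assumes "(U, \<phi>) \<in> A" "open T"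
  shows "open {p \<in> U. \<phi> p \<in> T}"
  using continuous_open_preimage[OF chart(3,1)[OF assms(1)] assms(2)]
  by (simp add: vimage_def Int_def conj_commute)

text \<open>Plots are smooth maps from open sets of arbitrary Euclidean spaces into the group. They
  are closed under sums, negation and smooth substitution, so smoothness arguments below rarely have
  to return to charts.\<close>

definition plot :: "'v::euclidean_space set \<Rightarrow> ('v \<Rightarrow> 'g) \<Rightarrow> bool"
  where "plot S h \<longleftrightarrow> open S \<and> continuous_on S h \<and>
    (\<forall>(V, \<psi>)\<in>A. smooth_on (S \<inter> h -` V) (\<lambda>x. \<psi> (h x)))"

lemma plotD:
  assumes "plot S h"
  shows "open S" "continuous_on S h" "(V, \<psi>) \<in> A \<Longrightarrow> smooth_on (S \<inter> h -` V) (\<lambda>x. \<psi> (h x))"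
    "open V \<Longrightarrow> open (S \<inter> h -` V)"
  using assms continuous_open_preimage by (auto simp: plot_def)

lemma plot_localI:
  assumes "open S"
    and loc: "\<And>x. x \<in> S \<Longrightarrow> \<exists>T. x \<in> T \<and> plot T h"
  shows "plot S h"
  unfolding plot_def
proof safe
  show "continuous_on S h"
  proof (rule continuous_at_imp_continuous_on, rule ballI)
    fix x assume "x \<in> S"
    then obtain T where "x \<in> T" "plot T h" using loc by blast
    then show "isCont h x"
      using plotD[of T h] continuous_on_eq_continuous_at by blast
  qed
  fix V \<psi> assume V: "(V, \<psi>) \<in> A"
  show "smooth_on (S \<inter> h -` V) (\<lambda>x. \<psi> (h x))"
  proof (rule smooth_on_local)
    fix x assume x: "x \<in> S \<inter> h -` V"
    then obtain T where "x \<in> T" "plot T h" using loc by blast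
    then show "\<exists>T. open T \<and> x \<in> T \<and> smooth_on T (\<lambda>x. \<psi> (h x))"
      using plotD[of T h] V chart(1)[OF V] x by blast
  qed
qed (rule assms(1))

lemma plot_cong: "\<lbrakk>plot S h; \<And>x. x \<in> S \<Longrightarrow> h x = k x\<rbrakk> \<Longrightarrow> plot S k"
proof -
  assume h: "plot S h" and eq: "\<And>x. x \<in> S \<Longrightarrow> h x = k x"
  have "smooth_on (S \<inter> k -` V) (\<lambda>x. \<psi> (k x))" if V: "(V, \<psi>) \<in> A" for V \<psi>
  proof -
    have s: "S \<inter> k -` V = S \<inter> h -` V"
      using eq by auto
    have o: "open (S \<inter> h -` V)"
      using plotD(4)[OF h chart(1)[OF V]] .
    show ?thesis
      unfolding s using smooth_on_cong[OF o, of "\<lambda>x. \<psi> (h x)" "\<lambda>x. \<psi> (k x)"] plotD(3)[OF h V] eq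
      by simp
  qed
  moreover have "continuous_on S k"
    using plotD(2)[OF h] eq by (metis continuous_on_cong)
  ultimately show "plot S k"
    using plotD(1)[OF h] by (auto simp: plot_def)
qed

text \<open>One chart near each point is enough, because the transition maps carry smoothness to all
  other charts.\<close>

lemma plotI:
  assumes "open S" and h: "continuous_on S h"
    and loc: "\<And>x. x \<in> S \<Longrightarrow> \<exists>U \<phi> T. (U, \<phi>) \<in> A \<and> open T \<and> x \<in> T \<and> T \<subseteq> S \<inter> h -` U \<and> smooth_on T (\<lambda>x. \<phi> (h x))"
  shows "plot S h"
  unfolding plot_def
proof safe
  fix V \<psi> assume V: "(V, \<psi>) \<in> A"
  show "smooth_on (S \<inter> h -` V) (\<lambda>x. \<psi> (h x))"
  proof (rule smooth_on_local)
    fix x assume x: "x \<in> S \<inter> h -` V"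
    then obtain U \<phi> T where U: "(U, \<phi>) \<in> A" and T: "open T" "x \<in> T" "T \<subseteq> S \<inter> h -` U" "smooth_on T (\<lambda>x. \<phi> (h x))"
      using loc by blast
    have tr: "smooth_on (\<phi> ` (U \<inter> V)) (\<psi> \<circ> inv_into U \<phi>)"
      using atlas U V by (auto simp: is_atlas_def)
    let ?T = "T \<inter> (S \<inter> h -` V)"
    have oT: "open ?T"
      using T(1) continuous_open_preimage[OF h assms(1) chart(1)[OF V]] by blast
    have oUV: "open (\<phi> ` (U \<inter> V))"
      by (rule chart_open_image[OF U]) (use chart(1)[OF U] chart(1)[OF V] in auto)
    have "smooth_on ?T (\<lambda>x. (\<psi> \<circ> inv_into U \<phi>) (\<phi> (h x)))"
      by (rule smooth_on_compose[OF oT oUV _ smooth_on_subset[OF T(4)] tr]) (use T(3) in auto)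
    then have "smooth_on ?T (\<lambda>x. \<psi> (h x))"
      using smooth_on_cong[OF oT, of "\<lambda>x. (\<psi> \<circ> inv_into U \<phi>) (\<phi> (h x))" "\<lambda>x. \<psi> (h x)"] chart(6)[OF U] T(3)
      by (auto simp: subset_iff)
    then show "\<exists>T. open T \<and> x \<in> T \<and> smooth_on T (\<lambda>x. \<psi> (h x))"
      using oT T(2) x by blast
  qed
qed (use assms in auto)

lemma plot_const: "open S \<Longrightarrow> plot S (\<lambda>x. a)"
  unfolding plot_def
  by (auto intro!: smooth_on_const)

lemma plot_chart: "(U, \<phi>) \<in> A \<Longrightarrow> plot (\<phi> ` U) (inv_into U \<phi>)"
proof (rule plotI)
  assume U: "(U, \<phi>) \<in> A"
  show "open (\<phi> ` U)" "continuous_on (\<phi> ` U) (inv_into U \<phi>)"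
    using chart[OF U] by auto
  have "smooth_on (\<phi> ` U) (\<lambda>x. \<phi> (inv_into U \<phi> x))"
    using smooth_on_id[OF chart(2)[OF U]] smooth_on_cong[OF chart(2)[OF U], of "\<lambda>x. \<phi> (inv_into U \<phi> x)" "\<lambda>x. x"]
      chart(7)[OF U] by blast
  then show "\<exists>V \<psi> T. (V, \<psi>) \<in> A \<and> open T \<and> x \<in> T \<and> T \<subseteq> \<phi> ` U \<inter> inv_into U \<phi> -` V
      \<and> smooth_on T (\<lambda>x. \<psi> (inv_into U \<phi> x))" if "x \<in> \<phi> ` U" for x
    using that U chart[OF U] by (intro exI[of _ U] exI[of _ \<phi>] exI[of _ "\<phi> ` U"]) auto
qed

lemma plot_compose:
  assumes h: "plot T h" and k: "open S" "smooth_on S k" "k ` S \<subseteq> T"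
  shows "plot S (\<lambda>x. h (k x))"
proof -
  have "smooth_on (S \<inter> (\<lambda>x. h (k x)) -` V) (\<lambda>x. \<psi> (h (k x)))" if V: "(V, \<psi>) \<in> A" for V \<psi>
  proof -
    have oT: "open (T \<inter> h -` V)"
      using plotD(4)[OF h chart(1)[OF V]] .
    have "S \<inter> (\<lambda>x. h (k x)) -` V = S \<inter> k -` (T \<inter> h -` V)"
      using k(3) by auto
    then have oS: "open (S \<inter> (\<lambda>x. h (k x)) -` V)"
      using continuous_open_preimage[OF smooth_on_continuous[OF k(2)] k(1) oT] by simp
    show ?thesis
      by (rule smooth_on_compose[OF oS oT _ smooth_on_subset[OF k(2)] plotD(3)[OF h V]]) (use k(3) in auto)
  qed
  moreover have "continuous_on S (\<lambda>x. h (k x))"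
    by (rule continuous_on_compose2[OF plotD(2)[OF h] smooth_on_continuous[OF k(2)] k(3)])
  ultimately show ?thesis
    using k(1) by (auto simp: plot_def)
qed

lemma plot_add:
  assumes h: "plot S h" and k: "plot S k"
  shows "plot S (\<lambda>x. h x + k x)"
proof (rule plotI)
  show "open S" using plotD(1)[OF h] .
  show cont: "continuous_on S (\<lambda>x. h x + k x)"
    using plotD(2)[OF h] plotD(2)[OF k] by (intro continuous_intros)
  fix x assume x: "x \<in> S"
  obtain U \<phi> where U: "(U, \<phi>) \<in> A" "h x \<in> U" using chart_exists by blast
  obtain V \<psi> where V: "(V, \<psi>) \<in> A" "k x \<in> V" using chart_exists by blast
  obtain W \<omega> where W: "(W, \<omega>) \<in> A" "h x + k x \<in> W" using chart_exists by blast
  let ?P = "(\<lambda>(x, y). x + y) -` W"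
  let ?R = "map_prod \<phi> \<psi> ` (U \<times> V \<inter> ?P)"
  have m: "(U \<times> V, map_prod \<phi> \<psi>) \<in> prod_atlas A A"
    using U V by (auto simp: prod_atlas_def)
  have sm: "smooth_on ?R (\<omega> \<circ> (\<lambda>(x, y). x + y) \<circ> inv_into (U \<times> V) (map_prod \<phi> \<psi>))"
    using lie m W(1) unfolding is_lie_group_def smooth_map_def by fast
  have inj: "inj_on (map_prod \<phi> \<psi>) (U \<times> V)"
    using chart(5)[OF U(1)] chart(5)[OF V(1)] by (simp add: map_prod_inj_on)
  have inv: "inv_into (U \<times> V) (map_prod \<phi> \<psi>) (\<phi> a, \<psi> b) = (a, b)" if "a \<in> U" "b \<in> V" for a b
    using inv_into_f_f[OF inj, of "(a, b)"] that by simp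
  \<comment> \<open>Composition needs an open domain for the chart expression of the group law;
    \<open>?R\<close> is the preimage of \<open>W\<close> under addition in coordinates.\<close>
  have oR: "open ?R"
  proof -
    let ?q = "\<lambda>z. inv_into U \<phi> (fst z) + inv_into V \<psi> (snd z)"
    have c: "continuous_on (\<phi> ` U \<times> \<psi> ` V) ?q"
    proof (intro continuous_intros)
      show "continuous_on (\<phi> ` U \<times> \<psi> ` V) (\<lambda>z. inv_into U \<phi> (fst z))"
        by (rule continuous_on_compose2[OF chart(4)[OF U(1)]]) (auto intro!: continuous_intros)
      show "continuous_on (\<phi> ` U \<times> \<psi> ` V) (\<lambda>z. inv_into V \<psi> (snd z))"
        by (rule continuous_on_compose2[OF chart(4)[OF V(1)]]) (auto intro!: continuous_intros)
    qed
    have "open ((\<phi> ` U \<times> \<psi> ` V) \<inter> ?q -` W)"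
      by (rule continuous_open_preimage[OF c]) (auto intro: open_Times chart U V W)
    moreover have "?R = (\<phi> ` U \<times> \<psi> ` V) \<inter> ?q -` W"
      using chart(6)[OF U(1)] chart(6)[OF V(1)] by (auto simp: image_iff)
    ultimately show ?thesis by simp
  qed
  let ?T = "(S \<inter> h -` U) \<inter> (S \<inter> k -` V) \<inter> (S \<inter> (\<lambda>x. h x + k x) -` W)"
  have oT: "open ?T"
    using plotD(4)[OF h chart(1)[OF U(1)]] plotD(4)[OF k chart(1)[OF V(1)]]
      continuous_open_preimage[OF cont \<open>open S\<close> chart(1)[OF W(1)]] by blast
  have pair: "smooth_on ?T (\<lambda>x. (\<phi> (h x), \<psi> (k x)))"
    by (rule smooth_on_Pair[OF oT smooth_on_subset[OF plotD(3)[OF h U(1)]] smooth_on_subset[OF plotD(3)[OF k V(1)]]]) auto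
  have "smooth_on ?T (\<lambda>x. (\<omega> \<circ> (\<lambda>(x, y). x + y) \<circ> inv_into (U \<times> V) (map_prod \<phi> \<psi>)) (\<phi> (h x), \<psi> (k x)))"
  proof (rule smooth_on_compose[OF oT oR _ pair sm], rule image_subsetI)
    fix x assume "x \<in> ?T"
    then have "(\<phi> (h x), \<psi> (k x)) = map_prod \<phi> \<psi> (h x, k x)" "(h x, k x) \<in> U \<times> V \<inter> ?P"
      by auto
    then show "(\<phi> (h x), \<psi> (k x)) \<in> ?R" by blast
  qed
  then have "smooth_on ?T (\<lambda>x. \<omega> (h x + k x))"
    using smooth_on_cong[OF oT, of "\<lambda>x. (\<omega> \<circ> (\<lambda>(x, y). x + y) \<circ> inv_into (U \<times> V) (map_prod \<phi> \<psi>)) (\<phi> (h x), \<psi> (k x))" "\<lambda>x. \<omega> (h x + k x)"]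
    by (simp add: inv)
  moreover have "x \<in> ?T" using x U V W by auto
  ultimately show "\<exists>U \<phi> T. (U, \<phi>) \<in> A \<and> open T \<and> x \<in> T \<and> T \<subseteq> S \<inter> (\<lambda>x. h x + k x) -` U \<and> smooth_on T (\<lambda>x. \<phi> (h x + k x))"
    using oT W(1) by (intro exI[of _ W] exI[of _ \<omega>] exI[of _ ?T]) auto
qed

lemma plot_uminus:
  assumes h: "plot S h"
  shows "plot S (\<lambda>x. - h x)"
proof (rule plotI)
  show "open S" using plotD(1)[OF h] .
  show cont: "continuous_on S (\<lambda>x. - h x)"
    using plotD(2)[OF h] by (intro continuous_intros)
  fix x assume x: "x \<in> S"
  obtain U \<phi> where U: "(U, \<phi>) \<in> A" "h x \<in> U" using chart_exists by blast
  obtain W \<omega> where W: "(W, \<omega>) \<in> A" "- h x \<in> W" using chart_exists by blast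
  let ?R = "\<phi> ` (U \<inter> uminus -` W)"
  have sm: "smooth_on ?R (\<omega> \<circ> uminus \<circ> inv_into U \<phi>)"
    using lie U(1) W(1) unfolding is_lie_group_def smooth_map_def by fast
  have "open (uminus -` W)"
    by (rule open_vimage[OF chart(1)[OF W(1)]]) (intro continuous_intros)
  then have oR: "open ?R"
    by (intro chart_open_image[OF U(1)]) (use chart(1)[OF U(1)] in auto)
  let ?T = "(S \<inter> h -` U) \<inter> (S \<inter> (\<lambda>x. - h x) -` W)"
  have oT: "open ?T"
    using plotD(4)[OF h chart(1)[OF U(1)]] continuous_open_preimage[OF cont \<open>open S\<close> chart(1)[OF W(1)]] by blast
  have "smooth_on ?T (\<lambda>x. (\<omega> \<circ> uminus \<circ> inv_into U \<phi>) (\<phi> (h x)))"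
    by (rule smooth_on_compose[OF oT oR _ smooth_on_subset[OF plotD(3)[OF h U(1)]] sm]) auto
  then have "smooth_on ?T (\<lambda>x. \<omega> (- h x))"
    using smooth_on_cong[OF oT, of "\<lambda>x. (\<omega> \<circ> uminus \<circ> inv_into U \<phi>) (\<phi> (h x))" "\<lambda>x. \<omega> (- h x)"] chart(6)[OF U(1)]
    by simp
  moreover have "x \<in> ?T" using x U W by auto
  ultimately show "\<exists>U \<phi> T. (U, \<phi>) \<in> A \<and> open T \<and> x \<in> T \<and> T \<subseteq> S \<inter> (\<lambda>x. - h x) -` U \<and> smooth_on T (\<lambda>x. \<phi> (- h x))"
    using oT W(1) by (intro exI[of _ W] exI[of _ \<omega>] exI[of _ ?T]) auto
qed

lemma plot_UNIV_smooth_map: "plot UNIV F \<Longrightarrow> smooth_map euclidean_atlas A F"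
  by (auto simp: plot_def smooth_map_def euclidean_atlas_def o_def)

abbreviation "C \<equiv> smooth_functions A"

lemma smooth_function_iff:
  "f \<in> C \<longleftrightarrow> (\<forall>(U, \<phi>)\<in>A. smooth_on (\<phi> ` U) (\<lambda>x. f (inv_into U \<phi> x)))"
proof
  assume "f \<in> C"
  then show "\<forall>(U, \<phi>)\<in>A. smooth_on (\<phi> ` U) (\<lambda>x. f (inv_into U \<phi> x))"
    by (auto simp: smooth_functions_def smooth_map_def euclidean_atlas_def o_def)
next
  assume f: "\<forall>(U, \<phi>)\<in>A. smooth_on (\<phi> ` U) (\<lambda>x. f (inv_into U \<phi> x))"
  have "isCont f p" for p
  proof -
    obtain U \<phi> where U: "(U, \<phi>) \<in> A" "p \<in> U" using chart_exists by blast
    have "continuous_on (\<phi> ` U) (\<lambda>x. f (inv_into U \<phi> x))"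
      using f U smooth_on_continuous by blast
    then have "continuous_on U (\<lambda>q. f (inv_into U \<phi> (\<phi> q)))"
      by (rule continuous_on_compose2[OF _ chart(3)[OF U(1)]]) auto
    then have "continuous_on U f"
      using chart(6)[OF U(1)] by (simp cong: continuous_on_cong)
    then show ?thesis
      using U chart(1) continuous_on_eq_continuous_at by blast
  qed
  then have "continuous_on UNIV f"
    by (simp add: continuous_at_imp_continuous_on)
  with f show "f \<in> C"
    by (auto simp: smooth_functions_def smooth_map_def euclidean_atlas_def o_def)
qed

lemma smooth_on_plot:
  assumes f: "f \<in> C" and h: "plot S h"
  shows "smooth_on S (\<lambda>x. f (h x))"
proof (rule smooth_on_local)
  fix x assume x: "x \<in> S"
  obtain U \<phi> where U: "(U, \<phi>) \<in> A" "h x \<in> U" using chart_exists by blast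
  let ?T = "S \<inter> h -` U"
  have oT: "open ?T"
    using plotD(4)[OF h chart(1)[OF U(1)]] .
  have fU: "smooth_on (\<phi> ` U) (\<lambda>x. f (inv_into U \<phi> x))"
    using f U by (auto simp: smooth_function_iff)
  have "smooth_on ?T (\<lambda>x. f (inv_into U \<phi> (\<phi> (h x))))"
    by (rule smooth_on_compose[OF oT chart(2)[OF U(1)] _ plotD(3)[OF h U(1)] fU]) auto
  then have "smooth_on ?T (\<lambda>x. f (h x))"
    using smooth_on_cong[OF oT, of "\<lambda>x. f (inv_into U \<phi> (\<phi> (h x)))" "\<lambda>x. f (h x)"] chart(6)[OF U(1)] by simp
  then show "\<exists>T. open T \<and> x \<in> T \<and> smooth_on T (\<lambda>x. f (h x))"
    using oT x U by (intro exI[of _ ?T]) auto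
qed

lemma smooth_function_localI:
  assumes "\<And>p. \<exists>U \<phi> T. (U, \<phi>) \<in> A \<and> p \<in> U \<and> open T \<and> \<phi> p \<in> T \<and> T \<subseteq> \<phi> ` U \<and> smooth_on T (\<lambda>x. f (inv_into U \<phi> x))"
  shows "f \<in> C"
  unfolding smooth_function_iff
proof safe
  fix V \<psi> assume V: "(V, \<psi>) \<in> A"
  show "smooth_on (\<psi> ` V) (\<lambda>x. f (inv_into V \<psi> x))"
  proof (rule smooth_on_local)
    fix x assume x: "x \<in> \<psi> ` V"
    let ?p = "inv_into V \<psi>"
    obtain U \<phi> T where U: "(U, \<phi>) \<in> A" "?p x \<in> U" and T: "open T" "\<phi> (?p x) \<in> T" "T \<subseteq> \<phi> ` U" "smooth_on T (\<lambda>x. f (inv_into U \<phi> x))"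
      using assms[of "?p x"] by (elim exE conjE)
    let ?S = "\<psi> ` V \<inter> ?p -` U"
    have oS: "open ?S" and sS: "smooth_on ?S (\<lambda>x. \<phi> (?p x))"
      by (rule plotD(4)[OF plot_chart[OF V] chart(1)[OF U(1)]], rule plotD(3)[OF plot_chart[OF V] U(1)])
    have oR: "open (?S \<inter> (\<lambda>x. \<phi> (?p x)) -` T)"
      by (rule continuous_open_preimage[OF smooth_on_continuous[OF sS] oS T(1)])
    have "smooth_on (?S \<inter> (\<lambda>x. \<phi> (?p x)) -` T) (\<lambda>x. f (inv_into U \<phi> (\<phi> (?p x))))"
      by (rule smooth_on_compose[OF oR T(1) _ smooth_on_subset[OF sS] T(4)]) auto
    then have "smooth_on (?S \<inter> (\<lambda>x. \<phi> (?p x)) -` T) (\<lambda>x. f (?p x))"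
      using smooth_on_cong[OF oR, of "\<lambda>x. f (inv_into U \<phi> (\<phi> (?p x)))" "\<lambda>x. f (?p x)"] chart(6)[OF U(1)] by simp
    then show "\<exists>T. open T \<and> x \<in> T \<and> smooth_on T (\<lambda>x. f (?p x))"
      using oR x U T by (intro exI[of _ "?S \<inter> (\<lambda>x. \<phi> (?p x)) -` T"]) auto
  qed
qed

lemma C_const [simp]: "(\<lambda>_. c) \<in> C"
  using chart(2) by (auto simp: smooth_function_iff intro!: smooth_on_const)

lemma C_add: "\<lbrakk>f \<in> C; h \<in> C\<rbrakk> \<Longrightarrow> f + h \<in> C"
  using chart(2) by (auto simp: smooth_function_iff intro!: smooth_on_add)

lemma C_mult: "\<lbrakk>f \<in> C; h \<in> C\<rbrakk> \<Longrightarrow> f * h \<in> C"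
  using chart(2) by (auto simp: smooth_function_iff intro!: smooth_on_mult)

lemma C_scaleR: "f \<in> C \<Longrightarrow> c *\<^sub>R f \<in> C"
  using C_mult[of "\<lambda>_. c" f] by (simp add: scaleR_fun_def times_fun_def)

lemma C_uminus: "f \<in> C \<Longrightarrow> - f \<in> C"
  using C_scaleR[of f "-1"] by simp

lemma C_diff: "\<lbrakk>f \<in> C; h \<in> C\<rbrakk> \<Longrightarrow> f - h \<in> C"
  using C_add[of f "- h"] C_uminus by simp

lemma C_zero [simp]: "0 \<in> C"
  using C_const[of 0] by (simp add: zero_fun_def)

lemma C_sum: "(\<And>i. i \<in> I \<Longrightarrow> f i \<in> C) \<Longrightarrow> (\<Sum>i\<in>I. f i) \<in> C"
  by (induction I rule: infinite_finite_induct) (auto intro: C_add)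

lemma C_translate: "f \<in> C \<Longrightarrow> (\<lambda>x. f (a + x)) \<in> C"
  unfolding smooth_function_iff[of "\<lambda>x. f (a + x)"]
proof safe
  fix U \<phi> assume "f \<in> C" "(U, \<phi>) \<in> A"
  then show "smooth_on (\<phi> ` U) (\<lambda>x. f (a + inv_into U \<phi> x))"
    by (intro smooth_on_plot[of f _ "\<lambda>x. a + inv_into U \<phi> x"] plot_add plot_const plot_chart chart(2)) auto
qed

lemma C_translate_iff: "(\<lambda>x. f (a + x)) \<in> C \<longleftrightarrow> f \<in> C"
  using C_translate[of "\<lambda>x. f (a + x)" "- a"] C_translate[of f a] by (auto simp: add.assoc[symmetric])

section \<open>Derivations and left invariant fields\<close>

abbreviation "VF \<equiv> vector_fields A"

lemma VF_props:
  assumes "X \<in> VF"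
  shows VF_smooth: "f \<in> C \<Longrightarrow> X f \<in> C"
    and VF_add: "f \<in> C \<Longrightarrow> h \<in> C \<Longrightarrow> X (f + h) = X f + X h"
    and VF_scaleR: "f \<in> C \<Longrightarrow> X (c *\<^sub>R f) = c *\<^sub>R X f"
    and VF_mult: "f \<in> C \<Longrightarrow> h \<in> C \<Longrightarrow> X (f * h) = X f * h + f * X h"
    and VF_outside: "f \<notin> C \<Longrightarrow> X f = 0"
  using assms by (auto simp: vector_fields_def)

lemma VF_zero_function: "X \<in> VF \<Longrightarrow> X 0 = 0"
  using VF_scaleR[of X 0 0] by simp

text \<open>The product rule for \<open>1 * 1\<close> gives \<open>X 1 = 2 * X 1\<close>.\<close>

lemma VF_const: "X \<in> VF \<Longrightarrow> X (\<lambda>_. c) = 0"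
proof -
  assume X: "X \<in> VF"
  have 1: "(1 :: 'g \<Rightarrow> real) \<in> C"
    using C_const[of 1] by (simp add: one_fun_def)
  have "X (1 * 1) = X 1 * 1 + 1 * X 1"
    by (rule VF_mult[OF X 1 1])
  then have "X 1 = 0" by simp
  then show "X (\<lambda>_. c) = 0"
    using VF_scaleR[OF X 1, of c] by (simp add: scaleR_fun_def one_fun_def zero_fun_def)
qed

lemma VF_diff_function: "\<lbrakk>X \<in> VF; f \<in> C; h \<in> C\<rbrakk> \<Longrightarrow> X (f - h) = X f - X h"
  using VF_add[of X f "(-1) *\<^sub>R h"] VF_scaleR[of X h "-1"] C_scaleR[of h "-1"] by simp

lemma VF_sum_function: "\<lbrakk>X \<in> VF; \<And>i. i \<in> I \<Longrightarrow> f i \<in> C\<rbrakk> \<Longrightarrow> X (\<Sum>i\<in>I. f i) = (\<Sum>i\<in>I. X (f i))"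
  by (induction I rule: infinite_finite_induct) (auto simp: VF_zero_function VF_add C_sum)

lemma VFI:
  assumes "\<And>f. f \<in> C \<Longrightarrow> X f \<in> C"
    and "\<And>f h. f \<in> C \<Longrightarrow> h \<in> C \<Longrightarrow> X (f + h) = X f + X h"
    and "\<And>f c. f \<in> C \<Longrightarrow> X (c *\<^sub>R f) = c *\<^sub>R X f"
    and "\<And>f h. f \<in> C \<Longrightarrow> h \<in> C \<Longrightarrow> X (f * h) = X f * h + f * X h"
    and "\<And>f. f \<notin> C \<Longrightarrow> X f = 0"
  shows "X \<in> VF"
  using assms by (simp add: vector_fields_def)

lemma VF_plus: "\<lbrakk>X \<in> VF; Y \<in> VF\<rbrakk> \<Longrightarrow> X + Y \<in> VF"
  by (rule VFI) (auto simp: VF_props C_add algebra_simps scaleR_add_right)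

lemma fun_mult_scaleR: "f * (c *\<^sub>R h) = c *\<^sub>R (f * h)" for f h :: "'m \<Rightarrow> real"
  by (simp add: fun_eq_iff scaleR_fun_def)

lemma VF_fmult: "\<lbrakk>u \<in> C; X \<in> VF\<rbrakk> \<Longrightarrow> fmult u X \<in> VF"
  by (rule VFI) (auto simp: VF_props C_mult fmult_def fun_mult_scaleR algebra_simps)

text \<open>Through this, linearity over the smooth functions yields linearity over the reals for
  metric, complex structure and connections.\<close>

lemma fmult_const: "fmult (\<lambda>_. c) X = c *\<^sub>R X"
  by (simp add: fmult_def scaleR_fun_def times_fun_def)

lemma VF_scale: "X \<in> VF \<Longrightarrow> c *\<^sub>R X \<in> VF"
  using VF_fmult[of "\<lambda>_. c" X] by (simp add: fmult_const)

lemma VF_0: "0 \<in> VF"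
  by (rule VFI) auto

lemma subspace_VF: "subspace VF"
  by (simp add: subspace_def VF_0 VF_plus VF_scale)

lemmas VF_minus = subspace_diff[OF subspace_VF]
lemmas VF_uminus = subspace_neg[OF subspace_VF]
lemmas VF_sum = subspace_sum[OF subspace_VF]

lemma VF_bracket: "\<lbrakk>X \<in> VF; Y \<in> VF\<rbrakk> \<Longrightarrow> bracket X Y \<in> VF"
proof (rule VFI)
  assume X: "X \<in> VF" and Y: "Y \<in> VF"
  note P = VF_props[OF X] VF_props[OF Y]
  show "bracket X Y f \<in> C" if "f \<in> C" for f
    using that by (simp add: bracket_def C_diff P)
  show "bracket X Y (f + h) = bracket X Y f + bracket X Y h" if "f \<in> C" "h \<in> C" for f h
    using that by (simp add: bracket_def P)
  show "bracket X Y (c *\<^sub>R f) = c *\<^sub>R bracket X Y f" if "f \<in> C" for f c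
    using that by (simp add: bracket_def P scaleR_diff_right)
  show "bracket X Y (f * h) = bracket X Y f * h + f * bracket X Y h" if "f \<in> C" "h \<in> C" for f h
    using that by (simp add: bracket_def P C_mult algebra_simps)
  show "bracket X Y f = 0" if "f \<notin> C" for f
    using that X Y by (simp add: bracket_def P VF_zero_function)
qed

lemma push_left_VF: "X \<in> VF \<Longrightarrow> push_left a X \<in> VF"
proof (rule VFI)
  assume X: "X \<in> VF"
  note P = VF_props[OF X]
  have plus: "(\<lambda>x. (f + h) (a + x)) = (\<lambda>x. f (a + x)) + (\<lambda>x. h (a + x))" for f h :: "'g \<Rightarrow> real"
    by (simp add: plus_fun_def)
  have times: "(\<lambda>x. (f * h) (a + x)) = (\<lambda>x. f (a + x)) * (\<lambda>x. h (a + x))" for f h :: "'g \<Rightarrow> real"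
    by (simp add: times_fun_def)
  have scale: "(\<lambda>x. (c *\<^sub>R f) (a + x)) = c *\<^sub>R (\<lambda>x. f (a + x))" for f :: "'g \<Rightarrow> real" and c
    by (simp add: scaleR_fun_def)
  show "push_left a X f \<in> C" if "f \<in> C" for f
    using C_translate[OF P(1)[OF C_translate[OF that]]] by (simp add: push_left_def)
  show "push_left a X (f + h) = push_left a X f + push_left a X h" if "f \<in> C" "h \<in> C" for f h
    using that C_translate unfolding push_left_def plus by (simp add: P(2) fun_eq_iff)
  show "push_left a X (c *\<^sub>R f) = c *\<^sub>R push_left a X f" if "f \<in> C" for f c
    unfolding push_left_def scale P(3)[OF C_translate[OF that]] by (simp add: fun_eq_iff scaleR_fun_def)
  show "push_left a X (f * h) = push_left a X f * h + f * push_left a X h" if "f \<in> C" "h \<in> C" for f h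
    using that C_translate unfolding push_left_def times by (simp add: P(4) fun_eq_iff add.assoc[symmetric])
  show "push_left a X f = 0" if "f \<notin> C" for f
    using that by (simp add: push_left_def P(5) C_translate_iff zero_fun_def)
qed

abbreviation "L \<equiv> lie_algebra A"

lemma L_VF: "X \<in> L \<Longrightarrow> X \<in> VF"
  by (simp add: lie_algebra_def)

lemma L_translate: "X \<in> L \<Longrightarrow> X f (a + p) = X (\<lambda>x. f (a + x)) p"
proof -
  assume "X \<in> L"
  then have "push_left a X f (a + p) = X f (a + p)"
    by (simp add: lie_algebra_def)
  then show ?thesis
    by (simp add: push_left_def add.assoc[symmetric])
qed

lemma L_bracket: "\<lbrakk>X \<in> L; Y \<in> L\<rbrakk> \<Longrightarrow> bracket X Y \<in> L"
proof -
  assume X: "X \<in> L" and Y: "Y \<in> L"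
  have XY: "X (\<lambda>x. f (a + x)) = (\<lambda>x. X f (a + x))" "Y (\<lambda>x. f (a + x)) = (\<lambda>x. Y f (a + x))" for f a
    using L_translate[OF X] L_translate[OF Y] by auto
  have "push_left a (bracket X Y) = bracket X Y" for a
    by (simp add: push_left_def bracket_def fun_eq_iff XY add.assoc[symmetric])
  then show ?thesis
    using X Y by (simp add: lie_algebra_def VF_bracket)
qed

lemma subspace_L: "subspace L"
  unfolding subspace_def
proof (intro conjI ballI allI)
  show "0 \<in> L"
    by (simp add: lie_algebra_def VF_0 push_left_def fun_eq_iff)
  show "X + Y \<in> L" if "X \<in> L" "Y \<in> L" for X Y
    using that unfolding lie_algebra_def
    by (simp add: VF_plus push_left_def fun_eq_iff)
  show "c *\<^sub>R X \<in> L" if "X \<in> L" for c X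
  proof -
    have "push_left a (c *\<^sub>R X) = c *\<^sub>R push_left a X" for a
      by (simp add: push_left_def fun_eq_iff scaleR_fun_def)
    with that show ?thesis
      by (simp add: lie_algebra_def VF_scale)
  qed
qed

lemma bracket_skew: "bracket X Y = - bracket Y X"
  by (simp add: bracket_def fun_eq_iff)

lemma bracket_jacobi:
  assumes X: "X \<in> VF" and Y: "Y \<in> VF" and Z: "Z \<in> VF"
  shows "bracket X (bracket Y Z) + bracket Y (bracket Z X) + bracket Z (bracket X Y) = 0"
proof
  fix f
  note P = VF_props[OF X] VF_props[OF Y] VF_props[OF Z] VF_zero_function[OF X] VF_zero_function[OF Y] VF_zero_function[OF Z]
  show "(bracket X (bracket Y Z) + bracket Y (bracket Z X) + bracket Z (bracket X Y)) f = 0 f"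
  proof (cases "f \<in> C")
    case True
    then show ?thesis
      by (simp add: bracket_def P VF_diff_function X Y Z) (simp add: fun_eq_iff)
  next
    case False
    then show ?thesis
      by (simp add: bracket_def P)
  qed
qed

end

subsection \<open>Left invariant fields and the expansion of derivations\<close>

lemma Ck_on_inverse:
  fixes f :: "'a::euclidean_space \<Rightarrow> real"
  shows "\<lbrakk>open S; Ck_on k S f; \<And>x. x \<in> S \<Longrightarrow> f x \<noteq> 0\<rbrakk> \<Longrightarrow> Ck_on k S (\<lambda>x. inverse (f x))"
proof (induction k)
  case 0
  then show ?case by (auto intro!: continuous_intros)
next
  case (Suc k)
  have IH: "Ck_on k S (\<lambda>x. inverse (f x))"
    using Suc Ck_on_Suc_imp by blast
  show ?case
  proof (rule Ck_on_SucI[OF Suc.prems(1)])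
    show "((\<lambda>x. inverse (f x)) has_derivative (\<lambda>v. (- 1) * (inverse (f x) * fd f x v * inverse (f x)))) (at x)"
      if "x \<in> S" for x
      using Deriv.has_derivative_inverse[OF Suc.prems(3)[OF that] Ck_on_has_derivative[OF Suc.prems(2) that]] by simp
    show "Ck_on k S (\<lambda>x. (- 1) * (inverse (f x) * fd f x v * inverse (f x)))" for v
      using Suc.prems IH by (intro Ck_on_mult Ck_on_const) auto
  qed
qed

lemma smooth_on_inverse:
  fixes f :: "'a::euclidean_space \<Rightarrow> real"
  shows "\<lbrakk>open S; smooth_on S f; \<And>x. x \<in> S \<Longrightarrow> f x \<noteq> 0\<rbrakk> \<Longrightarrow> smooth_on S (\<lambda>x. inverse (f x))"
  by (simp add: smooth_on_def Ck_on_inverse)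

text \<open>The second summand of the denominator vanishes on the half ball, where the quotient is
  therefore 1, and keeps the denominator positive where the bump is zero.\<close>

definition plateau :: "'a::euclidean_space \<Rightarrow> real \<Rightarrow> 'a \<Rightarrow> real"
  where "plateau c r x =
    bump c r x * inverse (bump c r x + flat_exp 0 ((x - c) \<bullet> (x - c) - (r / 2)\<^sup>2))"

lemma flat_exp_nonneg: "flat_exp 0 t \<ge> 0" and flat_exp_pos_iff: "flat_exp 0 t > 0 \<longleftrightarrow> t > 0"
  by (auto simp: flat_exp_def)

lemma bump_nonneg: "bump c r x \<ge> 0"
  by (simp add: bump_def flat_exp_nonneg)

lemma plateau_denominator_pos:
  assumes "r > 0"
  shows "bump c r x + flat_exp 0 ((x - c) \<bullet> (x - c) - (r / 2)\<^sup>2) > 0"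
proof (cases "(x - c) \<bullet> (x - c) < r\<^sup>2")
  case True
  then have "bump c r x > 0"
    by (simp add: bump_def flat_exp_pos_iff)
  then show ?thesis
    by (simp add: add_pos_nonneg flat_exp_nonneg)
next
  case False
  then have "(x - c) \<bullet> (x - c) - (r / 2)\<^sup>2 > 0"
    using assms by (simp add: power_divide field_simps) (smt (verit) zero_less_power)
  then have "flat_exp 0 ((x - c) \<bullet> (x - c) - (r / 2)\<^sup>2) > 0"
    by (simp only: flat_exp_pos_iff)
  then show ?thesis
    using bump_nonneg[of c r x] by simp
qed

lemma smooth_on_plateau: "r > 0 \<Longrightarrow> smooth_on UNIV (plateau c r)"
proof -
  assume r: "r > 0"
  have "smooth_on UNIV (\<lambda>x. (x - c) \<bullet> (x - c) - (r / 2)\<^sup>2)"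
    by (intro smooth_on_diff smooth_on_inner smooth_on_const smooth_on_id open_UNIV)
  from smooth_on_compose[OF open_UNIV open_UNIV subset_UNIV this smooth_onI[OF Ck_on_flat_exp]]
  have "smooth_on UNIV (\<lambda>x. bump c r x + flat_exp 0 ((x - c) \<bullet> (x - c) - (r / 2)\<^sup>2))"
    by (intro smooth_on_add smooth_on_bump) auto
  moreover have "bump c r x + flat_exp 0 ((x - c) \<bullet> (x - c) - (r / 2)\<^sup>2) \<noteq> 0" for x
    using plateau_denominator_pos[OF r, of c x] by linarith
  ultimately have "smooth_on UNIV (\<lambda>x. inverse (bump c r x + flat_exp 0 ((x - c) \<bullet> (x - c) - (r / 2)\<^sup>2)))"
    by (rule smooth_on_inverse[OF open_UNIV])
  then show ?thesis
    unfolding plateau_def by (intro smooth_on_mult smooth_on_bump) auto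
qed

lemma plateau_nonzero_iff: "r > 0 \<Longrightarrow> plateau c r x \<noteq> 0 \<longleftrightarrow> x \<in> ball c r"
  using plateau_denominator_pos[of r c x] bump_nonzero_iff[of r c x] by (simp add: plateau_def)

lemma plateau_eq_1:
  assumes "r > 0" "x \<in> ball c (r / 2)"
  shows "plateau c r x = 1"
proof -
  have "norm (x - c) < r / 2"
    using assms by (simp add: dist_norm norm_minus_commute)
  then have "norm (x - c) ^ 2 < (r / 2) ^ 2"
    by (intro power_strict_mono) auto
  then have "flat_exp 0 ((x - c) \<bullet> (x - c) - (r / 2)\<^sup>2) = 0"
    by (simp add: flat_exp_def power2_norm_eq_inner)
  then show ?thesis
    using plateau_denominator_pos[OF assms(1), of c x] by (simp add: plateau_def)
qed

lemma sum_fun_apply: "(\<Sum>i\<in>I. f i) x = (\<Sum>i\<in>I. f i x)" for f :: "'i \<Rightarrow> 'm \<Rightarrow> 'b::comm_monoid_add"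
  by (induction I rule: infinite_finite_induct) auto

section \<open>A chart at the unit\<close>

locale lie_group_chart = lie_group A
  for A :: "('g::{topological_group_add, t2_space}, 'e::euclidean_space) chart set" +
  fixes U :: "'g set" and \<phi> :: "'g \<Rightarrow> 'e"
  assumes UA: "(U, \<phi>) \<in> A" and U0: "0 \<in> U"
begin

definition "pt = inv_into U \<phi>"
definition "x0 = \<phi> 0"
definition "W = \<phi> ` U"

lemma W_open: "open W" and x0_W: "x0 \<in> W"
  using chart(2)[OF UA] U0 by (auto simp: W_def x0_def)

lemma pt_simps [simp]: "q \<in> U \<Longrightarrow> pt (\<phi> q) = q" "x \<in> W \<Longrightarrow> \<phi> (pt x) = x" "x \<in> W \<Longrightarrow> pt x \<in> U"
  "q \<in> U \<Longrightarrow> \<phi> q \<in> W" "pt x0 = 0"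
  using chart(6,7,8)[OF UA] U0 by (auto simp: pt_def W_def x0_def)

lemma plot_pt: "plot W pt"
  using plot_chart[OF UA] by (simp add: W_def pt_def)

lemma smooth_on_pt: "f \<in> C \<Longrightarrow> smooth_on W (\<lambda>x. f (pt x))"
  by (rule smooth_on_plot[OF _ plot_pt])

definition "R1 = (SOME r. r > 0 \<and> ball x0 r \<subseteq> W)"

lemma R1: "R1 > 0" "ball x0 R1 \<subseteq> W"
proof -
  have "\<exists>r. r > 0 \<and> ball x0 r \<subseteq> W"
    using W_open x0_W open_contains_ball by blast
  from someI_ex[OF this] show "R1 > 0" "ball x0 R1 \<subseteq> W"
    by (auto simp: R1_def)
qed

text \<open>Halving leaves the closed ball of radius \<open>R\<close> inside the chart, so its
  preimage is a compact set that carries the cutoffs.\<close>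

definition "R = R1 / 2"

lemma R: "R > 0" "cball x0 R \<subseteq> ball x0 R1" "ball x0 R \<subseteq> W" "ball x0 (R / 2) \<subseteq> ball x0 R"
  "ball x0 R \<subseteq> ball x0 R1"
proof -
  show "R > 0" "cball x0 R \<subseteq> ball x0 R1" "ball x0 (R / 2) \<subseteq> ball x0 R"
    using R1 by (auto simp: R_def cball_subset_ball_iff)
  then show "ball x0 R \<subseteq> W" "ball x0 R \<subseteq> ball x0 R1"
    using R1 ball_subset_cball by blast+
qed

definition cut :: "('e \<Rightarrow> real) \<Rightarrow> 'g \<Rightarrow> real"
  where "cut k q = (if q \<in> U \<and> \<phi> q \<in> ball x0 R then plateau x0 R (\<phi> q) * k (\<phi> q) else 0)"

text \<open>Inside the chart the formula is a product of smooth functions. Elsewhere the Hausdorff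
  property is used: the compact preimage of the closed ball is closed, and the function vanishes on
  its open complement.\<close>

lemma cut_smooth:
  assumes k: "smooth_on (ball x0 R1) k"
  shows "cut k \<in> C"
proof (rule smooth_function_localI)
  fix q
  let ?K = "pt ` cball x0 R"
  have KW: "cball x0 R \<subseteq> W"
    using R R1 by blast
  have "compact ?K"
    using continuous_on_subset[OF plotD(2)[OF plot_pt] KW] by (intro compact_continuous_image) auto
  then have K: "closed ?K"
    by (rule compact_imp_closed)
  show "\<exists>V \<psi> T. (V, \<psi>) \<in> A \<and> q \<in> V \<and> open T \<and> \<psi> q \<in> T \<and> T \<subseteq> \<psi> ` V \<and> smooth_on T (\<lambda>x. cut k (inv_into V \<psi> x))"
  proof (cases "q \<in> U \<and> \<phi> q \<in> ball x0 R1")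
    case True
    have "smooth_on (ball x0 R1) (\<lambda>x. plateau x0 R x * k x)"
      by (intro smooth_on_mult k smooth_on_subset[OF smooth_on_plateau[OF R(1)]]) auto
    moreover have "plateau x0 R x * k x = cut k (pt x)" if "x \<in> ball x0 R1" for x
      using that R1 plateau_nonzero_iff[OF R(1), of x0 x] by (auto simp: cut_def)
    ultimately have "smooth_on (ball x0 R1) (\<lambda>x. cut k (pt x))"
      using smooth_on_cong[OF open_ball, of x0 R1 "\<lambda>x. plateau x0 R x * k x" "\<lambda>x. cut k (pt x)"] by simp
    then show ?thesis
      using True UA R1(2) by (intro exI[of _ U] exI[of _ \<phi>] exI[of _ "ball x0 R1"]) (auto simp: pt_def W_def)
  next
    case False
    obtain V \<psi> where V: "(V, \<psi>) \<in> A" "q \<in> V"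
      using chart_exists by blast
    let ?T = "\<psi> ` (V - ?K)"
    have oT: "open ?T"
      by (rule chart_open_image[OF V(1)]) (use chart(1)[OF V(1)] K in auto)
    have "q \<notin> ?K"
    proof
      assume "q \<in> ?K"
      then obtain x where "x \<in> cball x0 R" "q = pt x" by blast
      with False KW R(2) show False
        by (metis pt_simps(2,3) subsetD)
    qed
    moreover have "cut k p = 0" if "p \<notin> ?K" for p
    proof (rule ccontr)
      assume "cut k p \<noteq> 0"
      then have "p \<in> U" "\<phi> p \<in> cball x0 R"
        by (auto simp: cut_def split: if_splits)
      then have "p \<in> ?K"
        by (metis image_eqI pt_simps(1))
      with that show False ..
    qed
    then have "cut k (inv_into V \<psi> x) = 0" if "x \<in> ?T" for x
      using that chart(6)[OF V(1)] by auto
    then have "smooth_on ?T (\<lambda>x. cut k (inv_into V \<psi> x))"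
      using smooth_on_cong[OF oT, of "\<lambda>x. cut k (inv_into V \<psi> x)" "\<lambda>x. 0"] smooth_on_const[OF oT] by blast
    ultimately show ?thesis
      using V oT by (intro exI[of _ V] exI[of _ \<psi>] exI[of _ ?T]) auto
  qed
qed

lemma cut_pt: "x \<in> ball x0 R \<Longrightarrow> cut k (pt x) = plateau x0 R x * k x"
  using R by (auto simp: cut_def)

lemma cut_pt_plateau: "x \<in> ball x0 (R / 2) \<Longrightarrow> cut k (pt x) = k x"
  using cut_pt[of x k] R plateau_eq_1[OF R(1), of x x0] by auto

definition "\<beta> = cut (\<lambda>_. 1)"
definition "hc b = cut (\<lambda>x. x \<bullet> b)"

lemma \<beta>_C: "\<beta> \<in> C" and hc_C: "hc b \<in> C"
  unfolding \<beta>_def hc_def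
  by (intro cut_smooth smooth_on_const smooth_on_inner smooth_on_id open_ball)+

text \<open>Multiplied by \<open>\<beta>\<^sup>2\<close>, Hadamard's lemma in the chart becomes an identity of globally smooth
  functions, to which a derivation can be applied.\<close>

lemma derivation_expand:
  assumes X: "X \<in> VF" and f: "f \<in> C" and x: "x \<in> ball x0 R"
  shows "\<beta> (pt x) * X f (pt x) =
    (\<Sum>b\<in>Basis. (X (hc b) (pt x) - (x \<bullet> b) * X \<beta> (pt x)) * fd (\<lambda>x. f (pt x)) x b)"
proof -
  let ?q = "pt x" and ?F = "\<lambda>x. f (pt x)"
  have xB: "x \<in> ball x0 R1" using x R(5) by blast
  obtain h where h: "\<And>b. smooth_on (ball x0 R1) (h b)" "\<And>b. h b x = fd ?F x b"
    "\<And>y. y \<in> ball x0 R1 \<Longrightarrow> ?F y = ?F x + (\<Sum>b\<in>Basis. ((y - x) \<bullet> b) *\<^sub>R h b y)"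
    using hadamard[OF open_ball convex_ball xB smooth_on_subset[OF smooth_on_pt[OF f] R1(2)]] by blast
  \<comment> \<open>This is the cutoff times the b-th coordinate centred at \<open>x\<close>. It
    vanishes at \<open>?q\<close>, so the product rule keeps only the term that differentiates
    it.\<close>
  let ?c = "\<lambda>b. hc b - (x \<bullet> b) *\<^sub>R \<beta>"
  have cC: "?c b \<in> C" and gC: "cut (h b) \<in> C" for b
    using h(1) by (auto intro!: C_diff C_scaleR hc_C \<beta>_C cut_smooth)
  have eq: "(\<beta> * \<beta>) * (f - (\<lambda>_. f ?q)) = (\<Sum>b\<in>Basis. ?c b * cut (h b))"
  proof
    fix p
    have s: "(\<Sum>b\<in>Basis. ?c b * cut (h b)) p = (\<Sum>b\<in>Basis. (hc b p - (x \<bullet> b) * \<beta> p) * cut (h b) p)"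
      by (simp add: scaleR_fun_def sum_fun_apply)
    show "((\<beta> * \<beta>) * (f - (\<lambda>_. f ?q))) p = (\<Sum>b\<in>Basis. ?c b * cut (h b)) p"
    proof (cases "p \<in> U \<and> \<phi> p \<in> ball x0 R")
      case True
      define y where "y = \<phi> p"
      have y: "y \<in> ball x0 R" "p = pt y" "y \<in> ball x0 R1"
        using True R(5) by (simp_all add: y_def subset_iff)
      let ?m = "plateau x0 R y"
      have "(\<Sum>b\<in>Basis. (hc b p - (x \<bullet> b) * \<beta> p) * cut (h b) p) = (\<Sum>b\<in>Basis. (?m * ?m) * (((y - x) \<bullet> b) *\<^sub>R h b y))"
        by (rule sum.cong) (auto simp: y(2) cut_pt[OF y(1)] hc_def \<beta>_def inner_diff_left algebra_simps)
      also have "\<dots> = (?m * ?m) * (?F y - ?F x)"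
        using h(3)[OF y(3)] by (simp add: sum_distrib_left)
      finally show ?thesis
        unfolding s by (simp add: y(2) cut_pt[OF y(1)] \<beta>_def)
    next
      case False
      then have "\<beta> p = 0" "cut (h b) p = 0" for b
        unfolding \<beta>_def cut_def by (auto simp del: mem_ball)
      then show ?thesis
        unfolding s by simp
    qed
  qed
  have fcC: "f - (\<lambda>_. f ?q) \<in> C"
    by (intro C_diff f C_const)
  have bb: "\<beta> * \<beta> \<in> C"
    by (intro C_mult \<beta>_C)
  have "X ((\<beta> * \<beta>) * (f - (\<lambda>_. f ?q))) ?q = \<beta> ?q * \<beta> ?q * X f ?q"
    by (simp add: VF_mult[OF X bb fcC] VF_diff_function[OF X f] VF_const[OF X])
  moreover have "X (\<Sum>b\<in>Basis. ?c b * cut (h b)) ?q = (\<Sum>b\<in>Basis. X (?c b * cut (h b)) ?q)"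
    by (subst VF_sum_function[OF X]) (auto intro!: C_mult cC gC simp: sum_fun_apply)
  moreover have "X (?c b * cut (h b)) ?q = (X (hc b) ?q - (x \<bullet> b) * X \<beta> ?q) * fd ?F x b * \<beta> ?q" for b
  proof -
    have "X (?c b * cut (h b)) ?q = X (?c b) ?q * cut (h b) ?q + ?c b ?q * X (cut (h b)) ?q"
      unfolding VF_mult[OF X cC gC] by simp
    moreover have "X (?c b) ?q = X (hc b) ?q - (x \<bullet> b) * X \<beta> ?q"
      unfolding VF_diff_function[OF X hc_C C_scaleR[OF \<beta>_C]] VF_scaleR[OF X \<beta>_C] by (simp add: scaleR_fun_def)
    moreover have "?c b ?q = 0" "cut (h b) ?q = fd ?F x b * \<beta> ?q"
      by (simp_all add: scaleR_fun_def hc_def \<beta>_def cut_pt[OF x] h(2))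
    ultimately show ?thesis by simp
  qed
  ultimately have "\<beta> ?q * \<beta> ?q * X f ?q = \<beta> ?q * (\<Sum>b\<in>Basis. (X (hc b) ?q - (x \<bullet> b) * X \<beta> ?q) * fd ?F x b)"
    unfolding eq by (simp add: sum_distrib_left mult_ac)
  moreover have "\<beta> ?q \<noteq> 0"
    using plateau_nonzero_iff[OF R(1), THEN iffD2, OF x] by (simp add: \<beta>_def cut_pt[OF x])
  ultimately show ?thesis by simp
qed

text \<open>The coordinate expressions of left translation of tangent vectors from the unit to the
  point \<open>pt x\<close>, and back.\<close>

definition "M x v = fd (\<lambda>y. \<phi> (pt x + pt y)) x0 v"
definition "N x v = fd (\<lambda>z. \<phi> (- pt x + pt z)) x v"

definition "muD = {z \<in> W \<times> W. pt (fst z) + pt (snd z) \<in> U}"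
definition "nuD = {z \<in> W \<times> W. - pt (fst z) + pt (snd z) \<in> U}"

lemma plot_fst: "plot (W \<times> W) (\<lambda>z. pt (fst z))" and plot_snd: "plot (W \<times> W) (\<lambda>z. pt (snd z))"
  by (rule plot_compose[OF plot_pt]; auto intro!: open_Times W_open smooth_on_bounded_linear bounded_linear_fst bounded_linear_snd)+

lemma mu_smooth: "open muD" "smooth_on muD (\<lambda>z. \<phi> (pt (fst z) + pt (snd z)))"
  and nu_smooth: "open nuD" "smooth_on nuD (\<lambda>z. \<phi> (- pt (fst z) + pt (snd z)))"
proof -
  have a: "plot (W \<times> W) (\<lambda>z. pt (fst z) + pt (snd z))" "plot (W \<times> W) (\<lambda>z. - pt (fst z) + pt (snd z))"
    by (intro plot_add plot_uminus plot_fst plot_snd)+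
  have m: "muD = (W \<times> W) \<inter> (\<lambda>z. pt (fst z) + pt (snd z)) -` U"
    and n: "nuD = (W \<times> W) \<inter> (\<lambda>z. - pt (fst z) + pt (snd z)) -` U"
    by (auto simp: muD_def nuD_def)
  show "open muD" "smooth_on muD (\<lambda>z. \<phi> (pt (fst z) + pt (snd z)))"
    unfolding m by (rule plotD(4)[OF a(1) chart(1)[OF UA]], rule plotD(3)[OF a(1) UA])
  show "open nuD" "smooth_on nuD (\<lambda>z. \<phi> (- pt (fst z) + pt (snd z)))"
    unfolding n by (rule plotD(4)[OF a(2) chart(1)[OF UA]], rule plotD(3)[OF a(2) UA])
qed

lemma partial_snd:
  fixes G :: "'a::euclidean_space \<times> 'b::euclidean_space \<Rightarrow> 'c::euclidean_space"
  assumes D: "open D" "smooth_on D G" "(x, y) \<in> D"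
  shows "((\<lambda>y. G (x, y)) has_derivative (\<lambda>v. fd G (x, y) (0, v))) (at y)"
    and "fd (\<lambda>y. G (x, y)) y v = fd G (x, y) (0, v)"
proof -
  show *: "((\<lambda>y. G (x, y)) has_derivative (\<lambda>v. fd G (x, y) (0, v))) (at y)"
    by (rule has_derivative_compose[of "\<lambda>y. (x, y)" _ _ _ G, OF _ smooth_on_has_derivative[OF D(2,3)]])
      (auto intro!: derivative_eq_intros)
  show "fd (\<lambda>y. G (x, y)) y v = fd G (x, y) (0, v)"
    using fd_eq[OF *] by simp
qed

text \<open>The base point \<open>k x\<close> may move with the parameter: it is constant for
  \<open>M\<close> and \<open>lf\<close>, and the identity for \<open>N\<close>.\<close>

lemma smooth_on_partial_snd:
  fixes G :: "'a::euclidean_space \<times> 'b::euclidean_space \<Rightarrow> 'c::euclidean_space"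
  assumes D: "open D" "smooth_on D G" and S: "open S" "smooth_on S k" "\<And>x. x \<in> S \<Longrightarrow> (x, k x) \<in> D"
  shows "smooth_on S (\<lambda>x. fd (\<lambda>y. G (x, y)) (k x) v)"
proof -
  have "smooth_on S (\<lambda>x. fd G (x, k x) (0, v))"
    by (rule smooth_on_compose[OF S(1) D(1) _ smooth_on_Pair[OF S(1) smooth_on_id[OF S(1)] S(2)] smooth_on_fd[OF D(2)]])
      (use S(3) in auto)
  then show ?thesis
    using smooth_on_cong[OF S(1), of "\<lambda>x. fd G (x, k x) (0, v)" "\<lambda>x. fd (\<lambda>y. G (x, y)) (k x) v"]
      partial_snd(2)[OF D S(3)] by simp
qed

lemma M_smooth: "smooth_on W (\<lambda>x. M x v)"
  unfolding M_def
  using smooth_on_partial_snd[OF mu_smooth W_open smooth_on_const[OF W_open], of x0 v] x0_W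
  by (auto simp: muD_def)

lemma N_smooth: "smooth_on W (\<lambda>x. N x v)"
  unfolding N_def
  using smooth_on_partial_snd[OF nu_smooth W_open smooth_on_id[OF W_open], of v] U0
  by (auto simp: nuD_def)

lemma M_has_derivative: "x \<in> W \<Longrightarrow> ((\<lambda>y. \<phi> (pt x + pt y)) has_derivative M x) (at x0)"
  and N_has_derivative: "x \<in> W \<Longrightarrow> ((\<lambda>z. \<phi> (- pt x + pt z)) has_derivative N x) (at x)"
proof -
  assume x: "x \<in> W"
  have "(x, x0) \<in> muD" "(x, x) \<in> nuD"
    using x x0_W U0 by (auto simp: muD_def nuD_def)
  from partial_snd(1)[OF mu_smooth this(1)] partial_snd(1)[OF nu_smooth this(2)]
  have d: "(\<lambda>y. \<phi> (pt x + pt y)) differentiable (at x0)" "(\<lambda>z. \<phi> (- pt x + pt z)) differentiable (at x)"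
    by (auto simp: differentiable_def)
  have "M x = fd (\<lambda>y. \<phi> (pt x + pt y)) x0" "N x = fd (\<lambda>z. \<phi> (- pt x + pt z)) x"
    by (simp_all add: fun_eq_iff M_def N_def)
  with fd_works[OF d(1)] fd_works[OF d(2)]
  show "((\<lambda>y. \<phi> (pt x + pt y)) has_derivative M x) (at x0)"
    "((\<lambda>z. \<phi> (- pt x + pt z)) has_derivative N x) (at x)"
    by simp_all
qed

lemma N_linear: "x \<in> W \<Longrightarrow> linear (N x)"
  using N_has_derivative has_derivative_linear by blast

lemma open_translate_W: "open {y \<in> W. a + pt y \<in> U}"
proof -
  have "plot W (\<lambda>y. a + pt y)"
    by (intro plot_add plot_const plot_pt W_open)
  from plotD(4)[OF this chart(1)[OF UA]] show ?thesis
    by (simp add: Int_def vimage_def)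
qed

text \<open>The translations by \<open>pt x\<close> and \<open>- pt x\<close> are mutually inverse;
  the chain rule at \<open>x0\<close> and at \<open>x\<close> gives the two identities.\<close>

lemma N_M [simp]: "x \<in> W \<Longrightarrow> N x (M x v) = v" and M_N [simp]: "x \<in> W \<Longrightarrow> M x (N x v) = v"
proof -
  assume x: "x \<in> W"
  have m0: "\<phi> (pt x + pt x0) = x" and n0: "\<phi> (- pt x + pt x) = x0"
    using x by (simp, simp add: x0_def)
  have c1: "((\<lambda>y. \<phi> (- pt x + pt (\<phi> (pt x + pt y)))) has_derivative (\<lambda>v. N x (M x v))) (at x0)"
    by (rule has_derivative_compose[OF M_has_derivative[OF x], of "\<lambda>z. \<phi> (- pt x + pt z)"])
      (simp only: m0 N_has_derivative[OF x])
  have c2: "((\<lambda>z. \<phi> (pt x + pt (\<phi> (- pt x + pt z)))) has_derivative (\<lambda>v. M x (N x v))) (at x)"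
    by (rule has_derivative_compose[OF N_has_derivative[OF x], of "\<lambda>y. \<phi> (pt x + pt y)"])
      (simp only: n0 M_has_derivative[OF x])
  have "((\<lambda>y. y) has_derivative (\<lambda>v. N x (M x v))) (at x0)"
    by (rule has_derivative_transform_within_open[OF c1 open_translate_W[of "pt x"]])
      (use x x0_W in \<open>auto simp: add.assoc[symmetric]\<close>)
  then show "N x (M x v) = v"
    by (metis has_derivative_unique[OF _ has_derivative_ident])
  have "((\<lambda>y. y) has_derivative (\<lambda>v. M x (N x v))) (at x)"
    by (rule has_derivative_transform_within_open[OF c2 open_translate_W[of "- pt x"]])
      (use x U0 in \<open>auto simp: add.assoc[symmetric]\<close>)
  then show "M x (N x v) = v"
    by (metis has_derivative_unique[OF _ has_derivative_ident])
qed

text \<open>The left invariant field with value \<open>v\<close> at the unit.\<close>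

definition lf :: "'e \<Rightarrow> 'g vfield"
  where "lf v f = (if f \<in> C then (\<lambda>a. fd (\<lambda>y. f (a + pt y)) x0 v) else 0)"

lemma translate_differentiable: "f \<in> C \<Longrightarrow> (\<lambda>y. f (a + pt y)) differentiable (at x0)"
  by (rule smooth_on_differentiable[OF smooth_on_plot[OF _ plot_add[OF plot_const[OF W_open] plot_pt]] x0_W])

lemma translate_has_derivative: "f \<in> C \<Longrightarrow> ((\<lambda>y. f (a + pt y)) has_derivative (\<lambda>v. lf v f a)) (at x0)"
  using fd_works[OF translate_differentiable] by (simp add: lf_def)

lemma lf_smooth: assumes f: "f \<in> C" shows "lf v f \<in> C"
  unfolding smooth_function_iff
proof safe
  fix V \<psi> assume V: "(V, \<psi>) \<in> A"
  let ?q = "inv_into V \<psi>"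
  have o: "open (\<psi> ` V \<times> W)"
    by (intro open_Times chart(2)[OF V] W_open)
  have "plot (\<psi> ` V \<times> W) (\<lambda>z. ?q (fst z) + pt (snd z))"
    by (rule plot_add; rule plot_compose[OF plot_chart[OF V]] plot_compose[OF plot_pt])
      (auto intro!: o smooth_on_bounded_linear bounded_linear_fst bounded_linear_snd)
  then have "smooth_on (\<psi> ` V \<times> W) (\<lambda>z. f (?q (fst z) + pt (snd z)))"
    by (rule smooth_on_plot[OF f])
  from smooth_on_partial_snd[OF o this chart(2)[OF V] smooth_on_const[OF chart(2)[OF V]], of x0 v]
  show "smooth_on (\<psi> ` V) (\<lambda>x. lf v f (?q x))"
    using f x0_W by (simp add: lf_def)
qed

lemma lf_VF: "lf v \<in> VF"
proof (rule VFI)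
  note d = translate_has_derivative
  show "lf v f \<in> C" if "f \<in> C" for f
    using that by (rule lf_smooth)
  show "lf v (f + h) = lf v f + lf v h" if f: "f \<in> C" and h: "h \<in> C" for f h
  proof
    fix a
    have "((\<lambda>y. (f + h) (a + pt y)) has_derivative (\<lambda>v. lf v f a + lf v h a)) (at x0)"
      using has_derivative_add[OF d[OF f] d[OF h]] by simp
    from fd_eq[OF this] show "lf v (f + h) a = (lf v f + lf v h) a"
      using C_add[OF f h] by (simp add: lf_def[of _ "f + h"])
  qed
  show "lf v (c *\<^sub>R f) = c *\<^sub>R lf v f" if f: "f \<in> C" for f c
  proof
    fix a
    have "((\<lambda>y. (c *\<^sub>R f) (a + pt y)) has_derivative (\<lambda>v. c *\<^sub>R lf v f a)) (at x0)"
      using has_derivative_scaleR_right[OF d[OF f]] by (simp add: scaleR_fun_def)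
    from fd_eq[OF this] have "fd (\<lambda>y. (c *\<^sub>R f) (a + pt y)) x0 v = c *\<^sub>R lf v f a"
      by simp
    then show "lf v (c *\<^sub>R f) a = (c *\<^sub>R lf v f) a"
      using C_scaleR[OF f] by (simp only: lf_def[of _ "c *\<^sub>R f"] if_True scaleR_fun_def[of c "lf v f"])
  qed
  show "lf v (f * h) = lf v f * h + f * lf v h" if f: "f \<in> C" and h: "h \<in> C" for f h
  proof
    fix a
    have "((\<lambda>y. (f * h) (a + pt y)) has_derivative (\<lambda>v. f (a + pt x0) * lf v h a + lf v f a * h (a + pt x0))) (at x0)"
      using has_derivative_mult[OF d[OF f] d[OF h]] by simp
    from fd_eq[OF this] show "lf v (f * h) a = (lf v f * h + f * lf v h) a"
      using C_mult[OF f h] by (simp add: lf_def[of _ "f * h"])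
  qed
qed (simp add: lf_def)

lemma lf_L: "lf v \<in> L"
proof -
  have "push_left a (lf v) = lf v" for a
    using C_translate_iff by (auto simp: push_left_def lf_def fun_eq_iff add.assoc[symmetric])
  then show ?thesis
    using lf_VF by (simp add: lie_algebra_def)
qed

lemma lf_linear: "linear lf"
proof (rule linearI)
  show "lf (v + w) = lf v + lf w" for v w
    using linear_add[OF has_derivative_linear[OF translate_has_derivative]]
    by (auto simp: fun_eq_iff) (auto simp: lf_def)
  show "lf (c *\<^sub>R v) = c *\<^sub>R lf v" for c v
    using linear_scale[OF has_derivative_linear[OF translate_has_derivative]]
    by (auto simp: fun_eq_iff scaleR_fun_def) (auto simp: lf_def)
qed

text \<open>For \<open>y\<close> near \<open>x0\<close>, \<open>f (pt x + pt y)\<close> is the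
  coordinate expression of \<open>f\<close> composed with a left translation whose differential is
  \<open>M x\<close>.\<close>

lemma lf_pt: "f \<in> C \<Longrightarrow> x \<in> W \<Longrightarrow> lf v f (pt x) = fd (\<lambda>x. f (pt x)) x (M x v)"
proof -
  assume f: "f \<in> C" and x: "x \<in> W"
  have "\<phi> (pt x + pt x0) = x" using x by simp
  then have "((\<lambda>z. f (pt z)) has_derivative fd (\<lambda>x. f (pt x)) x) (at (\<phi> (pt x + pt x0)))"
    using smooth_on_has_derivative[OF smooth_on_pt[OF f] x] by simp
  from has_derivative_compose[OF M_has_derivative[OF x] this]
  have "((\<lambda>y. f (pt (\<phi> (pt x + pt y)))) has_derivative (\<lambda>v. fd (\<lambda>x. f (pt x)) x (M x v))) (at x0)" .
  then have "((\<lambda>y. f (pt x + pt y)) has_derivative (\<lambda>v. fd (\<lambda>x. f (pt x)) x (M x v))) (at x0)"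
    by (rule has_derivative_transform_within_open[OF _ open_translate_W[of "pt x"]]) (use x x0_W in auto)
  from fd_eq[OF this] show ?thesis
    using f by (simp add: lf_def)
qed

lemma fd_pt: "f \<in> C \<Longrightarrow> x \<in> W \<Longrightarrow> fd (\<lambda>x. f (pt x)) x v = lf (N x v) f (pt x)"
  by (simp add: lf_pt)

lemma M_x0 [simp]: "M x0 v = v"
proof -
  have "((\<lambda>y. y) has_derivative M x0) (at x0)"
    by (rule has_derivative_transform_within_open[OF M_has_derivative[OF x0_W] W_open x0_W]) simp
  then show ?thesis
    using has_derivative_unique has_derivative_ident by metis
qed

lemma N_x0 [simp]: "N x0 v = v"
  using M_N[OF x0_W, of v] by simp

lemma x0_R: "x0 \<in> ball x0 R"
  using R by simp

lemma \<beta>_0: "\<beta> 0 = 1"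
  using cut_pt_plateau[of x0 "\<lambda>_. 1"] R by (simp add: \<beta>_def)

text \<open>At the unit \<beta> is 1 and \<open>N\<close> is the identity, so
  \<open>derivation_expand\<close> exhibits the derivation as a directional derivative. The witness
  is the coefficient vector of that expansion.\<close>

lemma VF_at_0:
  assumes X: "X \<in> VF"
  obtains v where "\<And>f. f \<in> C \<Longrightarrow> X f 0 = lf v f 0"
proof
  fix f assume f: "f \<in> C"
  let ?v = "\<Sum>b\<in>Basis. (X (hc b) 0 - (x0 \<bullet> b) * X \<beta> 0) *\<^sub>R b"
  have "X f 0 = (\<Sum>b\<in>Basis. (X (hc b) 0 - (x0 \<bullet> b) * X \<beta> 0) * lf b f 0)"
    using derivation_expand[OF X f x0_R] fd_pt[OF f x0_W] by (simp add: \<beta>_0)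
  also have "\<dots> = lf ?v f 0"
    by (simp add: linear_sum[OF lf_linear] linear_scale[OF lf_linear] sum_fun_apply scaleR_fun_def)
  finally show "X f 0 = lf ?v f 0" .
qed

lemma L_eq_lf:
  assumes "X \<in> L"
  obtains v where "X = lf v"
proof -
  obtain v where v: "\<And>f. f \<in> C \<Longrightarrow> X f 0 = lf v f 0"
    using VF_at_0[OF L_VF[OF assms]] by blast
  have "X f a = lf v f a" for f a
  proof (cases "f \<in> C")
    case True
    then show ?thesis
      using L_translate[OF assms, of f a 0] L_translate[OF lf_L, of v f a 0] v[OF C_translate[OF True]] by simp
  next
    case False
    then show ?thesis
      using VF_outside[OF L_VF[OF assms]] VF_outside[OF lf_VF] by simp
  qed
  then show ?thesis
    using that by blast
qed

lemma range_lf: "range lf = L"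
  using L_eq_lf lf_L by blast

text \<open>On the half ball the plateau is 1 and \<open>hc b\<close> is the b-th coordinate. This
  recovers \<open>M\<close> from the action of the fields on global functions.\<close>

lemma lf_hc: "x \<in> ball x0 (R / 2) \<Longrightarrow> lf v (hc b) (pt x) = M x v \<bullet> b"
proof -
  assume x: "x \<in> ball x0 (R / 2)"
  then have xW: "x \<in> W" using R by blast
  have "((\<lambda>x. hc b (pt x)) has_derivative (\<lambda>v. v \<bullet> b)) (at x)"
    by (rule has_derivative_transform_within_open[OF _ open_ball x, of "\<lambda>x. x \<bullet> b"])
      (auto intro!: derivative_eq_intros simp: hc_def cut_pt_plateau)
  from fd_eq[OF this] show ?thesis
    using lf_pt[OF hc_C xW] by simp
qed

lemma inj_lf: "inj lf"
proof (rule linear_injective_0[THEN iffD2, OF lf_linear], intro allI impI)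
  fix v assume v: "lf v = 0"
  have "v \<bullet> b = 0" for b
    using lf_hc[of x0 v b] R v by simp
  then show "v = 0"
    using inner_eq_zero_iff by blast
qed

end

lemma scaleR_fun_apply: "(c *\<^sub>R f) x = c *\<^sub>R f x" for f :: "'m \<Rightarrow> 'b::real_vector"
  by (simp add: scaleR_fun_def)

context lie_group_chart
begin

text \<open>Metric and connections are only assumed to be linear over the smooth functions. This
  decomposition shows that the metric at a point depends only on the fields at that point.\<close>

lemma VF_vanish_decomp:
  assumes Y: "Y \<in> VF" and Y0: "\<And>f. f \<in> C \<Longrightarrow> Y f 0 = 0"
  obtains a where "\<And>b. a b \<in> C" "\<And>b. a b 0 = 0" "fmult (\<beta> * \<beta>) Y = (\<Sum>b\<in>Basis. fmult (a b) (lf b))"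
proof
  \<comment> \<open>In \<open>derivation_expand\<close> the derivative along \<open>b\<close> is
    \<open>lf (N x b)\<close>, which is then expanded in the fields \<open>lf c\<close>. The
    coordinate factor \<open>x \<bullet> b\<close> has to sit inside a cutoff, whence
    \<open>?m\<close>. One factor \<beta> comes from the cutoff and one from
    \<open>derivation_expand\<close>.\<close>
  let ?n = "\<lambda>b c. cut (\<lambda>x. N x b \<bullet> c)" and ?m = "\<lambda>b c. cut (\<lambda>x. (x \<bullet> b) * (N x b \<bullet> c))"
  let ?a = "\<lambda>c. \<Sum>b\<in>Basis. Y (hc b) * ?n b c - Y \<beta> * ?m b c"
  have N: "smooth_on (ball x0 R1) (\<lambda>x. N x b)" for b
    using smooth_on_subset[OF N_smooth R1(2)] .
  have n: "?n b c \<in> C" and m: "?m b c \<in> C" for b c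
    by (intro cut_smooth smooth_on_mult smooth_on_inner smooth_on_const smooth_on_id N open_ball)+
  show "?a c \<in> C" for c
    by (intro C_sum C_diff C_mult VF_smooth[OF Y] hc_C \<beta>_C n m)
  show "?a c 0 = 0" for c
    by (simp add: sum_fun_apply Y0 hc_C \<beta>_C)
  show "fmult (\<beta> * \<beta>) Y = (\<Sum>b\<in>Basis. fmult (?a b) (lf b))"
  proof (intro ext)
    fix f p
    have r: "(\<Sum>b\<in>Basis. fmult (?a b) (lf b)) f p = (\<Sum>c\<in>Basis. ?a c p * lf c f p)"
      by (simp add: sum_fun_apply fmult_def)
    have l: "fmult (\<beta> * \<beta>) Y f p = \<beta> p * \<beta> p * Y f p"
      by (simp add: fmult_def)
    show "fmult (\<beta> * \<beta>) Y f p = (\<Sum>b\<in>Basis. fmult (?a b) (lf b)) f p"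
    proof (cases "f \<in> C \<and> p \<in> U \<and> \<phi> p \<in> ball x0 R")
      case True
      define x where "x = \<phi> p"
      have x: "x \<in> ball x0 R" "p = pt x" "x \<in> W" and f: "f \<in> C"
        using True by (simp_all add: x_def)
      have lfN: "lf (N x b) f p = (\<Sum>c\<in>Basis. (N x b \<bullet> c) * lf c f p)" for b
        by (subst (1) euclidean_representation[symmetric, of "N x b"])
          (simp add: linear_sum[OF lf_linear] linear_scale[OF lf_linear] sum_fun_apply scaleR_fun_def)
      have "?a c p = (\<Sum>b\<in>Basis. \<beta> p * ((Y (hc b) p - (x \<bullet> b) * Y \<beta> p) * (N x b \<bullet> c)))" for c
        unfolding sum_fun_apply
        by (rule sum.cong) (simp_all add: x(2) cut_pt[OF x(1)] \<beta>_def algebra_simps)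
      then have "(\<Sum>c\<in>Basis. ?a c p * lf c f p)
          = (\<Sum>c\<in>Basis. \<Sum>b\<in>Basis. \<beta> p * ((Y (hc b) p - (x \<bullet> b) * Y \<beta> p) * (N x b \<bullet> c)) * lf c f p)"
        by (simp add: sum_distrib_right)
      also have "\<dots> = (\<Sum>b\<in>Basis. \<beta> p * ((Y (hc b) p - (x \<bullet> b) * Y \<beta> p) * lf (N x b) f p))"
        unfolding lfN by (subst sum.swap) (simp add: sum_distrib_left mult_ac)
      also have "\<dots> = \<beta> p * (\<beta> p * Y f p)"
        using derivation_expand[OF Y f x(1)] fd_pt[OF f x(3)] by (simp add: x(2) sum_distrib_left)
      finally show ?thesis
        unfolding l r by simp
    next
      case False
      show ?thesis
      proof (cases "f \<in> C")
        case True
        then have "cut k p = 0" for k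
          using False by (auto simp: cut_def simp del: mem_ball)
        then show ?thesis
          unfolding l r by (simp add: sum_fun_apply \<beta>_def)
      next
        case False
        then show ?thesis
          unfolding l r by (simp add: VF_outside[OF Y] lf_def)
      qed
    qed
  qed
qed

lemma VF_at_point:
  assumes X: "X \<in> VF"
  obtains v where "\<And>f. f \<in> C \<Longrightarrow> X f p = lf v f p"
proof -
  obtain v where v: "\<And>f. f \<in> C \<Longrightarrow> push_left (- p) X f 0 = lf v f 0"
    using VF_at_0[OF push_left_VF[OF X]] by blast
  have "X f p = lf v f p" if "f \<in> C" for f
    using v[OF C_translate[OF that, of p]] L_translate[OF lf_L, of v f p 0]
    by (simp add: push_left_def add.assoc[symmetric])
  then show ?thesis
    using that by blast
qed

end

section \<open>The Hermitian structure at the unit\<close>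

locale hermitian_group = lie_group_chart A U \<phi>
  for A :: "('g::{topological_group_add, t2_space}, 'e::euclidean_space) chart set" and U \<phi> +
  fixes g :: "'g vfield \<Rightarrow> 'g vfield \<Rightarrow> 'g \<Rightarrow> real" and J :: "'g vfield \<Rightarrow> 'g vfield"
  assumes dim_e: "DIM('e) = 4"
    and metric: "riemannian_metric A g" and metric_left: "left_invariant_metric A g"
    and complex: "complex_structure A J" and complex_left: "left_invariant_complex_structure A J"
    and compat: "compatible A J g"
begin

lemma g_sym: "\<lbrakk>X \<in> VF; Y \<in> VF\<rbrakk> \<Longrightarrow> g X Y = g Y X"
  and g_add: "\<lbrakk>X \<in> VF; Y \<in> VF; Z \<in> VF\<rbrakk> \<Longrightarrow> g (X + Z) Y = g X Y + g Z Y"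
  and g_fmult: "\<lbrakk>X \<in> VF; Y \<in> VF; f \<in> C\<rbrakk> \<Longrightarrow> g (fmult f X) Y = f * g X Y"
  and g_nonneg: "X \<in> VF \<Longrightarrow> g X X p \<ge> 0"
  and g_definite: "\<lbrakk>X \<in> VF; g X X p = 0; f \<in> C\<rbrakk> \<Longrightarrow> X f p = 0"
  using metric by (auto simp: riemannian_metric_def)

lemma g_scale: "\<lbrakk>X \<in> VF; Y \<in> VF\<rbrakk> \<Longrightarrow> g (c *\<^sub>R X) Y = c *\<^sub>R g X Y"
  using g_fmult[of X Y "\<lambda>_. c"] by (simp add: fmult_const) (simp add: fun_eq_iff scaleR_fun_def)

lemma g_neg: "\<lbrakk>X \<in> VF; Y \<in> VF\<rbrakk> \<Longrightarrow> g (- X) Y = - g X Y"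
  using g_scale[of X Y "-1"] by simp

lemma g_diff: "\<lbrakk>X \<in> VF; Y \<in> VF; Z \<in> VF\<rbrakk> \<Longrightarrow> g (X - Z) Y = g X Y - g Z Y"
  using g_add[of X Y "- Z"] VF_uminus[of Z] by (simp add: g_neg)

lemma g_add_right: "\<lbrakk>X \<in> VF; Y \<in> VF; Z \<in> VF\<rbrakk> \<Longrightarrow> g Y (X + Z) = g Y X + g Y Z"
  using g_add[of X Y Z] g_sym VF_plus by metis

lemma g_scale_right: "\<lbrakk>X \<in> VF; Y \<in> VF\<rbrakk> \<Longrightarrow> g Y (c *\<^sub>R X) = c *\<^sub>R g Y X"
  using g_scale[of X Y] g_sym VF_scale by metis

lemma g_neg_right: "\<lbrakk>X \<in> VF; Y \<in> VF\<rbrakk> \<Longrightarrow> g Y (- X) = - g Y X"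
  using g_neg[of X Y] g_sym VF_uminus by metis

lemma g_zero: "Y \<in> VF \<Longrightarrow> g 0 Y = 0"
  using g_scale[OF VF_0, of Y 0] by simp

lemma g_sum: "\<lbrakk>\<And>i. i \<in> I \<Longrightarrow> X i \<in> VF; Y \<in> VF\<rbrakk> \<Longrightarrow> g (\<Sum>i\<in>I. X i) Y = (\<Sum>i\<in>I. g (X i) Y)"
  by (induction I rule: infinite_finite_induct) (auto simp: g_zero g_add VF_sum)

lemma g_translate: "\<lbrakk>X \<in> VF; Y \<in> VF\<rbrakk> \<Longrightarrow> g (push_left a X) (push_left a Y) (a + p) = g X Y p"
  using metric_left by (simp add: left_invariant_metric_def)

text \<open>Multiplication by \<beta> squared does not change the value at the unit, and it turns
  \<open>Y\<close> into a combination of left invariant fields whose coefficients vanish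
  there.\<close>

lemma g_tensorial_0:
  assumes Y: "Y \<in> VF" and Z: "Z \<in> VF" and Y0: "\<And>f. f \<in> C \<Longrightarrow> Y f 0 = 0"
  shows "g Y Z 0 = 0"
proof -
  obtain a where a: "\<And>b. a b \<in> C" "\<And>b. a b 0 = 0" "fmult (\<beta> * \<beta>) Y = (\<Sum>b\<in>Basis. fmult (a b) (lf b))"
    using VF_vanish_decomp[OF Y Y0] by blast
  have "g Y Z 0 = g (fmult (\<beta> * \<beta>) Y) Z 0"
    by (simp add: g_fmult Y Z C_mult \<beta>_C \<beta>_0)
  also have "\<dots> = (\<Sum>b\<in>Basis. g (fmult (a b) (lf b)) Z) 0"
    unfolding a(3) by (subst g_sum) (auto intro: VF_fmult a lf_VF Z)
  also have "\<dots> = 0"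
    by (simp add: sum_fun_apply g_fmult lf_VF Z a)
  finally show ?thesis .
qed

lemma g_tensorial:
  assumes Y: "Y \<in> VF" and Z: "Z \<in> VF" and Y0: "\<And>f. f \<in> C \<Longrightarrow> Y f p = 0"
  shows "g Y Z p = 0"
proof -
  have "push_left (- p) Y f 0 = 0" if "f \<in> C" for f
    using Y0[OF C_translate[OF that]] by (simp add: push_left_def)
  then have "g (push_left (- p) Y) (push_left (- p) Z) 0 = 0"
    by (intro g_tensorial_0 push_left_VF Y Z)
  then show ?thesis
    using g_translate[OF Y Z, of "- p" p] by simp
qed

lemma g_L: "\<lbrakk>X \<in> L; Y \<in> L\<rbrakk> \<Longrightarrow> g X Y p = g X Y 0"
  using g_translate[of X Y p 0] by (simp add: lie_algebra_def)

lemma J_VF: "X \<in> VF \<Longrightarrow> J X \<in> VF"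
  and J_J: "X \<in> VF \<Longrightarrow> J (J X) = - X"
  and J_plus: "\<lbrakk>X \<in> VF; Y \<in> VF\<rbrakk> \<Longrightarrow> J (X + Y) = J X + J Y"
  and J_fmult: "\<lbrakk>X \<in> VF; f \<in> C\<rbrakk> \<Longrightarrow> J (fmult f X) = fmult f (J X)"
  and J_bracket: "\<lbrakk>X \<in> VF; Y \<in> VF\<rbrakk> \<Longrightarrow>
    bracket (J X) (J Y) = bracket X Y + J (bracket (J X) Y) + J (bracket X (J Y))"
  using complex by (auto simp: complex_structure_def)

lemma J_scale: "X \<in> VF \<Longrightarrow> J (c *\<^sub>R X) = c *\<^sub>R J X"
  using J_fmult[of X "\<lambda>_. c"] by (simp add: fmult_const)

lemma J_L: "X \<in> L \<Longrightarrow> J X \<in> L"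
  using complex_left by (auto simp: lie_algebra_def J_VF left_invariant_complex_structure_def)

lemma g_J: "\<lbrakk>X \<in> VF; Y \<in> VF\<rbrakk> \<Longrightarrow> g (J X) (J Y) = g X Y"
  using compat by (simp add: compatible_def)

lemma g_J_skew: "\<lbrakk>X \<in> VF; Y \<in> VF\<rbrakk> \<Longrightarrow> g (J X) Y = - g X (J Y)"
  using g_J[of X "J Y"] J_VF by (simp add: J_J g_neg_right minus_equation_iff)

definition ip where "ip v w = g (lf v) (lf w) 0"
definition j where "j v = inv lf (J (lf v))"

lemma lf_j: "lf (j v) = J (lf v)"
  unfolding j_def using J_L[OF lf_L] range_lf by (simp add: f_inv_into_f)

lemma g_lf: "g (lf v) (lf w) p = ip v w"
  unfolding ip_def by (rule g_L[OF lf_L lf_L])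

lemma linear_ip: "linear (ip v)"
  by (rule linearI) (simp_all add: ip_def linear_add[OF lf_linear] linear_scale[OF lf_linear]
      g_add_right g_scale_right lf_VF scaleR_fun_apply)

lemma ip_sym: "ip v w = ip w v"
  using g_sym[OF lf_VF lf_VF] by (simp add: ip_def)

lemma ip_add: "ip (u + v) w = ip u w + ip v w" "ip w (u + v) = ip w u + ip w v"
  and ip_scale: "ip (c *\<^sub>R u) w = c * ip u w" "ip w (c *\<^sub>R u) = c * ip w u"
  by (simp_all add: linear_add[OF linear_ip] linear_scale[OF linear_ip] ip_sym[of _ w])

lemma ip_pos: "v \<noteq> 0 \<Longrightarrow> ip v v > 0"
proof (rule ccontr)
  assume v: "v \<noteq> 0" "\<not> ip v v > 0"
  then have "g (lf v) (lf v) p = 0" for p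
    using g_nonneg[OF lf_VF, of v 0] by (simp add: g_lf)
  then have "lf v f p = 0" for f p
    using g_definite[OF lf_VF, of v p f] VF_outside[OF lf_VF, of f v] by (cases "f \<in> C") auto
  then have "lf v = 0"
    by (simp add: fun_eq_iff)
  then show False
    using v(1) linear_injective_0[OF lf_linear] inj_lf by blast
qed

lemma ip_j: "ip (j v) (j w) = ip v w"
  by (simp add: ip_def lf_j g_J lf_VF)

lemma jj: "j (j v) = - v"
proof -
  have "lf (j (j v)) = lf (- v)"
    by (simp add: lf_j J_J lf_VF linear_neg[OF lf_linear])
  then show ?thesis
    using inj_lf by (simp add: inj_eq)
qed

lemma linear_j: "linear j"
proof (rule linearI)
  show "j (v + w) = j v + j w" for v w
    by (rule injD[OF inj_lf]) (simp add: lf_j linear_add[OF lf_linear] J_plus lf_VF)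
  show "j (c *\<^sub>R v) = c *\<^sub>R j v" for c v
    by (rule injD[OF inj_lf]) (simp add: lf_j linear_scale[OF lf_linear] J_scale lf_VF)
qed

lemma ip_j_self: "ip v (j v) = 0"
  using ip_j[of v "j v"] ip_sym[of v "j v"] ip_scale(2)[of "j v" "-1" v] by (simp add: jj)

lemma ip_j_skew: "ip (j v) w = - ip v (j w)"
  using ip_j[of v "j w"] ip_scale(2)[of "j v" "-1" w] by (simp add: jj)

text \<open>This is Gram-Schmidt for \<open>ip\<close> instead of the inner product of the model
  space: the images of the complex unit vectors are \<open>v\<close> and \<open>w\<close>, completed
  by \<open>j v\<close> and \<open>j w\<close>.\<close>

lemma unitary_isomorphism_exists:
  obtains \<kappa> :: "complex ^ 2 \<Rightarrow> 'e" where "linear \<kappa>" "bij \<kappa>" "\<And>\<xi>. \<kappa> (\<i> *s \<xi>) = j (\<kappa> \<xi>)"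
    "\<And>\<xi> \<eta>. ip (\<kappa> \<xi>) (\<kappa> \<eta>) = \<xi> \<bullet> \<eta>"
proof -
  obtain b :: 'e where "b \<in> Basis" using nonempty_Basis by blast
  then have b: "b \<noteq> 0" using nonzero_Basis by blast
  have normalize: "ip (v /\<^sub>R sqrt (ip v v)) (v /\<^sub>R sqrt (ip v v)) = 1" if "v \<noteq> 0" for v
    using ip_pos[OF that] by (simp add: ip_scale field_simps)
  define v where "v = b /\<^sub>R sqrt (ip b b)"
  have v: "ip v v = 1"
    using normalize[OF b] by (simp add: v_def)
  \<comment> \<open>Two orthogonality conditions are wanted while the lemma takes three functionals,
    so \<open>v\<close> is given twice.\<close>
  obtain c where c: "c \<noteq> 0" "ip v c = 0" "ip (j v) c = 0" "ip v c = 0"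
    by (rule linear_functional_common_zero[OF _ linear_ip linear_ip linear_ip, of v "j v" v]) (use dim_e in auto)
  define w where "w = c /\<^sub>R sqrt (ip c c)"
  have w: "ip w w = 1" "ip v w = 0" "ip (j v) w = 0"
    using normalize[OF c(1)] c by (simp_all add: w_def ip_scale)
  define \<kappa> where "\<kappa> \<xi> = Re (\<xi> $ 1) *\<^sub>R v + Im (\<xi> $ 1) *\<^sub>R j v + Re (\<xi> $ 2) *\<^sub>R w + Im (\<xi> $ 2) *\<^sub>R j w"
    for \<xi> :: "complex ^ 2"
  note tab = v w ip_j ip_j_self ip_sym[of "j v" v] ip_sym[of w v] ip_sym[of "j w" w] ip_sym[of w "j v"]
  have vjw: "ip v (j w) = 0" "ip (j w) v = 0"
    using w(3) ip_j_skew[of v w] ip_sym[of "j w" v] by simp_all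
  have lin: "linear \<kappa>"
    by (rule linearI) (simp_all add: \<kappa>_def algebra_simps)
  have ip\<kappa>: "ip (\<kappa> \<xi>) (\<kappa> \<eta>) = \<xi> \<bullet> \<eta>" for \<xi> \<eta>
    by (simp add: \<kappa>_def ip_add ip_scale tab vjw inner_vec_def sum_2 inner_complex_def)
  have inj: "inj \<kappa>"
  proof (rule linear_injective_0[THEN iffD2, OF lin], intro allI impI)
    fix \<xi> assume "\<kappa> \<xi> = 0"
    then have "\<xi> \<bullet> \<xi> = ip 0 0"
      using ip\<kappa>[of \<xi> \<xi>] by simp
    also have "ip 0 0 = 0"
      using linear_0[OF linear_ip] .
    finally show "\<xi> = 0" by simp
  qed
  have "dim (range \<kappa>) = DIM(complex ^ 2)"
    using dim_image_eq[OF lin, of UNIV] inj by simp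
  then have "dim (range \<kappa>) = DIM('e)"
    by (simp add: dim_e)
  then have "span (range \<kappa>) = UNIV"
    by (simp add: dim_eq_full)
  then have "surj \<kappa>"
    using linear_subspace_image[OF lin subspace_UNIV] by (simp add: span_eq_iff[THEN iffD2])
  moreover have "\<kappa> (\<i> *s \<xi>) = j (\<kappa> \<xi>)" for \<xi>
    by (simp add: \<kappa>_def linear_add[OF linear_j] linear_scale[OF linear_j] jj)
  ultimately show ?thesis
    using that[OF lin] inj ip\<kappa> by (simp add: bij_def)
qed

text \<open>Subtracting the left invariant field with the same components leaves a field orthogonal
  to all left invariant ones. At each point it has the value of some left invariant field, so by
  tensoriality its norm there is zero.\<close>

lemma constant_components_L:
  assumes Xv: "X \<in> VF" and const: "\<And>v p. g X (lf v) p = g X (lf v) 0"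
  shows "X \<in> L"
proof -
  obtain \<kappa> :: "complex ^ 2 \<Rightarrow> 'e" where \<kappa>: "linear \<kappa>" "bij \<kappa>" "\<And>\<xi> \<eta>. ip (\<kappa> \<xi>) (\<kappa> \<eta>) = \<xi> \<bullet> \<eta>"
    using unitary_isomorphism_exists by metis
  let ?F = "\<lambda>\<xi>. lf (\<kappa> \<xi>)"
  have linF: "linear ?F"
    using linear_compose[OF \<kappa>(1) lf_linear] by (simp add: o_def)
  define \<zeta> where "\<zeta> = (\<Sum>b\<in>Basis. g X (?F b) 0 *\<^sub>R b)"
  have lin: "linear (\<lambda>\<xi>. g X (?F \<xi>) 0)"
    by (rule linearI) (simp_all add: linear_add[OF linF] linear_scale[OF linF] g_add_right g_scale_right lf_VF Xv scaleR_fun_apply)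
  have gX: "g X (?F \<xi>) p = \<zeta> \<bullet> \<xi>" for \<xi> p
  proof -
    have "g X (?F \<xi>) p = g X (?F \<xi>) 0"
      by (rule const)
    also have "\<dots> = g X (?F (\<Sum>b\<in>Basis. (\<xi> \<bullet> b) *\<^sub>R b)) 0"
      by (simp add: euclidean_representation)
    also have "\<dots> = (\<Sum>b\<in>Basis. (\<xi> \<bullet> b) * g X (?F b) 0)"
      using linear_sum[OF lin, of "\<lambda>b. (\<xi> \<bullet> b) *\<^sub>R b" Basis] linear_scale[OF lin] by simp
    also have "\<dots> = \<zeta> \<bullet> \<xi>"
      by (simp add: \<zeta>_def inner_sum_left inner_commute[of \<xi>] mult.commute)
    finally show ?thesis .
  qed
  let ?Y = "X - ?F \<zeta>"
  have Y: "?Y \<in> VF"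
    by (intro VF_minus Xv lf_VF)
  have gY: "g ?Y (?F \<xi>) p = 0" for \<xi> p
    by (simp add: g_diff Xv lf_VF gX g_lf \<kappa>(3))
  have "?Y f p = 0" if f: "f \<in> C" for f p
  proof (rule g_definite[OF Y _ f])
    obtain v where v: "\<And>f. f \<in> C \<Longrightarrow> ?Y f p = lf v f p"
      using VF_at_point[OF Y] by blast
    obtain \<xi> where \<xi>: "v = \<kappa> \<xi>"
      using \<kappa>(2) by (metis bij_pointE)
    have "g (?Y - lf v) ?Y p = 0"
      by (rule g_tensorial) (use v in \<open>auto intro!: VF_minus Y lf_VF Xv\<close>)
    then have "g ?Y ?Y p = g (lf v) ?Y p"
      using Y by (simp add: g_diff[OF Y Y lf_VF])
    also have "\<dots> = 0"
      using gY[of \<xi> p] g_sym[OF Y lf_VF, of v] by (simp add: \<xi>)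
    finally show "g ?Y ?Y p = 0" .
  qed
  then have "?Y = 0"
    using VF_outside[OF Y] by (metis (no_types, opaque_lifting) ext zero_fun_apply)
  then show ?thesis
    using lf_L by simp
qed

end

subsection \<open>Reduction to the Lie algebra\<close>

interpretation complex_plane: hermitian_space "\<lambda>\<xi> :: complex ^ 2. \<i> *s \<xi>"
proof
  show "DIM(complex ^ 2) = 4" by simp
  show "\<i> *s (\<xi> + \<eta>) = \<i> *s \<xi> + \<i> *s \<eta>" for \<xi> \<eta> :: "complex ^ 2"
    by (simp add: vec_eq_iff algebra_simps)
  show "\<i> *s (r *\<^sub>R \<xi>) = r *\<^sub>R (\<i> *s \<xi>)" for r and \<xi> :: "complex ^ 2"
    by (simp add: vec_eq_iff)
  show "\<i> *s (\<i> *s \<xi>) = - \<xi>" for \<xi> :: "complex ^ 2"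
    by (simp add: vec_eq_iff mult.assoc[symmetric])
  show "(\<i> *s \<xi>) \<bullet> (\<i> *s \<eta>) = \<xi> \<bullet> \<eta>" for \<xi> \<eta> :: "complex ^ 2"
    by (simp add: inner_vec_def inner_complex_def add.commute)
qed

locale hermitian_group_frame = hermitian_group A U \<phi> g J
  for A :: "('g::{topological_group_add, t2_space}, 'e::euclidean_space) chart set" and U \<phi> g J +
  fixes \<kappa> :: "complex ^ 2 \<Rightarrow> 'e"
  assumes linear_\<kappa>: "linear \<kappa>" and bij_\<kappa>: "bij \<kappa>" and \<kappa>_i: "\<kappa> (\<i> *s \<xi>) = j (\<kappa> \<xi>)"
    and ip_\<kappa>: "ip (\<kappa> \<xi>) (\<kappa> \<eta>) = \<xi> \<bullet> \<eta>"
begin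

definition "\<Phi> \<xi> = lf (\<kappa> \<xi>)"
definition "\<Psi> = inv \<Phi>"

lemma linear_\<Phi>: "linear \<Phi>"
  using linear_compose[OF linear_\<kappa> lf_linear] by (simp add: \<Phi>_def[abs_def] o_def)

lemmas \<Phi>_add = linear_add[OF linear_\<Phi>]
lemmas \<Phi>_scale = linear_scale[OF linear_\<Phi>]
lemmas \<Phi>_neg = linear_neg[OF linear_\<Phi>]
lemmas \<Phi>_0 = linear_0[OF linear_\<Phi>]

lemma inj_\<Phi>: "inj \<Phi>"
  using inj_compose[OF inj_lf bij_is_inj[OF bij_\<kappa>]] by (simp add: \<Phi>_def[abs_def] o_def)

lemma \<Phi>_eq_iff [simp]: "\<Phi> \<xi> = \<Phi> \<eta> \<longleftrightarrow> \<xi> = \<eta>"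
  using inj_\<Phi> by (simp add: inj_eq)

lemma range_\<Phi>: "range \<Phi> = L"
proof -
  have "range \<Phi> = lf ` range \<kappa>"
    by (auto simp: \<Phi>_def)
  then show ?thesis
    using bij_is_surj[OF bij_\<kappa>] range_lf by simp
qed

lemma \<Phi>_L [simp]: "\<Phi> \<xi> \<in> L" and \<Phi>_VF [simp]: "\<Phi> \<xi> \<in> VF"
  by (simp_all add: \<Phi>_def lf_L lf_VF)

lemma \<Phi>_\<Psi>: "X \<in> L \<Longrightarrow> \<Phi> (\<Psi> X) = X"
  using range_\<Phi> by (simp add: \<Psi>_def f_inv_into_f)

lemma \<Phi>_i: "\<Phi> (\<i> *s \<xi>) = J (\<Phi> \<xi>)"
  by (simp add: \<Phi>_def \<kappa>_i lf_j)

lemma g_\<Phi>: "g (\<Phi> \<xi>) (\<Phi> \<eta>) = (\<lambda>_. \<xi> \<bullet> \<eta>)"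
  by (rule ext) (simp add: \<Phi>_def g_lf ip_\<kappa>)

definition "br \<xi> \<eta> = \<Psi> (bracket (\<Phi> \<xi>) (\<Phi> \<eta>))"

lemma \<Phi>_br: "\<Phi> (br \<xi> \<eta>) = bracket (\<Phi> \<xi>) (\<Phi> \<eta>)"
  by (simp add: br_def \<Phi>_\<Psi> L_bracket)

lemma VF_eqI: "\<lbrakk>X \<in> VF; Y \<in> VF; \<And>f. f \<in> C \<Longrightarrow> X f = Y f\<rbrakk> \<Longrightarrow> X = Y"
  by (rule ext) (metis VF_outside)

lemma bracket_add:
  assumes X: "X \<in> VF" and Y: "Y \<in> VF" and Z: "Z \<in> VF"
  shows "bracket (X + Y) Z = bracket X Z + bracket Y Z"
proof (rule VF_eqI)
  show "bracket (X + Y) Z \<in> VF" "bracket X Z + bracket Y Z \<in> VF"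
    by (intro VF_bracket VF_plus X Y Z)+
  show "bracket (X + Y) Z f = (bracket X Z + bracket Y Z) f" if "f \<in> C" for f
    using that by (simp add: bracket_def VF_props[OF X] VF_props[OF Y] VF_props[OF Z])
qed

lemma bracket_scale:
  assumes X: "X \<in> VF" and Y: "Y \<in> VF"
  shows "bracket (c *\<^sub>R X) Y = c *\<^sub>R bracket X Y"
proof (rule VF_eqI)
  show "bracket (c *\<^sub>R X) Y \<in> VF" "c *\<^sub>R bracket X Y \<in> VF"
    by (intro VF_bracket VF_scale X Y)+
  show "bracket (c *\<^sub>R X) Y f = (c *\<^sub>R bracket X Y) f" if "f \<in> C" for f
    using that by (simp add: bracket_def VF_props[OF X] VF_props[OF Y] scaleR_fun_apply scaleR_diff_right)
qed

lemma br_skew: "br \<xi> \<eta> = - br \<eta> \<xi>"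
proof -
  have "\<Phi> (br \<xi> \<eta>) = \<Phi> (- br \<eta> \<xi>)"
    using bracket_skew[of "\<Phi> \<xi>" "\<Phi> \<eta>"] by (simp only: \<Phi>_br \<Phi>_neg)
  then show ?thesis
    by (simp only: \<Phi>_eq_iff)
qed

lemma bilinear_br: "bilinear br"
proof -
  have l: "linear (\<lambda>\<xi>. br \<xi> \<eta>)" for \<eta>
  proof (rule linearI)
    show "br (\<xi> + \<xi>') \<eta> = br \<xi> \<eta> + br \<xi>' \<eta>" for \<xi> \<xi>'
      by (rule injD[OF inj_\<Phi>]) (simp add: \<Phi>_br \<Phi>_add bracket_add)
    show "br (c *\<^sub>R \<xi>) \<eta> = c *\<^sub>R br \<xi> \<eta>" for c \<xi>
      by (rule injD[OF inj_\<Phi>]) (simp add: \<Phi>_br \<Phi>_scale bracket_scale)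
  qed
  moreover have "linear (\<lambda>\<xi>. br \<eta> \<xi>)" for \<eta>
    using linear_compose_neg[OF l[of \<eta>]] br_skew[of \<eta>] by simp
  ultimately show ?thesis
    by (simp add: bilinear_def)
qed

sublocale hla: hermitian_lie_algebra "\<lambda>\<xi> :: complex ^ 2. \<i> *s \<xi>" br
proof
  show "bilinear br" by (rule bilinear_br)
  show "br \<xi> \<eta> = - br \<eta> \<xi>" for \<xi> \<eta> by (rule br_skew)
  show "br x (br y z) + br y (br z x) + br z (br x y) = 0" for x y z
    by (rule injD[OF inj_\<Phi>]) (simp add: \<Phi>_add \<Phi>_br \<Phi>_0 bracket_jacobi)
qed

lemma integrable: "br (\<i> *s x) (\<i> *s y) = br x y + \<i> *s br (\<i> *s x) y + \<i> *s br x (\<i> *s y)"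
  by (rule injD[OF inj_\<Phi>]) (simp add: \<Phi>_add \<Phi>_br \<Phi>_i J_bracket)

lemma connection_facts:
  assumes D: "hermitian_connection A J g D"
  shows D_VF: "\<lbrakk>X \<in> VF; Y \<in> VF\<rbrakk> \<Longrightarrow> D X Y \<in> VF"
    and D_add: "\<lbrakk>X \<in> VF; Y \<in> VF; Z \<in> VF\<rbrakk> \<Longrightarrow> D (X + Z) Y = D X Y + D Z Y"
    and D_add_right: "\<lbrakk>X \<in> VF; Y \<in> VF; Z \<in> VF\<rbrakk> \<Longrightarrow> D X (Y + Z) = D X Y + D X Z"
    and D_scale: "\<lbrakk>X \<in> VF; Y \<in> VF\<rbrakk> \<Longrightarrow> D (c *\<^sub>R X) Y = c *\<^sub>R D X Y"
    and D_scale_right: "\<lbrakk>X \<in> VF; Y \<in> VF\<rbrakk> \<Longrightarrow> D X (c *\<^sub>R Y) = c *\<^sub>R D X Y"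
    and D_J: "\<lbrakk>X \<in> VF; Y \<in> VF\<rbrakk> \<Longrightarrow> D X (J Y) = J (D X Y)"
    and D_metric: "\<lbrakk>X \<in> VF; Y \<in> VF; Z \<in> VF\<rbrakk> \<Longrightarrow> X (g Y Z) = g (D X Y) Z + g Y (D X Z)"
proof -
  have aff: "affine_connection A D"
    using D by (simp add: hermitian_connection_def)
  then show "\<lbrakk>X \<in> VF; Y \<in> VF\<rbrakk> \<Longrightarrow> D X Y \<in> VF"
    "\<lbrakk>X \<in> VF; Y \<in> VF; Z \<in> VF\<rbrakk> \<Longrightarrow> D (X + Z) Y = D X Y + D Z Y"
    "\<lbrakk>X \<in> VF; Y \<in> VF; Z \<in> VF\<rbrakk> \<Longrightarrow> D X (Y + Z) = D X Y + D X Z"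
    by (auto simp: affine_connection_def)
  have f: "D (fmult f X) Y = fmult f (D X Y)" "D X (fmult f Y) = fmult (X f) Y + fmult f (D X Y)"
    if "X \<in> VF" "Y \<in> VF" "f \<in> C" for X Y f
    using aff that by (auto simp: affine_connection_def)
  show "\<lbrakk>X \<in> VF; Y \<in> VF\<rbrakk> \<Longrightarrow> D (c *\<^sub>R X) Y = c *\<^sub>R D X Y"
    using f(1)[of X Y "\<lambda>_. c"] by (simp add: fmult_const)
  have z: "fmult 0 Y = 0" for Y :: "'g vfield"
    by (simp add: fmult_def fun_eq_iff)
  show "\<lbrakk>X \<in> VF; Y \<in> VF\<rbrakk> \<Longrightarrow> D X (c *\<^sub>R Y) = c *\<^sub>R D X Y"
    using f(2)[of X Y "\<lambda>_. c"] by (simp add: fmult_const VF_const z)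
  show "\<lbrakk>X \<in> VF; Y \<in> VF\<rbrakk> \<Longrightarrow> D X (J Y) = J (D X Y)"
    "\<lbrakk>X \<in> VF; Y \<in> VF; Z \<in> VF\<rbrakk> \<Longrightarrow> X (g Y Z) = g (D X Y) Z + g Y (D X Z)"
    using D by (auto simp: hermitian_connection_def)
qed

text \<open>These are the Christoffel symbols at \<open>p\<close> in the left invariant frame, with
  the last index lowered by the metric.\<close>

definition "low D p x y z = g (D (\<Phi> x) (\<Phi> y)) (\<Phi> z) p"

lemma low_facts:
  assumes D: "hermitian_connection A J g D"
  shows "low D p (- x) y z = - low D p x y z" "low D p x (- y) z = - low D p x y z"
    "low D p x y (- z) = - low D p x y z"
    "low D p x y z = - low D p x z y" "low D p x (\<i> *s y) z = - low D p x y (\<i> *s z)"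
proof -
  note c = connection_facts[OF D]
  have DV: "D (\<Phi> x) (\<Phi> y) \<in> VF" for x y by (simp add: c)
  show "low D p (- x) y z = - low D p x y z"
    using c(4)[of "\<Phi> x" "\<Phi> y" "-1"] by (simp add: low_def \<Phi>_neg g_neg DV)
  show "low D p x (- y) z = - low D p x y z"
    using c(5)[of "\<Phi> x" "\<Phi> y" "-1"] by (simp add: low_def \<Phi>_neg g_neg DV)
  show "low D p x y (- z) = - low D p x y z"
    by (simp add: low_def \<Phi>_neg g_neg_right DV)
  \<comment> \<open>The metric is constant on the frame, so metric compatibility reduces to skewness
    of the symbols.\<close>
  have "\<Phi> x (g (\<Phi> y) (\<Phi> z)) = 0"
    unfolding g_\<Phi> by (rule VF_const[OF \<Phi>_VF])
  then have "0 = g (D (\<Phi> x) (\<Phi> y)) (\<Phi> z) + g (\<Phi> y) (D (\<Phi> x) (\<Phi> z))"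
    using c(7)[of "\<Phi> x" "\<Phi> y" "\<Phi> z"] by (metis \<Phi>_VF)
  then have "g (D (\<Phi> x) (\<Phi> y)) (\<Phi> z) p + g (D (\<Phi> x) (\<Phi> z)) (\<Phi> y) p = 0"
    using g_sym[OF \<Phi>_VF DV] by (metis plus_fun_apply zero_fun_apply)
  then show "low D p x y z = - low D p x z y"
    by (simp add: low_def)
  show "low D p x (\<i> *s y) z = - low D p x y (\<i> *s z)"
    by (simp add: low_def \<Phi>_i c g_J_skew)
qed

lemma low_torsion:
  assumes D: "hermitian_connection A J g D"
  shows "g (torsion D (\<Phi> x) (\<Phi> y)) (\<Phi> z) p = low D p x y z - low D p y x z - br x y \<bullet> z"
proof -
  have DV: "D (\<Phi> x) (\<Phi> y) \<in> VF" for x y by (simp add: connection_facts[OF D])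
  have "torsion D (\<Phi> x) (\<Phi> y) = D (\<Phi> x) (\<Phi> y) - D (\<Phi> y) (\<Phi> x) - \<Phi> (br x y)"
    by (simp add: torsion_def \<Phi>_br)
  then show ?thesis
    by (simp add: g_diff VF_minus DV low_def g_\<Phi>)
qed

lemma connection_L:
  assumes D: "hermitian_connection A J g D" and const: "\<And>x y z p. low D p x y z = low D 0 x y z"
  shows "D (\<Phi> x) (\<Phi> y) \<in> L"
proof (rule constant_components_L)
  show "D (\<Phi> x) (\<Phi> y) \<in> VF"
    by (simp add: connection_facts[OF D])
  fix v p
  obtain \<xi> where "v = \<kappa> \<xi>"
    using bij_\<kappa> by (metis bij_pointE)
  then show "g (D (\<Phi> x) (\<Phi> y)) (lf v) p = g (D (\<Phi> x) (\<Phi> y)) (lf v) 0"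
    using const[of p x y \<xi>] by (simp add: low_def \<Phi>_def)
qed

text \<open>The symbols at \<open>p\<close> are compared with those at the unit. The bracket term of
  \<open>low_torsion\<close> is the same at both points and cancels, so the difference meets the
  hypotheses of the uniqueness lemma. The Bismut case is analogous.\<close>

lemma chern_L:
  assumes "chern_connection A J g D"
  shows "D (\<Phi> x) (\<Phi> y) \<in> L"
proof (rule connection_L)
  show D: "hermitian_connection A J g D"
    using assms by (simp add: chern_connection_def)
  note l = low_facts[OF D]
  have t: "g (torsion D (\<Phi> x) (\<Phi> y)) (\<Phi> z) p + g (torsion D (\<Phi> (\<i> *s x)) (\<Phi> (\<i> *s y))) (\<Phi> z) p = 0" for x y z p
  proof -
    have V: "torsion D (\<Phi> x) (\<Phi> y) \<in> VF" for x y
      unfolding torsion_def by (intro VF_minus VF_bracket connection_facts(1)[OF D] \<Phi>_VF)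
    have "torsion D (\<Phi> x) (\<Phi> y) + torsion D (\<Phi> (\<i> *s x)) (\<Phi> (\<i> *s y)) = 0"
      using assms by (simp add: chern_connection_def \<Phi>_i)
    then have "g (torsion D (\<Phi> x) (\<Phi> y) + torsion D (\<Phi> (\<i> *s x)) (\<Phi> (\<i> *s y))) (\<Phi> z) = 0"
      by (simp add: g_zero)
    then show ?thesis
      unfolding g_add[OF V \<Phi>_VF V] by (metis plus_fun_apply zero_fun_apply)
  qed
  have "low D p x y z - low D 0 x y z = 0" for x y z p
  proof (rule complex_plane.chern_difference_zero[of "\<lambda>x y z. low D p x y z - low D 0 x y z"])
    fix x y z
    show "low D p (- x) y z - low D 0 (- x) y z = - (low D p x y z - low D 0 x y z)"
      "low D p x (- y) z - low D 0 x (- y) z = - (low D p x y z - low D 0 x y z)"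
      "low D p x y (- z) - low D 0 x y (- z) = - (low D p x y z - low D 0 x y z)"
      by (simp_all add: l(1-3))
    show "low D p x y z - low D 0 x y z = - (low D p x z y - low D 0 x z y)"
      using l(4)[of p x y z] l(4)[of 0 x y z] by simp
    show "low D p x (\<i> *s y) z - low D 0 x (\<i> *s y) z = - (low D p x y (\<i> *s z) - low D 0 x y (\<i> *s z))"
      by (simp add: l(5))
    show "low D p x y z - low D 0 x y z - (low D p y x z - low D 0 y x z) +
       (low D p (\<i> *s x) (\<i> *s y) z - low D 0 (\<i> *s x) (\<i> *s y) z -
        (low D p (\<i> *s y) (\<i> *s x) z - low D 0 (\<i> *s y) (\<i> *s x) z)) = 0"
      using t[of x y z p] t[of x y z 0] unfolding low_torsion[OF D] by linarith
  qed
  then show "low D p x y z = low D 0 x y z" for x y z p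
    by simp
qed

lemma bismut_L:
  assumes "bismut_connection A J g D"
  shows "D (\<Phi> x) (\<Phi> y) \<in> L"
proof (rule connection_L)
  show D: "hermitian_connection A J g D"
    using assms by (simp add: bismut_connection_def)
  note l = low_facts[OF D]
  have t: "g (torsion D (\<Phi> x) (\<Phi> y)) (\<Phi> z) p = - g (torsion D (\<Phi> x) (\<Phi> z)) (\<Phi> y) p" for x y z p
  proof -
    have "g (torsion D (\<Phi> x) (\<Phi> y)) (\<Phi> z) = - g (torsion D (\<Phi> x) (\<Phi> z)) (\<Phi> y)"
      using assms \<Phi>_VF unfolding bismut_connection_def by blast
    then show ?thesis by simp
  qed
  have "low D p x y z - low D 0 x y z = 0" for x y z p
  proof (rule complex_plane.bismut_difference_zero[of "\<lambda>x y z. low D p x y z - low D 0 x y z"])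
    fix x y z
    show "low D p (- x) y z - low D 0 (- x) y z = - (low D p x y z - low D 0 x y z)"
      "low D p x (- y) z - low D 0 x (- y) z = - (low D p x y z - low D 0 x y z)"
      "low D p x y (- z) - low D 0 x y (- z) = - (low D p x y z - low D 0 x y z)"
      by (simp_all add: l(1-3))
    show "low D p x y z - low D 0 x y z = - (low D p x z y - low D 0 x z y)"
      using l(4)[of p x y z] l(4)[of 0 x y z] by simp
    show "low D p x (\<i> *s y) z - low D 0 x (\<i> *s y) z = - (low D p x y (\<i> *s z) - low D 0 x y (\<i> *s z))"
      by (simp add: l(5))
    show "low D p x y z - low D 0 x y z - (low D p y x z - low D 0 y x z) =
       - (low D p x z y - low D 0 x z y - (low D p z x y - low D 0 z x y))"
      using t[of x y z p] t[of x y z 0] unfolding low_torsion[OF D] by linarith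
  qed
  then show "low D p x y z = low D 0 x y z" for x y z p
    by simp
qed

lemma hermitian_form_pullback:
  assumes D: "hermitian_connection A J g D" and DL: "\<And>x y. D (\<Phi> x) (\<Phi> y) \<in> L"
  shows "hla.hermitian_form (\<lambda>x y. \<Psi> (D (\<Phi> x) (\<Phi> y)))" (is "hla.hermitian_form ?D")
    and "\<Phi> (hla.tor (\<lambda>x y. \<Psi> (D (\<Phi> x) (\<Phi> y))) x y) = torsion D (\<Phi> x) (\<Phi> y)"
proof -
  note c = connection_facts[OF D]
  define d where "d = ?D"
  have \<Phi>D: "\<Phi> (d x y) = D (\<Phi> x) (\<Phi> y)" for x y
    using \<Phi>_\<Psi>[OF DL] by (simp add: d_def)
  have "linear (\<lambda>y. d x y)" for x
    by (rule linearI; rule injD[OF inj_\<Phi>]) (simp_all add: \<Phi>D \<Phi>_add \<Phi>_scale c)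
  moreover have "linear (\<lambda>x. d x y)" for y
    by (rule linearI; rule injD[OF inj_\<Phi>]) (simp_all add: \<Phi>D \<Phi>_add \<Phi>_scale c)
  moreover have "d x (\<i> *s y) = \<i> *s d x y" for x y
    by (rule injD[OF inj_\<Phi>]) (simp add: \<Phi>D \<Phi>_i c)
  moreover have "d x y \<bullet> z = - (y \<bullet> d x z)" for x y z
    using low_facts(4)[OF D, of 0 x y z] by (simp add: low_def \<Phi>D[symmetric] g_\<Phi> inner_commute)
  ultimately have "hla.hermitian_form d"
    by (simp add: hla.hermitian_form_def bilinear_def)
  then show "hla.hermitian_form ?D"
    by (simp only: d_def)
  have "\<Phi> (hla.tor d x y) = torsion D (\<Phi> x) (\<Phi> y)"
    by (simp add: hla.tor_def torsion_def linear_diff[OF linear_\<Phi>] \<Phi>D \<Phi>_br)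
  then show "\<Phi> (hla.tor ?D x y) = torsion D (\<Phi> x) (\<Phi> y)"
    by (simp only: d_def)
qed

end

context hermitian_group_frame
begin

theorem flat_dichotomy:
  assumes s: "s \<noteq> 0" "s \<noteq> 2" and G: "gauduchon_connection A J g s D" and flat: "flat A D"
  shows "(\<forall>X\<in>L. \<forall>Y\<in>L. bracket X Y = 0) \<or>
    (\<exists>X Y Z W q. q \<noteq> 0 \<and>
       orthonormal_basis g L [X, Y, Z, W] \<and>
       orthogonal_decomposition g L (span {W}) (span {X, Y, Z}) \<and>
       subalgebra (span {W}) L \<and>
       subalgebra (span {X, Y, Z}) L \<and>
       center L = span {W} \<and>
       bracket X Y = q *\<^sub>R Z \<and> bracket X Z = - (q *\<^sub>R Y) \<and> bracket Y Z = 0 \<and>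
       J X = W \<and> J Y = Z)"
proof -
  obtain Dc Db where Dc: "chern_connection A J g Dc" and Db: "bismut_connection A J g Db"
    and D: "\<And>X Y. X \<in> VF \<Longrightarrow> Y \<in> VF \<Longrightarrow> D X Y = (1 - s / 2) *\<^sub>R Dc X Y + (s / 2) *\<^sub>R Db X Y"
    using G by (auto simp: gauduchon_connection_def)
  have hc: "hermitian_connection A J g Dc" and hb: "hermitian_connection A J g Db"
    using Dc Db by (simp_all add: chern_connection_def bismut_connection_def)
  define dc where "dc x y = \<Psi> (Dc (\<Phi> x) (\<Phi> y))" for x y
  define db where "db x y = \<Psi> (Db (\<Phi> x) (\<Phi> y))" for x y
  have \<Phi>d: "\<Phi> (dc x y) = Dc (\<Phi> x) (\<Phi> y)" "\<Phi> (db x y) = Db (\<Phi> x) (\<Phi> y)" for x y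
    by (simp_all add: dc_def db_def \<Phi>_\<Psi> chern_L[OF Dc] bismut_L[OF Db])
  note pc = hermitian_form_pullback[OF hc chern_L[OF Dc], folded dc_def]
  note pb = hermitian_form_pullback[OF hb bismut_L[OF Db], folded db_def]
  define d where "d x y = (1 - s / 2) *\<^sub>R dc x y + (s / 2) *\<^sub>R db x y" for x y
  have \<Phi>D: "D (\<Phi> x) (\<Phi> y) = \<Phi> (d x y)" for x y
    by (simp add: D d_def \<Phi>_add \<Phi>_scale \<Phi>d)
  have "(\<forall>x y. br x y = 0) \<or>
   (\<exists>x y q. q \<noteq> 0 \<and> complex_plane.unitary_frame x y \<and> br x y = q *\<^sub>R (\<i> *s y) \<and> br x (\<i> *s y) = - (q *\<^sub>R y) \<and>
     br y (\<i> *s y) = 0 \<and> (\<forall>v. br (\<i> *s x) v = 0))"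
  proof (rule hla.flat_gauduchon_classification[OF integrable pc(1) _ pb(1)])
    fix x y z
    show "hla.tor dc x y + hla.tor dc (\<i> *s x) (\<i> *s y) = 0"
      by (rule injD[OF inj_\<Phi>]) (use Dc in \<open>simp add: \<Phi>_add \<Phi>_0 pc(2) \<Phi>_i chern_connection_def\<close>)
    have "g (torsion Db (\<Phi> x) (\<Phi> y)) (\<Phi> z) = - g (torsion Db (\<Phi> x) (\<Phi> z)) (\<Phi> y)"
      using Db \<Phi>_VF unfolding bismut_connection_def by blast
    then have "g (\<Phi> (hla.tor db x y)) (\<Phi> z) 0 = - g (\<Phi> (hla.tor db x z)) (\<Phi> y) 0"
      unfolding pb(2) by simp
    then show "hla.tor db x y \<bullet> z = - (hla.tor db x z \<bullet> y)"
      by (simp only: g_\<Phi>)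
    have "\<Phi> (d x (d y z) - d y (d x z) - d (br x y) z) = 0"
      using flat unfolding flat_def by (simp add: linear_diff[OF linear_\<Phi>] \<Phi>D[symmetric] \<Phi>_br)
    then have "d x (d y z) - d y (d x z) - d (br x y) z = 0"
      by (metis \<Phi>_0 \<Phi>_eq_iff)
    then show "(1 - s / 2) *\<^sub>R dc x ((1 - s / 2) *\<^sub>R dc y z + (s / 2) *\<^sub>R db y z) +
        (s / 2) *\<^sub>R db x ((1 - s / 2) *\<^sub>R dc y z + (s / 2) *\<^sub>R db y z) -
       ((1 - s / 2) *\<^sub>R dc y ((1 - s / 2) *\<^sub>R dc x z + (s / 2) *\<^sub>R db x z) +
        (s / 2) *\<^sub>R db y ((1 - s / 2) *\<^sub>R dc x z + (s / 2) *\<^sub>R db x z)) -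
       ((1 - s / 2) *\<^sub>R dc (br x y) z + (s / 2) *\<^sub>R db (br x y) z) = 0"
      by (simp only: d_def)
  qed (use s in auto)
  then show ?thesis
  proof
    assume "\<forall>x y. br x y = 0"
    then have "bracket (\<Phi> x) (\<Phi> y) = 0" for x y
      using \<Phi>_br[of x y] by (simp add: \<Phi>_0)
    then show ?thesis
      using range_\<Phi> by (metis imageE)
  next
    assume "\<exists>x y q. q \<noteq> 0 \<and> complex_plane.unitary_frame x y \<and> br x y = q *\<^sub>R (\<i> *s y) \<and> br x (\<i> *s y) = - (q *\<^sub>R y) \<and>
     br y (\<i> *s y) = 0 \<and> (\<forall>v. br (\<i> *s x) v = 0)"
    then obtain x y q where q: "q \<noteq> 0" and fr: "complex_plane.unitary_frame x y"
      and b: "br x y = q *\<^sub>R (\<i> *s y)" "br x (\<i> *s y) = - (q *\<^sub>R y)" "br y (\<i> *s y) = 0" "\<And>v. br (\<i> *s x) v = 0"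
      by blast
    let ?X = "\<Phi> x" and ?Y = "\<Phi> y" and ?Z = "\<Phi> (\<i> *s y)" and ?W = "\<Phi> (\<i> *s x)"
    note ip = complex_plane.unitary_frame_inner[OF fr]
    have ne: "x \<noteq> y" "x \<noteq> \<i> *s y" "x \<noteq> \<i> *s x" "y \<noteq> \<i> *s y" "y \<noteq> \<i> *s x" "\<i> *s y \<noteq> \<i> *s x"
      using ip complex_plane.J_orth complex_plane.J_isometry by (metis zero_neq_one)+
    have BL: "set [?X, ?Y, ?Z, ?W] \<subseteq> L" by simp
    have expand: "v = (v \<bullet> x) *\<^sub>R x + (v \<bullet> (\<i> *s x)) *\<^sub>R (\<i> *s x) + (v \<bullet> y) *\<^sub>R y + (v \<bullet> (\<i> *s y)) *\<^sub>R (\<i> *s y)" for v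
      by (rule complex_plane.unitary_frame_expand[OF fr])
    have expand\<Phi>: "\<Phi> v = (v \<bullet> x) *\<^sub>R ?X + (v \<bullet> (\<i> *s x)) *\<^sub>R ?W + (v \<bullet> y) *\<^sub>R ?Y + (v \<bullet> (\<i> *s y)) *\<^sub>R ?Z" for v
      using arg_cong[OF expand[of v], of \<Phi>] by (simp only: \<Phi>_add \<Phi>_scale)
    have "\<Phi> v \<in> span (set [?X, ?Y, ?Z, ?W])" for v
      by (subst expand\<Phi>) (intro span_add span_scale span_base; simp)
    then have "L \<subseteq> span (set [?X, ?Y, ?Z, ?W])"
      unfolding range_\<Phi>[symmetric] by (rule image_subsetI)
    then have "span (set [?X, ?Y, ?Z, ?W]) = L"
      using span_minimal[OF BL subspace_L] by blast
    then have onb: "orthonormal_basis g L [?X, ?Y, ?Z, ?W]"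
      unfolding orthonormal_basis_def using BL
      by (auto simp: g_\<Phi> ip ne ne[symmetric] complex_plane.J_isometry complex_plane.J_orth zero_fun_def one_fun_def simp del: vector_smult_assoc)
    have spW: "span {?W} = {a *\<^sub>R ?W | a. True}"
      by (auto simp: span_singleton)
    have spK: "span {?X, ?Y, ?Z} = {a *\<^sub>R ?X + b *\<^sub>R ?Y + c *\<^sub>R ?Z | a b c. True}"
      by (auto simp: span_insert span_empty algebra_simps eq_diff_eq diff_eq_eq)
    have orthWK: "g X Y = 0" if X: "X \<in> span {?W}" and Y: "Y \<in> span {?X, ?Y, ?Z}" for X Y
    proof -
      obtain a where X: "X = \<Phi> (a *\<^sub>R (\<i> *s x))"
        using X unfolding spW by (auto simp: \<Phi>_scale)
      obtain a' b' c' where Y: "Y = \<Phi> (a' *\<^sub>R x + b' *\<^sub>R y + c' *\<^sub>R (\<i> *s y))"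
        using Y unfolding spK by (auto simp: \<Phi>_scale \<Phi>_add)
      show ?thesis
        unfolding X Y g_\<Phi> by (simp add: inner_simps ip fun_eq_iff)
    qed
    have dec: "orthogonal_decomposition g L (span {?W}) (span {?X, ?Y, ?Z})"
      unfolding orthogonal_decomposition_def
    proof (intro conjI ballI)
      show "L = {X + Y |X Y. X \<in> span {?W} \<and> Y \<in> span {?X, ?Y, ?Z}}" (is "_ = ?R")
      proof
        show "L \<subseteq> ?R"
        proof
          fix V assume "V \<in> L"
          then obtain v where "V = \<Phi> v"
            using range_\<Phi> by blast
          then have "V = (v \<bullet> (\<i> *s x)) *\<^sub>R ?W + ((v \<bullet> x) *\<^sub>R ?X + (v \<bullet> y) *\<^sub>R ?Y + (v \<bullet> (\<i> *s y)) *\<^sub>R ?Z)"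
            using expand\<Phi>[of v] by (simp add: algebra_simps)
          moreover have "(v \<bullet> (\<i> *s x)) *\<^sub>R ?W \<in> span {?W}"
            unfolding spW by blast
          moreover have "(v \<bullet> x) *\<^sub>R ?X + (v \<bullet> y) *\<^sub>R ?Y + (v \<bullet> (\<i> *s y)) *\<^sub>R ?Z \<in> span {?X, ?Y, ?Z}"
            unfolding spK by blast
          ultimately show "V \<in> ?R"
            by blast
        qed
        have "span {?W} \<subseteq> L" "span {?X, ?Y, ?Z} \<subseteq> L"
          by (rule span_minimal[OF _ subspace_L]; simp)+
        then show "?R \<subseteq> L"
          using subspace_add[OF subspace_L] by blast
      qed
      show "span {?W} \<inter> span {?X, ?Y, ?Z} = {0}"
      proof (intro equalityI subsetI)
        fix V assume V: "V \<in> span {?W} \<inter> span {?X, ?Y, ?Z}"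
        then have "g V V = 0"
          using orthWK by blast
        moreover obtain a where "V = \<Phi> (a *\<^sub>R (\<i> *s x))"
          using V unfolding spW by (auto simp: \<Phi>_scale)
        ultimately show "V \<in> {0}"
          by (auto simp: g_\<Phi> fun_eq_iff \<Phi>_0)
      qed (auto simp: span_zero)
      show "\<And>X Y. X \<in> span {?W} \<Longrightarrow> Y \<in> span {?X, ?Y, ?Z} \<Longrightarrow> g X Y = 0"
        by (rule orthWK)
    qed
    have bs: "br y x = - (q *\<^sub>R (\<i> *s y))" "br (\<i> *s y) x = q *\<^sub>R y" "br (\<i> *s y) y = 0" "br v (\<i> *s x) = 0" for v
      using b br_skew by (metis add.inverse_inverse minus_zero)+
    have self: "br v v = 0" for v
      by (rule eq_neg_imp_zero[OF br_skew])
    have sub: "subalgebra (span {?W}) L"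
      unfolding subalgebra_def
    proof (intro conjI ballI)
      show "span {?W} \<subseteq> L"
        by (rule span_minimal[OF _ subspace_L]) simp
      fix X Y assume "X \<in> span {?W}" "Y \<in> span {?W}"
      then obtain a c where "X = \<Phi> (a *\<^sub>R (\<i> *s x))" "Y = \<Phi> (c *\<^sub>R (\<i> *s x))"
        unfolding spW by (auto simp: \<Phi>_scale)
      then have "bracket X Y = 0"
        by (simp add: \<Phi>_br[symmetric] bilinear_simps[OF bilinear_br] b \<Phi>_0)
      then show "bracket X Y \<in> span {?W}"
        by (simp add: span_zero)
    qed simp
    have sub': "subalgebra (span {?X, ?Y, ?Z}) L"
      unfolding subalgebra_def
    proof (intro conjI ballI)
      show "span {?X, ?Y, ?Z} \<subseteq> L"
        by (rule span_minimal[OF _ subspace_L]) simp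
      fix X Y assume "X \<in> span {?X, ?Y, ?Z}" "Y \<in> span {?X, ?Y, ?Z}"
      then obtain a1 a2 a3 c1 c2 c3 where "X = \<Phi> (a1 *\<^sub>R x + a2 *\<^sub>R y + a3 *\<^sub>R (\<i> *s y))"
         "Y = \<Phi> (c1 *\<^sub>R x + c2 *\<^sub>R y + c3 *\<^sub>R (\<i> *s y))"
        unfolding spK by (auto simp: \<Phi>_scale \<Phi>_add)
      then have "bracket X Y = \<Phi> (0 *\<^sub>R x + (a3 * c1 * q - a1 * c3 * q) *\<^sub>R y + (a1 * c2 * q - a2 * c1 * q) *\<^sub>R (\<i> *s y))"
        by (simp add: \<Phi>_br[symmetric] bilinear_simps[OF bilinear_br] b bs self algebra_simps)
      then show "bracket X Y \<in> span {?X, ?Y, ?Z}"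
        unfolding spK \<Phi>_add \<Phi>_scale by blast
    qed simp
    \<comment> \<open>As q is nonzero, the bracket with \<open>x\<close> detects the components
      along \<open>y\<close> and \<open>\<i> *s y\<close>, and the bracket with \<open>y\<close> the
      one along \<open>x\<close>. Only multiples of \<open>\<i> *s x\<close> survive.\<close>
    have cen: "center L = span {?W}"
    proof (intro equalityI subsetI)
      fix V assume V: "V \<in> center L"
      then obtain v where v: "V = \<Phi> v"
        using range_\<Phi> by (auto simp: center_def)
      have "br v u = 0" for u
      proof -
        have "\<Phi> (br v u) = \<Phi> 0"
          using V by (simp add: center_def v \<Phi>_br \<Phi>_0)
        then show ?thesis by (simp only: \<Phi>_eq_iff)
      qed
      note v0 = this
      have "br v x = - ((v \<bullet> y) * q) *\<^sub>R (\<i> *s y) + ((v \<bullet> (\<i> *s y)) * q) *\<^sub>R y"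
        by (subst (1) expand) (simp add: bilinear_simps[OF bilinear_br] b bs self)
      then have "- ((v \<bullet> y) * q) *\<^sub>R (\<i> *s y) + ((v \<bullet> (\<i> *s y)) * q) *\<^sub>R y = 0"
        by (simp only: v0)
      then have "(- ((v \<bullet> y) * q) *\<^sub>R (\<i> *s y) + ((v \<bullet> (\<i> *s y)) * q) *\<^sub>R y) \<bullet> y = 0"
         "(- ((v \<bullet> y) * q) *\<^sub>R (\<i> *s y) + ((v \<bullet> (\<i> *s y)) * q) *\<^sub>R y) \<bullet> (\<i> *s y) = 0"
        by simp_all
      then have 1: "v \<bullet> y = 0" "v \<bullet> (\<i> *s y) = 0"
        using q by (simp_all only: inner_add_left inner_scaleR_left ip complex_plane.J_isometry complex_plane.J_orth) simp_all
      have "br v y = ((v \<bullet> x) * q) *\<^sub>R (\<i> *s y)"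
        by (subst (1) expand) (simp add: bilinear_simps[OF bilinear_br] b bs self)
      then have "((v \<bullet> x) * q) *\<^sub>R (\<i> *s y) \<bullet> (\<i> *s y) = 0"
        by (simp only: v0) simp
      then have "v \<bullet> x = 0"
        using q by (simp only: inner_scaleR_left ip complex_plane.J_isometry) simp
      then show "V \<in> span {?W}"
        unfolding v spW using 1 expand\<Phi>[of v] by auto
    next
      fix V assume "V \<in> span {?W}"
      then obtain a where V: "V = \<Phi> (a *\<^sub>R (\<i> *s x))"
        unfolding spW by (auto simp: \<Phi>_scale)
      have "bracket V (\<Phi> u) = 0" for u
        unfolding V by (simp add: \<Phi>_br[symmetric] bilinear_simps[OF bilinear_br] b \<Phi>_0)
      then have "bracket V Y = 0" if "Y \<in> L" for Y
        using that range_\<Phi> by (metis imageE)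
      then show "V \<in> center L"
        by (simp add: center_def V)
    qed
    have "bracket ?X ?Y = q *\<^sub>R ?Z" "bracket ?X ?Z = - (q *\<^sub>R ?Y)" "bracket ?Y ?Z = 0"
      by (simp_all add: \<Phi>_br[symmetric] b \<Phi>_scale \<Phi>_neg \<Phi>_0)
    moreover have "J ?X = ?W" "J ?Y = ?Z"
      by (simp_all add: \<Phi>_i)
    ultimately show ?thesis
      using q onb dec sub sub' cen by blast
  qed
qed

end

subsection \<open>Local homomorphisms and coverings of topological groups\<close>

primrec nmul :: "nat \<Rightarrow> 'g::group_add \<Rightarrow> 'g" where
  "nmul 0 a = 0"
| "nmul (Suc n) a = a + nmul n a"

lemma nmul_plus: "nmul (m + n) a = nmul m a + nmul n a"
  by (induction m) (simp_all add: add.assoc)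

lemma nmul_times: "nmul (m * n) a = nmul m (nmul n a)"
  by (induction m) (simp_all add: nmul_plus)

lemma nmul_commute: "a + b = b + a \<Longrightarrow> nmul n a + b = b + nmul n a"
  by (induction n) (simp_all, metis add.assoc)

lemma nmul_add: "a + b = b + a \<Longrightarrow> nmul n (a + b) = nmul n a + nmul n b"
proof (induction n)
  case (Suc n)
  have "nmul n a + b = b + nmul n a"
    by (rule nmul_commute[OF Suc.prems])
  then show ?case
    using Suc by (simp add: add.assoc) (metis add.assoc)
qed simp

locale local_homomorphism =
  fixes h :: "'v::real_normed_vector \<Rightarrow> 'g::group_add" and \<rho> :: real
  assumes \<rho>: "\<rho> > 0"
    and h_add: "\<And>u v. \<lbrakk>norm u < \<rho>; norm v < \<rho>; norm (u + v) < \<rho>\<rbrakk> \<Longrightarrow> h (u + v) = h u + h v"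
begin

lemma h_0: "h 0 = 0"
  using h_add[of 0 0] \<rho> by (metis add.right_neutral add_left_imp_eq norm_zero)

lemma h_nmul: "norm (real n *\<^sub>R u) < \<rho> \<Longrightarrow> h (real n *\<^sub>R u) = nmul n (h u)"
proof (induction n)
  case (Suc n)
  have "norm (real n *\<^sub>R u) \<le> norm (real (Suc n) *\<^sub>R u)" "norm (1 *\<^sub>R u) \<le> norm (real (Suc n) *\<^sub>R u)"
    unfolding norm_scaleR by (intro mult_right_mono; simp)+
  then have le: "norm (real n *\<^sub>R u) < \<rho>" "norm u < \<rho>"
    using Suc.prems by auto
  have "h (u + real n *\<^sub>R u) = h u + nmul n (h u)"
    using h_add[of u "real n *\<^sub>R u"] le Suc by (simp add: algebra_simps)
  then show ?case
    by (simp add: algebra_simps)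
qed (simp add: h_0)

text \<open>Here \<open>u\<close> is divided until it lies in the domain of \<open>h\<close>. The
  successor makes the inequality \<open>norm u < m * \<rho>\<close> strict and m positive even for
  \<open>u = 0\<close>.\<close>

definition ext :: "'v \<Rightarrow> 'g"
  where "ext u = (let m = Suc (nat \<lceil>norm u / \<rho>\<rceil>) in nmul m (h (u /\<^sub>R real m)))"

text \<open>Both sides are compared with the common refinement into \<open>m * n\<close>
  pieces.\<close>

lemma ext_welldefined:
  assumes "m > 0" "n > 0" "norm u < real m * \<rho>" "norm u < real n * \<rho>"
  shows "nmul m (h (u /\<^sub>R real m)) = nmul n (h (u /\<^sub>R real n))"
proof -
  have *: "nmul n (h (u /\<^sub>R real (m * n))) = h (u /\<^sub>R real m)"
    if "m > 0" "n > 0" "norm u < real m * \<rho>" for m n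
  proof -
    have eq: "real n *\<^sub>R (u /\<^sub>R real (m * n)) = u /\<^sub>R real m"
      using that by simp
    have "norm (u /\<^sub>R real m) < \<rho>"
      using that by (simp add: divide_simps mult.commute)
    then have "h (real n *\<^sub>R (u /\<^sub>R real (m * n))) = nmul n (h (u /\<^sub>R real (m * n)))"
      by (intro h_nmul) (simp only: eq)
    then show ?thesis
      by (simp only: eq)
  qed
  have "nmul m (nmul n (h (u /\<^sub>R real (m * n)))) = nmul n (nmul m (h (u /\<^sub>R real (n * m))))"
    by (simp only: nmul_times[symmetric] mult.commute)
  then show ?thesis
    by (simp only: *[OF assms(1,2,3)] *[OF assms(2,1,4)])
qed

lemma ext_eq:
  assumes "m > 0" "norm u < real m * \<rho>"
  shows "ext u = nmul m (h (u /\<^sub>R real m))"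
proof -
  have "norm u / \<rho> < real (Suc (nat \<lceil>norm u / \<rho>\<rceil>))"
    by linarith
  then have "norm u < real (Suc (nat \<lceil>norm u / \<rho>\<rceil>)) * \<rho>"
    using \<rho> by (simp add: divide_less_eq)
  then show ?thesis
    unfolding ext_def Let_def by (intro ext_welldefined assms) simp_all
qed

lemma ext_local: "norm u < \<rho> \<Longrightarrow> ext u = h u"
  using ext_eq[of 1 u] by simp

text \<open>The group need not be commutative, but \<open>h (u /\<^sub>R real m)\<close> and
  \<open>h (v /\<^sub>R real m)\<close> commute because both of their sums are the value of
  \<open>h\<close> at the same vector. Hence the m-fold multiple distributes over their sum.\<close>

lemma ext_add: "ext (u + v) = ext u + ext v"
proof -
  obtain m :: nat where m: "real m > (norm u + norm v) / \<rho>"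
    using reals_Archimedean2 by blast
  have m0: "m > 0"
    using m \<rho> by (metis divide_nonneg_pos add_nonneg_nonneg norm_ge_zero not_le of_nat_0_less_iff order.strict_trans1)
  have b: "norm u + norm v < real m * \<rho>"
    using m \<rho> by (simp add: divide_less_eq)
  have bs: "norm u < real m * \<rho>" "norm v < real m * \<rho>" "norm (u + v) < real m * \<rho>"
    using b norm_triangle_ineq[of u v] norm_ge_zero[of u] norm_ge_zero[of v] by linarith+
  have s: "norm (w /\<^sub>R real m) < \<rho>" if "norm w < real m * \<rho>" for w :: 'v
    using that m0 by (simp add: divide_simps mult.commute)
  have "h (u /\<^sub>R real m + v /\<^sub>R real m) = h (u /\<^sub>R real m) + h (v /\<^sub>R real m)"
    "h (v /\<^sub>R real m + u /\<^sub>R real m) = h (v /\<^sub>R real m) + h (u /\<^sub>R real m)"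
    by (rule h_add; use s bs in \<open>simp add: scaleR_add_right[symmetric] add.commute\<close>)+
  then have "h ((u + v) /\<^sub>R real m) = h (u /\<^sub>R real m) + h (v /\<^sub>R real m)"
    "h (u /\<^sub>R real m) + h (v /\<^sub>R real m) = h (v /\<^sub>R real m) + h (u /\<^sub>R real m)"
    by (simp_all add: scaleR_add_right add.commute)
  then show ?thesis
    using ext_eq[OF m0 bs(1)] ext_eq[OF m0 bs(2)] ext_eq[OF m0 bs(3)] nmul_add by metis
qed

end

section \<open>Homomorphisms that are homeomorphisms near zero\<close>

locale covering_homomorphism =
  fixes F :: "'v::real_normed_vector \<Rightarrow> 'g::{topological_group_add, t2_space}"
    and lg :: "'g \<Rightarrow> 'v" and \<rho> :: real
  assumes F_add: "F (u + v) = F u + F v"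
    and \<rho>: "\<rho> > 0"
    and homeo: "homeomorphism (ball 0 \<rho>) (F ` ball 0 \<rho>) F lg"
    and open_image: "open (F ` ball 0 \<rho>)"
    and conn: "connected (UNIV :: 'g set)"
begin

lemma F_0: "F 0 = 0"
  using F_add[of 0 0] by (metis add.right_neutral add_left_imp_eq)

lemma F_neg: "F (- u) = - F u"
  using F_add[of u "- u"] F_0 by (simp add: eq_neg_iff_add_eq_0 minus_unique)

lemma F_diff: "F (u - v) = - F v + F u"
  using F_add[of "- v" u] F_neg by simp

lemma lg_F: "norm u < \<rho> \<Longrightarrow> lg (F u) = u"
  using homeomorphism_apply1[OF homeo, of u] by simp

lemma open_F_ball:
  assumes "r \<le> \<rho>" shows "open (F ` ball 0 r)"
proof -
  have "openin (top_of_set (F ` ball 0 \<rho>)) (F ` ball 0 r)"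
    by (rule homeomorphism_imp_open_map[OF homeo]) (use assms in \<open>auto intro!: open_openin_trans\<close>)
  then show ?thesis
    using open_image openin_open_trans by blast
qed

lemma open_translate:
  fixes T :: "'g set"
  assumes "open T" shows "open ((+) a ` T)"
proof -
  have "(+) a ` T = (\<lambda>x. - a + x) -` T"
    by (force simp: add.assoc[symmetric] image_iff)
  moreover have "open ((\<lambda>x. - a + x) -` T)"
    by (rule open_vimage[OF assms]) (intro continuous_intros)
  ultimately show ?thesis by simp
qed

lemma continuous_F: "continuous_on UNIV F"
proof (rule continuous_at_imp_continuous_on, rule ballI)
  fix u
  have "continuous_on (ball u \<rho>) (\<lambda>v. F u + F (v - u))"
    by (intro continuous_intros continuous_on_compose2[OF homeomorphism_cont1[OF homeo]])
      (auto simp: dist_norm norm_minus_commute)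
  then have "continuous_on (ball u \<rho>) F"
    by (simp add: F_diff add.assoc[symmetric])
  then show "isCont F u"
    using \<rho> continuous_on_eq_continuous_at[OF open_ball] by (metis centre_in_ball)
qed

text \<open>The range is an open subgroup. Its complement is a union of translates of the same open
  set, so the range is also closed, and connectedness finishes.\<close>

lemma surj_F: "range F = UNIV"
proof -
  have o: "open (\<Union>a\<in>X. (+) a ` (F ` ball 0 \<rho>))" for X
    by (intro open_UN ballI open_translate open_image)
  have r: "range F = (\<Union>a\<in>range F. (+) a ` (F ` ball 0 \<rho>))"
  proof safe
    fix u show "F u \<in> (\<Union>a\<in>range F. (+) a ` (F ` ball 0 \<rho>))"
      using \<rho> F_0 by (intro UN_I[of "F u"]) (auto intro!: image_eqI[of _ _ 0] image_eqI[of _ F 0])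
  next
    fix u v show "F u + F v \<in> range F"
      by (metis F_add rangeI)
  qed
  then have op: "open (range F)"
    by (subst r) (rule o)
  have c: "- range F = (\<Union>a\<in>- range F. (+) a ` (F ` ball 0 \<rho>))"
  proof safe
    fix x assume "x \<notin> range F"
    then show "x \<in> (\<Union>a\<in>- range F. (+) a ` (F ` ball 0 \<rho>))"
      using \<rho> F_0 by (intro UN_I[of x]) (auto intro!: image_eqI[of _ _ 0] image_eqI[of _ F 0])
  next
    fix a u v assume a: "a \<notin> range F" "a + F u = F v"
    then have "a = F (v - u)"
      using F_add[of v "- u"] F_neg[of u] by (metis add.assoc add.right_neutral add.right_inverse uminus_add_conv_diff diff_conv_add_uminus)
    then show False
      using a(1) by blast
  qed
  have "closed (range F)"
    unfolding closed_def by (subst c) (rule o)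
  with op show ?thesis
    using conn connected_clopen[of "UNIV :: 'g set"] by auto
qed

lemma covering: "covering_space UNIV F UNIV"
proof
  show "continuous_on UNIV F" by (rule continuous_F)
  show "F ` UNIV = UNIV" by (rule surj_F)
  fix y :: 'g
  obtain u0 where u0: "y = F u0"
    using surj_F by blast
  \<comment> \<open>The sheets over \<open>?T\<close> are translates of this half ball by elements
    of the kernel. If two of them met, a kernel element of norm less than \<rho> would arise, and
    \<open>F\<close> is injective on that ball.\<close>
  let ?B = "ball 0 (\<rho> / 2) :: 'v set"
  let ?T = "(+) y ` (F ` ?B)"
  let ?S = "\<lambda>\<gamma>. (+) (u0 + \<gamma>) ` ?B"
  let ?v = "?S ` {\<gamma>. F \<gamma> = 0}"
  have h2: "homeomorphism ?B (F ` ?B) F lg"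
    by (rule homeomorphism_of_subsets[OF homeo]) (use \<rho> in auto)
  show "\<exists>T. y \<in> T \<and> openin (top_of_set UNIV) T \<and> (\<exists>v. \<Union> v = UNIV \<inter> F -` T \<and>
      (\<forall>u\<in>v. openin (top_of_set UNIV) u) \<and> pairwise disjnt v \<and> (\<forall>u\<in>v. \<exists>q. homeomorphism u T F q))"
  proof (intro exI[of _ ?T] exI[of _ ?v] conjI)
    show "y \<in> ?T"
      using \<rho> F_0 by (auto intro!: image_eqI[of _ _ 0] image_eqI[of _ F 0])
    show "openin (top_of_set UNIV) ?T"
      using open_translate[OF open_F_ball[of "\<rho> / 2"]] \<rho> by simp
    show "\<Union> ?v = UNIV \<inter> F -` ?T"
    proof (intro equalityI subsetI)
      fix x assume "x \<in> \<Union> ?v"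
      then obtain \<gamma> where "F \<gamma> = 0" "x \<in> ?S \<gamma>" by blast
      moreover from this obtain w where "w \<in> ?B" "x = u0 + \<gamma> + w" by blast
      ultimately have "F \<gamma> = 0" "w \<in> ?B" "x = u0 + \<gamma> + w" by auto
      then show "x \<in> UNIV \<inter> F -` ?T"
        using u0 by (auto simp: F_add)
    next
      fix x assume "x \<in> UNIV \<inter> F -` ?T"
      then obtain w where w: "w \<in> ?B" "F x = F u0 + F w"
        using u0 by auto
      have "F (x - (u0 + w)) = 0"
        by (simp add: F_diff F_add w(2))
      moreover have "x = u0 + (x - (u0 + w)) + w" by simp
      ultimately show "x \<in> \<Union> ?v"
        using w(1) by blast
    qed
    show "\<forall>u\<in>?v. openin (top_of_set UNIV) u"
      by (auto intro: open_translation)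
    show "pairwise disjnt ?v"
    proof (rule pairwiseI)
      fix P Q assume "P \<in> ?v" "Q \<in> ?v" and ne: "P \<noteq> Q"
      then obtain a b where ab: "F a = 0" "P = ?S a" "F b = 0" "Q = ?S b" by auto
      show "disjnt P Q"
      proof (rule ccontr)
        assume "\<not> disjnt P Q"
        then obtain x where "x \<in> ?S a" "x \<in> ?S b"
          unfolding ab disjnt_iff by blast
        then obtain w w' where w: "norm w < \<rho> / 2" "norm w' < \<rho> / 2" "u0 + a + w = u0 + b + w'"
          by (elim imageE) (metis mem_ball_0)
        then have "a - b = w' - w"
          by (simp add: algebra_simps)
        then have "norm (a - b) < \<rho>"
          using w norm_triangle_ineq4[of w' w] by simp
        moreover have "F (a - b) = F 0"
          by (simp add: F_diff ab F_0)
        ultimately have "a - b = 0"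
          using lg_F[of "a - b"] lg_F[of 0] \<rho> by simp
        then show False
          using ne ab by simp
      qed
    qed
    show "\<forall>u\<in>?v. \<exists>q. homeomorphism u ?T F q"
    proof
      fix P assume "P \<in> ?v"
      then obtain \<gamma> where \<gamma>: "F \<gamma> = 0" "P = ?S \<gamma>" by auto
      have Fs: "F (u0 + \<gamma> + w) = y + F w" for w
        by (simp add: F_add \<gamma> u0)
      have "homeomorphism P ?T F (\<lambda>t. u0 + \<gamma> + lg (- y + t))"
      proof (rule homeomorphismI)
        show "continuous_on P F"
          using continuous_F continuous_on_subset by blast
        show "continuous_on ?T (\<lambda>t. u0 + \<gamma> + lg (- y + t))"
          by (intro continuous_intros continuous_on_compose2[OF homeomorphism_cont2[OF h2]])
            (auto simp: add.assoc[symmetric])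
        have P: "\<exists>w. norm w < \<rho> / 2 \<and> x = u0 + \<gamma> + w" if "x \<in> P" for x
          using that unfolding \<gamma>(2) by (metis imageE mem_ball_0)
        have P': "u0 + \<gamma> + w \<in> P" if "norm w < \<rho> / 2" for w
          unfolding \<gamma>(2) using that by (intro imageI) simp
        have T: "\<exists>w. norm w < \<rho> / 2 \<and> t = y + F w" if "t \<in> ?T" for t
          using that by (elim imageE) (simp only: mem_ball_0, blast)
        have T': "y + F w \<in> ?T" if "norm w < \<rho> / 2" for w
          by (rule imageI, rule imageI) (use that in simp)
        have lg: "lg (- y + (y + F w)) = w" if "norm w < \<rho> / 2" for w
          using that lg_F[of w] \<rho> by (simp add: add.assoc[symmetric])
        show "F ` P \<subseteq> ?T"
        proof (rule image_subsetI)
          fix x assume "x \<in> P"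
          then obtain w where "norm w < \<rho> / 2" "F x = y + F w"
            using P Fs by blast
          then show "F x \<in> ?T"
            using T' by simp
        qed
        show "(\<lambda>t. u0 + \<gamma> + lg (- y + t)) ` ?T \<subseteq> P"
        proof (rule image_subsetI)
          fix t assume "t \<in> ?T"
          then show "u0 + \<gamma> + lg (- y + t) \<in> P"
            using T P' lg by metis
        qed
        show "u0 + \<gamma> + lg (- y + F x) = x" if "x \<in> P" for x
          using P[OF that] Fs lg by metis
        show "F (u0 + \<gamma> + lg (- y + t)) = t" if "t \<in> ?T" for t
          using T[OF that] Fs lg by metis
      qed
      then show "\<exists>q. homeomorphism P ?T F q"
        by blast
    qed
  qed
qed

text \<open>This is uniform continuity on a compact set. Closeness in the group means that
  \<open>- H x + H y\<close> lies in a given neighbourhood of 0, since the group carries no chosen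
  metric; a violating pair of sequences would have a common limit.\<close>

lemma uniform_closeness:
  fixes H :: "'m::metric_space \<Rightarrow> 'g"
  assumes K: "compact K" and H: "continuous_on K H" and T: "open T" "0 \<in> T"
  obtains e where "e > 0" "\<And>x y. \<lbrakk>x \<in> K; y \<in> K; dist x y < e\<rbrakk> \<Longrightarrow> - H x + H y \<in> T"
proof (rule ccontr)
  assume "\<not> thesis"
  then have "\<forall>n::nat. \<exists>x y. x \<in> K \<and> y \<in> K \<and> dist x y < 1 / real (Suc n) \<and> - H x + H y \<notin> T"
    using that by (metis zero_less_divide_1_iff of_nat_0_less_iff zero_less_Suc)
  then obtain X Y where XY: "\<And>n. X n \<in> K" "\<And>n. Y n \<in> K" "\<And>n::nat. dist (X n) (Y n) < 1 / real (Suc n)" "\<And>n. - H (X n) + H (Y n) \<notin> T"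
    by metis
  obtain l and r :: "nat \<Rightarrow> nat" where l: "l \<in> K" "strict_mono r" "(X \<circ> r) \<longlonglongrightarrow> l"
    using K XY(1) unfolding compact_def by blast
  have "(\<lambda>n. dist (X n) (Y n)) \<longlonglongrightarrow> 0"
    by (rule Lim_null_comparison[OF _ LIMSEQ_Suc[OF lim_1_over_n]])
      (use XY(3) in \<open>auto intro!: always_eventually less_imp_le\<close>)
  then have d: "(\<lambda>n. dist ((X \<circ> r) n) ((Y \<circ> r) n)) \<longlonglongrightarrow> 0"
    using LIMSEQ_subseq_LIMSEQ[OF _ l(2)] by (auto simp: o_def)
  have Yl: "(Y \<circ> r) \<longlonglongrightarrow> l"
  proof (subst tendsto_dist_iff, rule Lim_null_comparison)
    show "\<forall>\<^sub>F n in sequentially. norm (dist ((Y \<circ> r) n) l) \<le> dist ((X \<circ> r) n) ((Y \<circ> r) n) + dist ((X \<circ> r) n) l"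
      by (intro always_eventually allI) (simp add: dist_triangle3)
    show "(\<lambda>n. dist ((X \<circ> r) n) ((Y \<circ> r) n) + dist ((X \<circ> r) n) l) \<longlonglongrightarrow> 0"
      using tendsto_add[OF d iffD1[OF tendsto_dist_iff l(3)]]
      by simp
  qed
  have "((\<lambda>n. H ((X \<circ> r) n)) \<longlonglongrightarrow> H l)" "((\<lambda>n. H ((Y \<circ> r) n)) \<longlonglongrightarrow> H l)"
    using H l Yl XY(1,2) unfolding continuous_on_sequentially by (auto simp: o_def)
  then have "(\<lambda>n. - H ((X \<circ> r) n) + H ((Y \<circ> r) n)) \<longlonglongrightarrow> - H l + H l"
    by (intro tendsto_intros)
  then have "\<forall>\<^sub>F n in sequentially. - H ((X \<circ> r) n) + H ((Y \<circ> r) n) \<in> T"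
    using T by (intro topological_tendstoD) auto
  then show False
    using XY(4) by (auto simp: eventually_sequentially)
qed

text \<open>The increments of a loop, measured by \<open>lg\<close> along a fine subdivision, add up to the endpoint
  of its lift. This sum does not change along a homotopy of loops.\<close>

lemma simply_connected_kernel:
  assumes sc: "simply_connected (UNIV :: 'g set)" and \<gamma>: "F \<gamma> = 0"
  shows "\<gamma> = 0"
proof -
  define p where "p t = F (t *\<^sub>R \<gamma>)" for t :: real
  have cp: "continuous_on {0..1} p"
    unfolding p_def by (rule continuous_on_compose2[OF continuous_F]) (auto intro!: continuous_intros)
  have "homotopic_loops UNIV p (\<lambda>_. 0)"
    using sc cp \<gamma> F_0 unfolding simply_connected_def
    by (auto simp: path_def pathstart_def pathfinish_def p_def)
  then obtain H where H: "continuous_on ({0..1::real} \<times> {0..1::real}) H" "\<And>x. x \<in> {0..1} \<Longrightarrow> H (0, x) = p x"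
    "\<And>x. x \<in> {0..1} \<Longrightarrow> H (1, x) = 0" "\<And>t. t \<in> {0..1} \<Longrightarrow> H (t, 1) = H (t, 0)"
    unfolding homotopic_loops by (auto simp: pathfinish_def pathstart_def)
  \<comment> \<open>With radius \<rho> / 3 the sum of two increments stays in the domain of
    \<open>lg\<close>, which is therefore additive on them.\<close>
  let ?T = "F ` ball 0 (\<rho> / 3)"
  have T: "open ?T" "0 \<in> ?T"
    using open_F_ball[of "\<rho> / 3"] \<rho> F_0 by (auto intro!: image_eqI[of _ F 0])
  obtain e where e: "e > 0" "\<And>x y. \<lbrakk>x \<in> {0..1} \<times> {0..1}; y \<in> {0..1} \<times> {0..1}; dist x y < e\<rbrakk> \<Longrightarrow> - H x + H y \<in> ?T"
    using uniform_closeness[OF compact_Times[OF compact_Icc compact_Icc] H(1) T] by blast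
  have lg_add: "lg (a + b) = lg a + lg b" if "a \<in> ?T" "b \<in> ?T" for a b
  proof -
    obtain u v where uv: "a = F u" "norm u < \<rho> / 3" "b = F v" "norm v < \<rho> / 3"
      using \<open>a \<in> ?T\<close> \<open>b \<in> ?T\<close> by auto
    then have "norm (u + v) < \<rho>"
      using norm_triangle_ineq[of u v] \<rho> by linarith
    then show ?thesis
      using uv lg_F[of "u + v"] lg_F[of u] lg_F[of v] \<rho> by (simp add: F_add)
  qed
  \<comment> \<open>The first bound makes neighbouring grid points, diagonal ones included, closer
    than \<open>e\<close>; the second puts \<open>\<gamma> /\<^sub>R real n\<close> into the ball
    where \<open>lg\<close> inverts \<open>F\<close>.\<close>
  obtain n :: nat where n: "real n > max (2 / e) (norm \<gamma> / \<rho>)"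
    using reals_Archimedean2 by blast
  have n0: "real n > 0"
    using n e(1) by (smt (verit) divide_pos_pos max_less_iff_conj)
  have n1: "2 / real n < e" and n2: "norm \<gamma> / real n < \<rho>"
    using n n0 e(1) \<rho> by (simp_all add: divide_less_eq less_divide_eq mult.commute)
  define G where "G i k = H (real i / real n, real k / real n)" for i k
  have in01: "real i / real n \<in> {0..1}" if "i \<le> n" for i
    using that n0 by simp
  define \<delta> where "\<delta> a b = lg (- a + b)" for a b :: 'g
  have close: "- G i k + G i' k' \<in> ?T"
    if "i \<le> n" "k \<le> n" "i' \<le> n" "k' \<le> n" "\<bar>real i - real i'\<bar> \<le> 1" "\<bar>real k - real k'\<bar> \<le> 1" for i k i' k'
  proof -
    have d: "\<bar>real a / real n - real b / real n\<bar> \<le> 1 / real n" if "\<bar>real a - real b\<bar> \<le> 1" for a b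
      using that n0 by (simp add: diff_divide_distrib[symmetric] abs_divide divide_right_mono)
    have "dist (real i / real n, real k / real n) (real i' / real n, real k' / real n)
        \<le> \<bar>real i / real n - real i' / real n\<bar> + \<bar>real k / real n - real k' / real n\<bar>"
      using sqrt_sum_squares_le_sum_abs by (simp add: dist_Pair_Pair dist_real_def)
    also have "\<dots> \<le> 1 / real n + 1 / real n"
      using that by (intro add_mono d)
    also have "\<dots> < e"
      using n1 by simp
    finally show ?thesis
      unfolding G_def by (intro e(2) SigmaI in01 that(1-4))
  qed
  have \<delta>_trans: "\<delta> a c = \<delta> a b + \<delta> b c" if "- a + b \<in> ?T" "- b + c \<in> ?T" for a b c
  proof -
    have "- a + c = (- a + b) + (- b + c)"
      by (simp add: add.assoc)
    then show ?thesis
      unfolding \<delta>_def using lg_add[OF that] by simp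
  qed
  define w where "w i = (\<Sum>k<n. \<delta> (G i k) (G i (Suc k)))" for i
  \<comment> \<open>Each grid square gives two paths to the opposite corner with equal total
    increment. Summed over a row this telescopes to the difference at the ends, which coincide
    because every stage of the homotopy is a loop.\<close>
  have step: "w i = w (Suc i)" if i: "i < n" for i
  proof -
    let ?c = "\<lambda>k. \<delta> (G i k) (G (Suc i) k)"
    have "\<delta> (G i k) (G i (Suc k)) - \<delta> (G (Suc i) k) (G (Suc i) (Suc k)) = ?c k - ?c (Suc k)" if k: "k < n" for k
    proof -
      have "\<delta> (G i k) (G (Suc i) (Suc k)) = \<delta> (G i k) (G i (Suc k)) + ?c (Suc k)"
        by (rule \<delta>_trans; rule close) (use i k in auto)
      moreover have "\<delta> (G i k) (G (Suc i) (Suc k)) = ?c k + \<delta> (G (Suc i) k) (G (Suc i) (Suc k))"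
        by (rule \<delta>_trans; rule close) (use i k in auto)
      ultimately show ?thesis
        by (simp add: algebra_simps)
    qed
    then have "w i - w (Suc i) = (\<Sum>k<n. ?c k - ?c (Suc k))"
      unfolding w_def sum_subtractf[symmetric] by (intro sum.cong) auto
    also have "\<dots> = ?c 0 - ?c n"
      by (rule sum_lessThan_telescope')
    also have "\<dots> = 0"
    proof -
      have "G a n = G a 0" if "a \<le> n" for a
        using H(4)[OF in01[OF that]] n0 by (simp add: G_def)
      then show ?thesis
        using i by simp
    qed
    finally show ?thesis by simp
  qed
  have "w 0 = w i" if "i \<le> n" for i
    using that by (induction i) (auto simp: step)
  then have "w 0 = w n" by simp
  also have "w n = 0"
  proof -
    have "G n k = 0" if "k \<le> n" for k
      using H(3)[OF in01[OF that]] n0 by (simp add: G_def)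
    moreover have "lg 0 = 0"
      using lg_F[of 0] \<rho> F_0 by simp
    ultimately show ?thesis
      by (simp add: w_def \<delta>_def)
  qed
  also have "w 0 = (\<Sum>k<n. \<gamma> /\<^sub>R real n)"
    unfolding w_def
  proof (rule sum.cong[OF refl])
    fix k assume "k \<in> {..<n}"
    then have k: "k \<le> n" "Suc k \<le> n" by auto
    have "- G 0 k + G 0 (Suc k) = F ((real (Suc k) / real n) *\<^sub>R \<gamma> - (real k / real n) *\<^sub>R \<gamma>)"
      using H(2)[OF in01[OF k(1)]] H(2)[OF in01[OF k(2)]] by (simp add: G_def p_def F_diff)
    also have "(real (Suc k) / real n) *\<^sub>R \<gamma> - (real k / real n) *\<^sub>R \<gamma> = \<gamma> /\<^sub>R real n"
      using n0 by (simp add: scaleR_diff_left[symmetric] field_simps)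
    finally show "\<delta> (G 0 k) (G 0 (Suc k)) = \<gamma> /\<^sub>R real n"
      unfolding \<delta>_def using lg_F[of "\<gamma> /\<^sub>R real n"] n2 by (simp add: divide_inverse mult.commute)
  qed
  also have "\<dots> = \<gamma>"
    using n0 by (simp add: sum_constant_scaleR)
  finally show ?thesis .
qed

lemma simply_connected_bij:
  assumes "simply_connected (UNIV :: 'g set)"
  shows "bij F"
proof -
  have "inj F"
  proof (rule injI)
    fix u v assume "F u = F v"
    then have "F (u - v) = 0"
      by (simp add: F_diff)
    then have "u - v = 0"
      by (rule simply_connected_kernel[OF assms])
    then show "u = v" by simp
  qed
  then show ?thesis
    using surj_F by (simp add: bij_def)
qed

end

subsection \<open>Abelian Lie algebras\<close>

locale abelian_lie_group_chart = lie_group_chart A U \<phi>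
  for A :: "('g::{topological_group_add, t2_space}, 'e::euclidean_space) chart set" and U \<phi> +
  assumes abelian: "bracket (lf v) (lf w) = 0"
begin

text \<open>The vanishing bracket is applied to the functions \<open>hc b\<close>: near
  \<open>x0\<close> their derivative along \<open>lf v\<close> is the b-th component of
  \<open>M x v\<close>, and a second derivative gives both sides.\<close>

lemma M_commute:
  assumes x: "x \<in> ball x0 (R / 2)"
  shows "fd (\<lambda>x. M x v) x (M x w) = fd (\<lambda>x. M x w) x (M x v)"
proof -
  have xW: "x \<in> W" using x R by blast
  have l: "lf w (lf v (hc b)) (pt x) = fd (\<lambda>x. M x v) x (M x w) \<bullet> b" for v w b
  proof -
    have d: "((\<lambda>x. M x v \<bullet> b) has_derivative (\<lambda>u. fd (\<lambda>x. M x v) x u \<bullet> b)) (at x)"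
      by (rule has_derivative_inner_left[OF smooth_on_has_derivative[OF M_smooth xW]])
    have "lf w (lf v (hc b)) (pt x) = fd (\<lambda>x. lf v (hc b) (pt x)) x (M x w)"
      by (rule lf_pt[OF lf_smooth[OF hc_C] xW])
    also have "fd (\<lambda>x. lf v (hc b) (pt x)) x = fd (\<lambda>x. M x v \<bullet> b) x"
      by (rule fd_cong_open(1)[OF open_ball x]) (rule lf_hc)
    finally show ?thesis
      using fd_eq[OF d] by simp
  qed
  have "fd (\<lambda>x. M x v) x (M x w) \<bullet> b = fd (\<lambda>x. M x w) x (M x v) \<bullet> b" for b
  proof -
    have "bracket (lf w) (lf v) (hc b) (pt x) = 0"
      by (simp add: abelian)
    then show ?thesis
      by (simp add: bracket_def l)
  qed
  then show ?thesis
    by (rule euclidean_eqI)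
qed

lemma N_expand: "x \<in> W \<Longrightarrow> N x y = (\<Sum>b\<in>Basis. (y \<bullet> b) *\<^sub>R N x b)"
  using linear_sum[OF N_linear, of x "\<lambda>b. (y \<bullet> b) *\<^sub>R b" Basis] linear_scale[OF N_linear, of x]
  by (simp add: euclidean_representation)

text \<open>Differentiating \<open>N z (M z a) = a\<close> expresses the derivative of the coframe
  through that of the frame, so closedness is the dual of \<open>M_commute\<close>. The expansion in
  \<open>Basis\<close> separates the two ways in which \<open>N z (M z a)\<close> depends on
  z.\<close>

lemma N_closed:
  assumes x: "x \<in> ball x0 (R / 2)"
  shows "fd (\<lambda>x. N x u) x v = fd (\<lambda>x. N x v) x u"
proof -
  have xW: "x \<in> W" using x R by blast
  have dN: "((\<lambda>x. N x b) has_derivative fd (\<lambda>x. N x b) x) (at x)" for b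
    by (rule smooth_on_has_derivative[OF N_smooth xW])
  have q: "fd (\<lambda>x. N x y) x w = (\<Sum>b\<in>Basis. (y \<bullet> b) *\<^sub>R fd (\<lambda>x. N x b) x w)" for y w
  proof -
    have "((\<lambda>x. \<Sum>b\<in>Basis. (y \<bullet> b) *\<^sub>R N x b) has_derivative (\<lambda>w. \<Sum>b\<in>Basis. (y \<bullet> b) *\<^sub>R fd (\<lambda>x. N x b) x w)) (at x)"
      by (intro has_derivative_sum has_derivative_scaleR_right dN)
    then have "((\<lambda>x. N x y) has_derivative (\<lambda>w. \<Sum>b\<in>Basis. (y \<bullet> b) *\<^sub>R fd (\<lambda>x. N x b) x w)) (at x)"
      by (rule has_derivative_transform_within_open[OF _ W_open xW]) (simp add: N_expand[of _ y])
    from fd_eq[OF this] show ?thesis by simp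
  qed
  have nm: "fd (\<lambda>z. N z (M x a)) x w = - N x (fd (\<lambda>z. M z a) x w)" for a w
  proof -
    have dM: "((\<lambda>z. M z a) has_derivative fd (\<lambda>z. M z a) x) (at x)"
      by (rule smooth_on_has_derivative[OF M_smooth xW])
    have "((\<lambda>z. \<Sum>b\<in>Basis. (M z a \<bullet> b) *\<^sub>R N z b) has_derivative
        (\<lambda>w. \<Sum>b\<in>Basis. (M x a \<bullet> b) *\<^sub>R fd (\<lambda>x. N x b) x w + (fd (\<lambda>z. M z a) x w \<bullet> b) *\<^sub>R N x b)) (at x)"
      by (intro has_derivative_sum has_derivative_scaleR has_derivative_inner_left dM dN)
    then have "((\<lambda>z. a) has_derivative
        (\<lambda>w. \<Sum>b\<in>Basis. (M x a \<bullet> b) *\<^sub>R fd (\<lambda>x. N x b) x w + (fd (\<lambda>z. M z a) x w \<bullet> b) *\<^sub>R N x b)) (at x)"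
      by (rule has_derivative_transform_within_open[OF _ W_open xW]) (simp add: N_expand[symmetric])
    then have "(\<lambda>w. \<Sum>b\<in>Basis. (M x a \<bullet> b) *\<^sub>R fd (\<lambda>x. N x b) x w + (fd (\<lambda>z. M z a) x w \<bullet> b) *\<^sub>R N x b) = (\<lambda>w. 0)"
      by (rule has_derivative_unique[OF _ has_derivative_const])
    from fun_cong[OF this, of w]
    have "fd (\<lambda>z. N z (M x a)) x w + N x (fd (\<lambda>z. M z a) x w) = 0"
      by (simp add: sum.distrib q[of "M x a"] N_expand[OF xW, symmetric])
    then show ?thesis
      by (simp add: eq_neg_iff_add_eq_0)
  qed
  have "fd (\<lambda>z. N z (M x a)) x (M x b) = fd (\<lambda>z. N z (M x b)) x (M x a)" for a b
    unfolding nm M_commute[OF x, of a b] ..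
  from this[of "N x u" "N x v"] show ?thesis
    by (simp add: xW)
qed

text \<open>A chart in which left translations are translations: its differential is the left invariant
  coframe \<open>N\<close>, and its inverse \<open>k\<close> is a local homomorphism.\<close>

lemma logarithmic_chart:
  obtains f k X V where "open X" "x0 \<in> X" "X \<subseteq> W" "open V" "0 \<in> V" "homeomorphism X V f k"
    "smooth_on X f" "smooth_on V k" "k 0 = x0" "(k has_derivative (\<lambda>v. v)) (at 0)"
    "\<exists>r>0. ball 0 r \<subseteq> V \<and> (\<forall>y\<in>ball 0 r. \<forall>z\<in>ball 0 r. y + z \<in> V \<longrightarrow> pt (k (y + z)) = pt (k y) + pt (k z))"
proof -
  let ?B = "ball x0 (R / 2)"
  have BW: "?B \<subseteq> W" and x0B: "x0 \<in> ?B" using R by auto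
  obtain f where f: "smooth_on ?B f" "f x0 = 0" "\<And>x. x \<in> ?B \<Longrightarrow> (f has_derivative N x) (at x)"
  proof (rule poincare[OF open_ball convex_ball x0B, of N])
    show "linear (N x)" if "x \<in> ?B" for x
      using N_linear that BW by blast
    show "smooth_on ?B (\<lambda>x. N x v)" for v
      by (rule smooth_on_subset[OF N_smooth BW])
    show "fd (\<lambda>x. N x u) x v = fd (\<lambda>x. N x v) x u" if "x \<in> ?B" for x u v
      by (rule N_closed[OF that])
  qed (rule that)
  have bl: "blinfun_apply (Blinfun (fd f x)) = N x" if "x \<in> ?B" for x
    using f(3)[OF that] fd_eq[OF f(3)[OF that]]
    by (simp add: bounded_linear_Blinfun_apply has_derivative_bounded_linear)
  obtain X V k k' where X: "open X" "X \<subseteq> ?B" "x0 \<in> X" and V: "open V" "f x0 \<in> V" and hom: "homeomorphism X V f k"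
    and k': "\<And>y. y \<in> V \<Longrightarrow> (k has_derivative k' y) (at y)" "\<And>y. y \<in> V \<Longrightarrow> k' y = inv (blinfun_apply (Blinfun (fd f (k y))))"
  proof (rule inverse_function_theorem[OF open_ball, of x0 "R / 2" f "\<lambda>x. Blinfun (fd f x)" x0 id_blinfun])
    show "(f has_derivative blinfun_apply (Blinfun (fd f x))) (at x)" if "x \<in> ?B" for x
      using f(3)[OF that] by (simp add: bl[OF that])
    show "continuous_on ?B (\<lambda>x. Blinfun (fd f x))"
      by (rule continuous_on_Blinfun_fd[OF smooth_onD[OF f(1)]])
    show "id_blinfun o\<^sub>L Blinfun (fd f x0) = id_blinfun"
      by (rule blinfun_eqI) (simp add: bl[OF x0B])
    show "x0 \<in> ?B" by (rule x0B)
  qed (rule that)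
  have kX: "k y \<in> X" "f (k y) = y" if "y \<in> V" for y
    using hom that by (auto simp: homeomorphism_def)
  have fX: "f x \<in> V" "k (f x) = x" if "x \<in> X" for x
    using hom that by (auto simp: homeomorphism_def)
  have XW: "X \<subseteq> W" using X BW by blast
  have dk: "(k has_derivative M (k y)) (at y)" if y: "y \<in> V" for y
  proof -
    have kB: "k y \<in> ?B" and kW: "k y \<in> W"
      using kX[OF y] X BW by blast+
    have "k' y = inv (N (k y))"
      using k'(2)[OF y] by (simp add: bl[OF kB])
    also have "\<dots> = M (k y)"
      by (rule inv_equality) (use kW in auto)
    finally show ?thesis
      using k'(1)[OF y] by simp
  qed
  \<comment> \<open>The derivative of \<open>k\<close> at \<open>y\<close> is
    \<open>M (k y)\<close>, so if \<open>k\<close> is of class n, then so is its derivative, and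
    \<open>k\<close> gains one order.\<close>
  have ksm: "smooth_on V k"
  proof (rule smooth_onI)
    fix n show "Ck_on n V k"
    proof (induction n)
      case 0
      then show ?case
        using hom by (simp add: homeomorphism_def)
    next
      case (Suc n)
      show ?case
      proof (rule Ck_on_SucI[OF V(1) dk])
        show "Ck_on n V (\<lambda>y. M (k y) v)" for v
          by (rule Ck_on_compose[OF V(1) W_open _ Suc.IH smooth_onD[OF M_smooth]]) (use kX XW in blast)
      qed
    qed
  qed
  have V0: "0 \<in> V" using V f(2) by simp
  have k0: "k 0 = x0" using fX(2)[OF X(3)] f(2) by simp
  have dk0: "(k has_derivative (\<lambda>v. v)) (at 0)"
  proof -
    have "M (k 0) = (\<lambda>v. v)"
      by (rule ext) (simp add: k0)
    then show ?thesis
      using dk[OF V0] by simp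
  qed
  have plotk: "plot V (\<lambda>y. pt (k y))"
    by (rule plot_compose[OF plot_pt V(1) ksm]) (use kX XW in blast)
  have oVV: "open (V \<times> V)"
    using V by (intro open_Times)
  have plotkk: "plot (V \<times> V) (\<lambda>z. pt (k (fst z)) + pt (k (snd z)))"
    by (intro plot_add; rule plot_compose[OF plotk oVV])
      (auto intro!: smooth_on_bounded_linear bounded_linear_fst bounded_linear_snd oVV)
  have oX: "open {p \<in> U. \<phi> p \<in> X}"
    by (rule chart_open_preimage[OF UA X(1)])
  \<comment> \<open>These are the pairs whose sum stays in the domain of the logarithmic chart; a
    product neighbourhood of the origin inside it provides the radius r.\<close>
  let ?D = "(V \<times> V) \<inter> (\<lambda>z. pt (k (fst z)) + pt (k (snd z))) -` {p \<in> U. \<phi> p \<in> X}"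
  have oD: "open ?D"
    by (rule plotD(4)[OF plotkk oX])
  have D0: "(0, 0) \<in> ?D"
    using V0 X(3) U0 by (simp add: k0 x0_def)
  obtain P Q where PQ: "open P" "open Q" "(0, 0) \<in> P \<times> Q" "P \<times> Q \<subseteq> ?D"
    by (rule open_prod_elim[OF oD D0])
  then have "open (P \<inter> Q)" "0 \<in> P \<inter> Q" by auto
  then obtain r where r: "r > 0" "ball 0 r \<subseteq> P \<inter> Q"
    using open_contains_ball by metis
  have rD: "(y, z) \<in> ?D" if "y \<in> ball 0 r" "z \<in> ball 0 r" for y z
    using r(2) PQ(4) that by blast
  have rV: "ball 0 r \<subseteq> V"
    using rD by blast
  have hom_k: "pt (k (y + z)) = pt (k y) + pt (k z)" if y: "y \<in> ball 0 r" and z: "z \<in> ball 0 r" for y z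
  proof -
    let ?a = "pt (k y)"
    let ?e = "\<lambda>z. f (\<phi> (?a + pt (k z)))"
    have yV: "y \<in> V" using y rV by blast
    \<comment> \<open>Near \<open>z\<close> the translate is rewritten as \<open>?q\<close> plus an
      increment near the unit. The coframe \<open>N\<close> is left invariant, so the differential
      of \<open>?e\<close> is the identity and \<open>?e z - z\<close> is constant, namely
      \<open>y\<close>.\<close>
    have de: "(?e has_derivative (\<lambda>v. v)) (at z)" if z: "z \<in> ball 0 r" for z
    proof -
      have zV: "z \<in> V" using z rV by blast
      let ?x = "k z" and ?q = "?a + pt (k z)"
      have xW: "?x \<in> W" using kX[OF zV] XW by blast
      have q: "?q \<in> U" "\<phi> ?q \<in> X"
        using rD[OF y z] by auto
      then have qB: "\<phi> ?q \<in> ?B" "\<phi> ?q \<in> W"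
        using X BW by blast+
      have ptq: "pt (\<phi> ?q) = ?q" using q by simp
      have d1: "((\<lambda>z'. \<phi> (- pt ?x + pt (k z'))) has_derivative (\<lambda>v. N ?x (M ?x v))) (at z)"
        by (rule has_derivative_compose[OF dk[OF zV], of "\<lambda>w. \<phi> (- pt ?x + pt w)"])
          (rule N_has_derivative[OF xW])
      have d2: "((\<lambda>w. f (\<phi> (?q + pt w))) has_derivative (\<lambda>v. N (\<phi> ?q) (M (\<phi> ?q) v))) (at x0)"
      proof -
        have "((\<lambda>w. \<phi> (pt (\<phi> ?q) + pt w)) has_derivative M (\<phi> ?q)) (at x0)"
          by (rule M_has_derivative[OF qB(2)])
        then have m: "((\<lambda>w. \<phi> (?q + pt w)) has_derivative M (\<phi> ?q)) (at x0)"
          by (simp only: ptq)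
        show ?thesis
          by (rule has_derivative_compose[OF m, of f]) (simp add: f(3)[OF qB(1)])
      qed
      have e0: "\<phi> (- pt ?x + pt (k z)) = x0"
        by (simp add: x0_def)
      have d3: "((\<lambda>z'. f (\<phi> (?q + pt (\<phi> (- pt ?x + pt (k z')))))) has_derivative
          (\<lambda>v. N (\<phi> ?q) (M (\<phi> ?q) (N ?x (M ?x v))))) (at z)"
        by (rule has_derivative_compose[OF d1, of "\<lambda>w. f (\<phi> (?q + pt w))"]) (simp only: e0 d2)
      have eqv: "(\<lambda>v. N (\<phi> ?q) (M (\<phi> ?q) (N ?x (M ?x v)))) = (\<lambda>v. v)"
        by (rule ext) (simp only: N_M[OF qB(2)] N_M[OF xW])
      have o: "open (V \<inter> (\<lambda>z'. - pt ?x + pt (k z')) -` U)"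
        by (intro plotD(4)[OF plot_add[OF plot_const[OF V(1)] plotk] chart(1)[OF UA]])
      show ?thesis
        using d3 unfolding eqv
        by (rule has_derivative_transform_within_open[OF _ o]) (use zV U0 in \<open>auto simp: add.assoc\<close>)
    qed
    have "((\<lambda>z. ?e z - z) has_derivative (\<lambda>v. 0)) (at z within ball 0 r)" if "z \<in> ball 0 r" for z
      using has_derivative_diff[OF de[OF that] has_derivative_ident] has_derivative_at_withinI by fastforce
    then have "\<exists>c. \<forall>z\<in>ball 0 r. ?e z - z = c"
      by (rule has_derivative_zero_constant[OF convex_ball])
    then obtain c where c: "\<forall>z\<in>ball 0 r. ?e z - z = c" ..
    have "?e 0 - 0 = y"
      using kX[OF yV] XW by (auto simp: k0)
    then have "c = y"
      using bspec[OF c, of 0] r(1) by simp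
    then have "?e z = y + z"
      using bspec[OF c z] by (simp add: algebra_simps)
    moreover have q: "?a + pt (k z) \<in> U" "\<phi> (?a + pt (k z)) \<in> X"
      using rD[OF y z] by auto
    ultimately have "k (y + z) = \<phi> (?a + pt (k z))"
      using fX(2) by metis
    then show ?thesis
      using q by simp
  qed
  show ?thesis
  proof (rule that[OF X(1,3) XW V(1) V0 hom smooth_on_subset[OF f(1) X(2)] ksm k0 dk0])
    show "\<exists>r>0. ball 0 r \<subseteq> V \<and> (\<forall>y\<in>ball 0 r. \<forall>z\<in>ball 0 r. y + z \<in> V \<longrightarrow> pt (k (y + z)) = pt (k y) + pt (k z))"
      using r(1) rV hom_k by blast
  qed
qed

lemma vector_group_covering:
  fixes \<kappa> :: "complex ^ 2 \<Rightarrow> 'e" and J :: "'g vfield \<Rightarrow> 'g vfield"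
  assumes \<kappa>: "linear \<kappa>" "bij \<kappa>" and J: "\<And>\<xi>. J (lf (\<kappa> \<xi>)) = lf (\<kappa> (\<i> *s \<xi>))"
    and conn: "connected (UNIV :: 'g set)"
  shows "covered_by_complex_vector_group A J"
proof -
  obtain f k X V r where X: "open X" "x0 \<in> X" "X \<subseteq> W" and V: "open V" "0 \<in> V" and hom: "homeomorphism X V f k"
    and f: "smooth_on X f" and k: "smooth_on V k" "k 0 = x0" "(k has_derivative (\<lambda>v. v)) (at 0)"
    and r: "r > 0" "ball 0 r \<subseteq> V"
    and kadd: "\<And>y z. y \<in> ball 0 r \<Longrightarrow> z \<in> ball 0 r \<Longrightarrow> y + z \<in> V \<Longrightarrow> pt (k (y + z)) = pt (k y) + pt (k z)"
    using logarithmic_chart by metis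
  have kX: "k y \<in> X" "f (k y) = y" if "y \<in> V" for y
    using hom that by (auto simp: homeomorphism_def)
  have fX: "f x \<in> V" "k (f x) = x" if "x \<in> X" for x
    using hom that by (auto simp: homeomorphism_def)
  have bl\<kappa>: "bounded_linear \<kappa>"
    using \<kappa>(1) linear_conv_bounded_linear by blast
  define \<kappa>' where "\<kappa>' = inv \<kappa>"
  have \<kappa>\<kappa>': "\<kappa> (\<kappa>' y) = y" "\<kappa>' (\<kappa> u) = u" for y u
    using \<kappa>(2) by (simp_all add: \<kappa>'_def bij_is_inj bij_is_surj surj_f_inv_f)
  have "linear \<kappa>'"
    unfolding \<kappa>'_def using \<kappa> by (metis bij_is_inj bij_is_surj linear_injective_left_inverse inv_unique_comp surj_iff o_inv_distrib id_o o_assoc comp_id o_id)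
  then have bl\<kappa>': "bounded_linear \<kappa>'"
    using linear_conv_bounded_linear by blast
  have "open (\<kappa> -` ball 0 r)"
    using continuous_on_open_vimage[of UNIV \<kappa>] linear_continuous_on[OF bl\<kappa>, of UNIV] by (simp add: open_vimage)
  moreover have "0 \<in> \<kappa> -` ball 0 r"
    using r linear_0[OF \<kappa>(1)] by simp
  ultimately obtain \<rho> where \<rho>: "\<rho> > 0" "ball 0 \<rho> \<subseteq> \<kappa> -` ball 0 r"
    using open_contains_ball by metis
  have \<kappa>r: "\<kappa> u \<in> ball 0 r" "\<kappa> u \<in> V" if "norm u < \<rho>" for u
    using \<rho>(2) r(2) that by (auto simp: subset_iff)
  define h where "h u = pt (k (\<kappa> u))" for u
  interpret H: local_homomorphism h \<rho>
  proof
    show "\<rho> > 0" by (rule \<rho>)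
    show "h (u + v) = h u + h v" if "norm u < \<rho>" "norm v < \<rho>" "norm (u + v) < \<rho>" for u v
      using kadd[of "\<kappa> u" "\<kappa> v"] \<kappa>r[OF that(1)] \<kappa>r[OF that(2)] \<kappa>r[OF that(3)] linear_add[OF \<kappa>(1), of u v]
      by (simp add: h_def)
  qed
  let ?F = H.ext
  have k\<kappa>: "smooth_on (ball 0 \<rho>) (\<lambda>u. k (\<kappa> u))"
    by (rule smooth_on_compose[OF open_ball V(1) _ smooth_on_bounded_linear[OF bl\<kappa> open_ball] k(1)]) (use \<kappa>r in auto)
  have plot_h: "plot (ball 0 \<rho>) h"
    unfolding h_def by (rule plot_compose[OF plot_pt open_ball k\<kappa>]) (use kX \<kappa>r X(3) in \<open>auto simp: subset_iff\<close>)
  have Fh: "?F u = ?F u0 + h (u - u0)" if "u \<in> ball u0 \<rho>" for u u0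
    using H.ext_add[of u0 "u - u0"] H.ext_local[of "u - u0"] that by (simp add: dist_norm norm_minus_commute)
  have plot_F: "plot UNIV ?F"
  proof (rule plot_localI)
    fix u0 :: "complex ^ 2"
    have "plot (ball u0 \<rho>) (\<lambda>u. h (u - u0))"
      by (rule plot_compose[OF plot_h open_ball smooth_on_diff[OF open_ball smooth_on_id[OF open_ball] smooth_on_const[OF open_ball]]])
        (auto simp: dist_norm norm_minus_commute)
    then have "plot (ball u0 \<rho>) (\<lambda>u. ?F u0 + h (u - u0))"
      by (intro plot_add plot_const open_ball)
    then have "plot (ball u0 \<rho>) ?F"
      by (rule plot_cong) (simp add: Fh)
    then show "\<exists>T. u0 \<in> T \<and> plot T ?F"
      using \<rho> by (intro exI[of _ "ball u0 \<rho>"]) simp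
  qed simp
  define lg where "lg p = \<kappa>' (f (\<phi> p))" for p
  \<comment> \<open>\<open>G\<close> is the image of the \<rho>-ball, written as a preimage under
    the charts so that its openness can be read off.\<close>
  define G where "G = {p \<in> U. \<phi> p \<in> X \<and> f (\<phi> p) \<in> \<kappa>' -` ball 0 \<rho>}"
  have FG: "?F ` ball 0 \<rho> = G"
  proof (intro equalityI subsetI)
    fix p assume "p \<in> ?F ` ball 0 \<rho>"
    then obtain u where u: "norm u < \<rho>" "p = h u"
      using H.ext_local by auto
    then show "p \<in> G"
      using kX[OF \<kappa>r(2)[OF u(1)]] X(3) by (auto simp: G_def h_def \<kappa>\<kappa>' subset_iff)
  next
    fix p assume p: "p \<in> G"
    let ?u = "\<kappa>' (f (\<phi> p))"
    have "norm ?u < \<rho>" "h ?u = p"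
      using p fX by (auto simp: G_def h_def \<kappa>\<kappa>')
    then show "p \<in> ?F ` ball 0 \<rho>"
      using H.ext_local[of ?u] by (intro image_eqI[of _ _ ?u]) auto
  qed
  have oX': "open (X \<inter> f -` (\<kappa>' -` ball 0 \<rho>))"
    by (rule continuous_open_preimage[OF smooth_on_continuous[OF f] X(1)])
      (intro open_vimage open_ball linear_continuous_on[OF bl\<kappa>'])
  have "G = {p \<in> U. \<phi> p \<in> X \<inter> f -` (\<kappa>' -` ball 0 \<rho>)}"
    by (auto simp: G_def)
  then have oG: "open G"
    using chart_open_preimage[OF UA oX'] by simp
  have lgF: "lg (?F u) = u" if "norm u < \<rho>" for u
    using that H.ext_local[OF that] kX[OF \<kappa>r(2)[OF that]] X(3) by (auto simp: lg_def h_def \<kappa>\<kappa>' subset_iff)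
  interpret CH: covering_homomorphism ?F lg \<rho>
  proof
    show "?F (u + v) = ?F u + ?F v" for u v
      by (rule H.ext_add)
    show "homeomorphism (ball 0 \<rho>) (?F ` ball 0 \<rho>) ?F lg"
    proof (rule homeomorphismI)
      show "continuous_on (ball 0 \<rho>) ?F"
        using plotD(2)[OF plot_F] continuous_on_subset by blast
      have "continuous_on G (\<lambda>p. f (\<phi> p))"
        by (rule continuous_on_compose2[OF smooth_on_continuous[OF f] continuous_on_subset[OF chart(3)[OF UA]]])
          (auto simp: G_def)
      then have "continuous_on G lg"
        unfolding lg_def by (rule bounded_linear.continuous_on[OF bl\<kappa>'])
      then show "continuous_on (?F ` ball 0 \<rho>) lg"
        by (simp only: FG)
    qed (use lgF in auto)
    show "open (?F ` ball 0 \<rho>)"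
      using oG by (simp only: FG)
  qed (use \<rho> conn in auto)
  \<comment> \<open>Near \<open>u\<close> the map is \<open>?F u + h (w - u)\<close>, and
    \<open>k\<close> has identity differential at 0. Differentiating along \<xi> thus applies the
    left invariant field with value \<open>\<kappa> \<xi>\<close> at the unit.\<close>
  have related: "field_related A ?F \<xi> (lf (\<kappa> \<xi>))" for \<xi>
    unfolding field_related_def
  proof (intro ballI allI)
    fix l u assume l: "l \<in> C"
    have "(k has_derivative (\<lambda>v. v)) (at (\<kappa> (u - u)))"
      using k(3) linear_0[OF \<kappa>(1)] by simp
    moreover have "((\<lambda>w. w - u) has_derivative (\<lambda>v. v)) (at u)"
      by (auto intro!: derivative_eq_intros)
    from bounded_linear.has_derivative[OF bl\<kappa> this]
    have d\<kappa>: "((\<lambda>w. \<kappa> (w - u)) has_derivative \<kappa>) (at u)" .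
    ultimately have "((\<lambda>w. k (\<kappa> (w - u))) has_derivative \<kappa>) (at u)"
      using has_derivative_compose[OF d\<kappa>, of k "\<lambda>v. v"] by simp
    moreover have "((\<lambda>y. l (?F u + pt y)) has_derivative (\<lambda>v. lf v l (?F u))) (at (k (\<kappa> (u - u))))"
      using translate_has_derivative[OF l] k(2) linear_0[OF \<kappa>(1)] by simp
    ultimately have "((\<lambda>w. l (?F u + pt (k (\<kappa> (w - u))))) has_derivative (\<lambda>\<xi>. lf (\<kappa> \<xi>) l (?F u))) (at u)"
      by (rule has_derivative_compose[of "\<lambda>w. k (\<kappa> (w - u))" _ _ _ "\<lambda>y. l (?F u + pt y)"])
    then have "((l \<circ> ?F) has_derivative (\<lambda>\<xi>. lf (\<kappa> \<xi>) l (?F u))) (at u)"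
    proof (rule has_derivative_transform_within_open[OF _ open_ball[of u \<rho>]])
      show "l (?F u + pt (k (\<kappa> (w - u)))) = (l \<circ> ?F) w" if "w \<in> ball u \<rho>" for w
        using arg_cong[OF Fh[OF that], of l] by (simp add: h_def)
    qed (use \<rho> in simp)
    from fd_eq[OF this] show "lf (\<kappa> \<xi>) l (?F u) = fd (l \<circ> ?F) u \<xi>"
      by simp
  qed
  have vhom: "vector_group_hom A J ?F"
    unfolding vector_group_hom_def
  proof (intro conjI allI)
    show "?F (u + v) = ?F u + ?F v" for u v
      by (rule H.ext_add)
    show "smooth_map euclidean_atlas A ?F"
      by (rule plot_UNIV_smooth_map[OF plot_F])
    show "\<exists>X\<in>VF. field_related A ?F \<xi> X \<and> field_related A ?F (\<i> *s \<xi>) (J X)" for \<xi>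
      using related[of \<xi>] related[of "\<i> *s \<xi>"] lf_VF[of "\<kappa> \<xi>"] by (auto simp: J)
  qed
  have iso: "vector_group_iso A J ?F" if sc: "simply_connected (UNIV :: 'g set)"
  proof -
    have bij: "bij ?F"
      by (rule CH.simply_connected_bij[OF sc])
    \<comment> \<open>Near a point p the inverse homomorphism is \<open>inv ?F p\<close> plus
      \<open>lg\<close> of the left translate by \<open>- p\<close>, so smoothness of
      \<open>lg\<close> near the unit is enough everywhere.\<close>
    have loc: "smooth_on (\<psi> ` Y) (\<lambda>x. inv ?F (inv_into Y \<psi> x))" if Y: "(Y, \<psi>) \<in> A" for Y \<psi>
    proof (rule smooth_on_local)
      let ?q = "inv_into Y \<psi>"
      fix x assume x: "x \<in> \<psi> ` Y"
      define p where "p = ?q x"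
      define u0 where "u0 = inv ?F p"
      have Fu0: "?F u0 = p"
        using bij by (simp add: u0_def bij_is_surj surj_f_inv_f)
      have pl: "plot (\<psi> ` Y) (\<lambda>z. - p + ?q z)"
        by (intro plot_add plot_const plot_chart Y chart(2)[OF Y])
      let ?T = "\<psi> ` Y \<inter> (\<lambda>z. - p + ?q z) -` G"
      have oT: "open ?T"
        by (rule plotD(4)[OF pl oG])
      have "0 \<in> G"
        unfolding FG[symmetric] using \<rho> CH.F_0 by (intro image_eqI[of _ _ 0]) auto
      then have xT: "x \<in> ?T"
        using x by (simp add: p_def)
      have \<phi>s: "smooth_on ?T (\<lambda>z. \<phi> (- p + ?q z))"
        by (rule smooth_on_subset[OF plotD(3)[OF pl UA]]) (auto simp: G_def)
      have "smooth_on ?T (\<lambda>z. f (\<phi> (- p + ?q z)))"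
        by (rule smooth_on_compose[OF oT X(1) _ \<phi>s f]) (auto simp: G_def)
      then have "smooth_on ?T (\<lambda>z. \<kappa>' (f (\<phi> (- p + ?q z))))"
        by (rule smooth_on_compose_linear[OF bl\<kappa>' oT])
      then have "smooth_on ?T (\<lambda>z. u0 + lg (- p + ?q z))"
        unfolding lg_def by (intro smooth_on_add oT smooth_on_const)
      moreover have "u0 + lg (- p + ?q z) = inv ?F (?q z)" if z: "z \<in> ?T" for z
      proof -
        obtain w where w: "norm w < \<rho>" "- p + ?q z = ?F w"
          using z unfolding FG[symmetric] by auto
        have "?F (u0 + w) = ?q z"
          using w(2) by (simp add: H.ext_add Fu0 w(2)[symmetric] add.assoc[symmetric])
        then have "inv ?F (?q z) = u0 + w"
          using bij by (metis bij_is_inj inv_f_f)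
        then show ?thesis
          using lgF[OF w(1)] w(2) by simp
      qed
      ultimately have "smooth_on ?T (\<lambda>z. inv ?F (?q z))"
        using smooth_on_cong[OF oT, of "\<lambda>z. u0 + lg (- p + ?q z)" "\<lambda>z. inv ?F (?q z)"] by simp
      then show "\<exists>T. open T \<and> x \<in> T \<and> smooth_on T (\<lambda>z. inv ?F (?q z))"
        using oT xT by blast
    qed
    have "continuous_on UNIV (inv ?F)"
    proof (rule continuous_at_imp_continuous_on, rule ballI)
      fix p
      obtain Y \<psi> where Y: "(Y, \<psi>) \<in> A" "p \<in> Y" using chart_exists by blast
      have "continuous_on Y (\<lambda>q. inv ?F (inv_into Y \<psi> (\<psi> q)))"
        by (rule continuous_on_compose2[OF smooth_on_continuous[OF loc[OF Y(1)]] chart(3)[OF Y(1)]]) auto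
      then have "continuous_on Y (inv ?F)"
        using chart(6)[OF Y(1)] by (simp cong: continuous_on_cong)
      then show "isCont (inv ?F) p"
        using Y chart(1)[OF Y(1)] continuous_on_eq_continuous_at by blast
    qed
    then have "smooth_map A euclidean_atlas (inv ?F)"
      using loc by (auto simp: smooth_map_def euclidean_atlas_def o_def)
    then show ?thesis
      using vhom bij by (simp add: vector_group_iso_def)
  qed
  show ?thesis
    unfolding covered_by_complex_vector_group_def
    using vhom CH.covering iso by blast
qed

end

theorem corollary1p6:
  fixes A :: "('g::{topological_group_add, t2_space}, real ^ 4) chart set"
    and g :: "'g vfield \<Rightarrow> 'g vfield \<Rightarrow> 'g \<Rightarrow> real"
    and J :: "'g vfield \<Rightarrow> 'g vfield"
    and s :: real
    and D :: "'g connection"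
  assumes "is_lie_group A"
    and "connected (UNIV :: 'g set)"
    and "riemannian_metric A g" and "left_invariant_metric A g"
    and "complex_structure A J" and "left_invariant_complex_structure A J"
    and "compatible A J g"
    and "s \<noteq> 0" and "s \<noteq> 2"
    and "gauduchon_connection A J g s D" and "flat A D"
  shows "covered_by_complex_vector_group A J \<or>
    (\<exists>X Y Z W q. q \<noteq> 0 \<and>
       orthonormal_basis g (lie_algebra A) [X, Y, Z, W] \<and>
       orthogonal_decomposition g (lie_algebra A) (span {W}) (span {X, Y, Z}) \<and>
       subalgebra (span {W}) (lie_algebra A) \<and>
       subalgebra (span {X, Y, Z}) (lie_algebra A) \<and>
       center (lie_algebra A) = span {W} \<and>
       bracket X Y = q *\<^sub>R Z \<and> bracket X Z = - (q *\<^sub>R Y) \<and> bracket Y Z = 0 \<and>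
       J X = W \<and> J Y = Z)"
proof -
  interpret lie_group A
    by unfold_locales (rule assms)
  obtain U \<phi> where U: "(U, \<phi>) \<in> A" "0 \<in> U"
    using chart_exists by blast
  interpret hermitian_group A U \<phi> g J
    by unfold_locales (use U assms in auto)
  obtain \<kappa> :: "complex ^ 2 \<Rightarrow> real ^ 4" where \<kappa>: "linear \<kappa>" "bij \<kappa>" "\<And>\<xi>. \<kappa> (\<i> *s \<xi>) = j (\<kappa> \<xi>)"
    "\<And>\<xi> \<eta>. ip (\<kappa> \<xi>) (\<kappa> \<eta>) = \<xi> \<bullet> \<eta>"
    using unitary_isomorphism_exists by blast
  interpret hermitian_group_frame A U \<phi> g J \<kappa>
    by unfold_locales (use \<kappa> in \<open>auto simp: linear_iff\<close>)
  consider "\<forall>X\<in>L. \<forall>Y\<in>L. bracket X Y = 0" | "\<not> (\<forall>X\<in>L. \<forall>Y\<in>L. bracket X Y = 0)"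
    by blast
  then show ?thesis
  proof cases
    case 1
    interpret abelian_lie_group_chart A U \<phi>
      by unfold_locales (use 1 lf_L in blast)
    have "covered_by_complex_vector_group A J"
      by (rule vector_group_covering[OF \<kappa>(1,2) _ assms(2)]) (simp add: \<kappa>(3) lf_j)
    then show ?thesis ..
  next
    case 2
    then show ?thesis
      using flat_dichotomy[OF assms(8-11)] by blast
  qed
qed

end
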